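(* Let $N>2$, let $f_1$ and $\alpha_*$ satisfy $(H_1)$–$(H_4)$ below, and let $f_2,f_3$ be positive continuous functions on $[\alpha_*,\infty)$. Then there exist constants $\alpha_1>\alpha_*$, $\epsilon_1>0$, $A_2>0$, $\alpha_2>\alpha_1+\epsilon_1$, $\epsilon_2>0$, $A_3>0$ such that the problem $$\Delta u+f(u)=0\ \text{in }\mathbb R^N,\qquad \lim_{|x|\to\infty}u(x)=0,$$ with $$f(s)=\begin{cases}f_1(s), & 0\le s\le\alpha_1,\\ L_1(s), & \alpha_1\le s\le\alpha_1+\epsilon_1,\\ A_2^2f_2(s), & \alpha_1+\epsilon_1\le s\le\alpha_2,\\ L_2(s), & \alpha_2\le s\le\alpha_2+\epsilon_2,\\ A_3^2f_3(s), & s\ge\alpha_2+\epsilon_2,\end{cases}$$ (extended oddly) has at least three ground state solutions.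
   Context: $L_1$ is the affine function whose graph is the segment from $(\alpha_1,f_1(\alpha_1))$ to $(\alpha_1+\epsilon_1,A_2^2f_2(\alpha_1+\epsilon_1))$; $L_2$ is the affine function whose graph is the segment from $(\alpha_2,A_2^2f_2(\alpha_2))$ to $(\alpha_2+\epsilon_2,A_3^2f_3(\alpha_2+\epsilon_2))$. A ground state is a nonnegative, nontrivial solution (compactly supported ones allowed). Hypotheses: $(H_1)$ $f_1\in C[0,\infty)\cap C^1(0,\infty)$, $f_1(0)=0$, there is $b\ge0$ with $f_1(s)>0$ for $s>b$, $f_1(s)\le0$ on $[0,b]$, and $f_1<0$ on $(0,\epsilon_0)$ for some $\epsilon_0>0$; with $F_1(s)=\int_0^sf_1$, there is a unique finite $\beta\ge b$ with $F_1(\beta)=0$. $(H_2)$ $(F_1/f_1)'(s)>(N-2)/(2N)$ for all $s>\beta$. $(H_3)$ $f_1(s)/(s-b)$ is increasing for $s>b$. $(H_4)$ the solution of $u''+\frac{N-1}{r}u'+f_1(u)=0$, $u(0)=\alpha_*$, $u'(0)=0$ is a ground state. *)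

theory Defs
  imports "HOL-Analysis.Analysis"
begin

text \<open>Radial ground state of  Delta u + f(u) = 0 in R^N, u -> 0 at infinity:
  u(r), r = |x|, with u'' + (N-1)/r u' + f(u) = 0 for r > 0, u'(0) = 0,
  u nonnegative, not identically zero, and u(r) -> 0 as r -> infinity.\<close>
definition radial_ground_state :: "nat \<Rightarrow> (real \<Rightarrow> real) \<Rightarrow> (real \<Rightarrow> real) \<Rightarrow> bool" where
  "radial_ground_state N f u \<longleftrightarrow>
     (\<exists>u'. (\<forall>r\<ge>0. (u has_real_derivative u' r) (at r within {0..}))
        \<and> u' 0 = 0
        \<and> (\<forall>r>0. (u' has_real_derivative (- ((real N - 1) / r) * u' r - f (u r))) (at r))
        \<and> (\<forall>r\<ge>0. u r \<ge> 0)
        \<and> (\<exists>r\<ge>0. u r \<noteq> 0)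
        \<and> (u \<longlongrightarrow> 0) at_top)"

definition affine_seg :: "real \<Rightarrow> real \<Rightarrow> real \<Rightarrow> real \<Rightarrow> real \<Rightarrow> real" where
  "affine_seg x0 y0 x1 y1 s = y0 + (y1 - y0) / (x1 - x0) * (s - x0)"

definition glued_pos ::
  "(real \<Rightarrow> real) \<Rightarrow> (real \<Rightarrow> real) \<Rightarrow> (real \<Rightarrow> real) \<Rightarrow>
   real \<Rightarrow> real \<Rightarrow> real \<Rightarrow> real \<Rightarrow> real \<Rightarrow> real \<Rightarrow> real \<Rightarrow> real" where
  "glued_pos f1 f2 f3 \<alpha>1 \<epsilon>1 A2 \<alpha>2 \<epsilon>2 A3 s =
     (if s \<le> \<alpha>1 then f1 s
      else if s \<le> \<alpha>1 + \<epsilon>1 then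
        affine_seg \<alpha>1 (f1 \<alpha>1) (\<alpha>1 + \<epsilon>1) (A2^2 * f2 (\<alpha>1 + \<epsilon>1)) s
      else if s \<le> \<alpha>2 then A2^2 * f2 s
      else if s \<le> \<alpha>2 + \<epsilon>2 then
        affine_seg \<alpha>2 (A2^2 * f2 \<alpha>2) (\<alpha>2 + \<epsilon>2) (A3^2 * f3 (\<alpha>2 + \<epsilon>2)) s
      else A3^2 * f3 s)"

definition glued ::
  "(real \<Rightarrow> real) \<Rightarrow> (real \<Rightarrow> real) \<Rightarrow> (real \<Rightarrow> real) \<Rightarrow>
   real \<Rightarrow> real \<Rightarrow> real \<Rightarrow> real \<Rightarrow> real \<Rightarrow> real \<Rightarrow> real \<Rightarrow> real" where
  "glued f1 f2 f3 \<alpha>1 \<epsilon>1 A2 \<alpha>2 \<epsilon>2 A3 s =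
     (if s \<ge> 0 then glued_pos f1 f2 f3 \<alpha>1 \<epsilon>1 A2 \<alpha>2 \<epsilon>2 A3 s
      else - glued_pos f1 f2 f3 \<alpha>1 \<epsilon>1 A2 \<alpha>2 \<epsilon>2 A3 (- s))"

end

theory Submission
  imports Defs "HOL-Complex_Analysis.Great_Picard"
begin

text \<open>
  All solutions considered are radial, and the nonlinearity is changed to \<open>0\<close> on the negative axis. A solution
  is \<^emph>\<open>crossing\<close> if it becomes negative and \<^emph>\<open>trapped\<close> if its energy \<open>u'\<^sup>2 / 2 + F(u)\<close> becomes negative while
  it is positive. Between a crossing and a trapped initial height there is the height of a ground state.

  Regard radius and speed of a decreasing solution as functions of its level. Above \<open>\<beta>\<close> the Pohozaev-type
  identity provided by (H2), and below \<open>\<beta>\<close> the quantity \<open>r sqrt (u'\<^sup>2 + 2 F(u))\<close> (both in the spirit of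
  Erbe and Tang), show that every solution starting above an untrapped solution is crossing. Hence for \<open>f1\<close> all
  heights between \<open>0\<close> and \<open>\<alpha>*\<close> are trapped and those above \<open>\<alpha>*\<close> are crossing. This persists slightly above
  \<open>\<alpha>*\<close> for the glued function. If \<open>A2\<close> is large, a solution starting at a suitable level in the second range
  comes down to \<open>\<alpha>1\<close> almost at once and from then on looks like an \<open>f1\<close>-solution starting just below \<open>\<alpha>*\<close>, so
  it is trapped. If \<open>A3\<close> is small, a solution starting high enough reaches \<open>\<alpha>2 + \<epsilon>2\<close> at a large radius, where
  friction is negligible, so it is crossing. The two changes of type give the second and the third ground state.

  The initial value problem need not be uniquely solvable, so the shooting argument is applied to Lipschitz
  approximations of the nonlinearity and followed by a compactness argument.
\<close>

section \<open>Radial solutions\<close>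

text \<open>The functions \<open>f2\<close>, \<open>f3\<close> are only continuous and
  \<open>f1\<close> need not be Lipschitz at 0, so a height does not determine a solution.
  Statements about a height therefore speak of all solutions starting there, and solutions are
  handled through the integral equation \<open>u' = - rmean n (f(u))\<close>, which is stable under
  limits.

  The second range works because a fast drop is nearly harmonic when seen from outside: a source
  concentrated in a ball of radius of order \<open>1 / A\<close> produces a constant plus
  \<open>q / r^(n-1)\<close> outside the ball. The constant is controlled by the levels and by the
  shape of \<open>f2\<close>, independently of \<open>A\<close>; a large \<open>A\<close> only
  shrinks the ball, and with it \<open>q\<close>. What has to be arranged is that this constant
  lands between 0 and \<open>\<alpha>*\<close>. Starting close above \<open>\<alpha>*\<close>, where
  \<open>f2\<close> is almost constant, makes it computable up to harmless factors.

  The dimension enters through \<open>n \<ge> 2\<close>: the tail \<open>r^(1-n)\<close> decays at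
  infinity, and \<open>q\<close>, of order \<open>r^(n-1)\<close> in the radius of the ball,
  vanishes with it.\<close>

definition rint :: "nat \<Rightarrow> (real \<Rightarrow> real) \<Rightarrow> real \<Rightarrow> real" where
  "rint n g r = integral {0..r} (\<lambda>t. t ^ n * g t)"

text \<open>With \<open>n\<close> one less than the dimension the radial equation is
  \<open>(r^n u')' = - r^n f(u)\<close>, so \<open>u'\<close> is minus this mean of
  \<open>f(u)\<close>. At radius 0 the value is 0 because the integral is, in accordance with
  \<open>u'(0) = 0\<close>.\<close>

definition rmean :: "nat \<Rightarrow> (real \<Rightarrow> real) \<Rightarrow> real \<Rightarrow> real" where
  "rmean n g r = rint n g r / r ^ n"

text \<open>As for ground states, only the one-sided derivative 0 of \<open>u\<close> at the origin
  is demanded; continuity of \<open>v\<close> there is a consequence (\<open>v_eq\<close>). Values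
  at negative radii are left free.\<close>

definition rsol :: "nat \<Rightarrow> (real \<Rightarrow> real) \<Rightarrow> (real \<Rightarrow> real) \<Rightarrow> (real \<Rightarrow> real) \<Rightarrow> bool" where
  "rsol n f u v \<longleftrightarrow>
     (\<forall>r\<ge>0. (u has_real_derivative v r) (at r within {0..})) \<and> v 0 = 0 \<and>
     (\<forall>r>0. (v has_real_derivative (- (n / r) * v r - f (u r))) (at r))"

lemma real_mvt:
  fixes f :: "real \<Rightarrow> real"
  assumes "a < b" "continuous_on {a..b} f"
    and "\<And>x. a < x \<Longrightarrow> x < b \<Longrightarrow> (f has_real_derivative f' x) (at x)"
  obtains z where "a < z" "z < b" "f b - f a = (b - a) * f' z"
proof -
  obtain l z where "a < z" "z < b" "DERIV f z :> l" "f b - f a = (b - a) * l"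
    using MVT [of a b f] assms real_differentiable_def by blast
  with assms(3) [of z] show ?thesis using DERIV_unique that by blast
qed

lemma DERIV_pow_Suc:
  "n = Suc m \<Longrightarrow> ((\<lambda>x::real. x ^ n) has_real_derivative n * r ^ m) (at r)"
  using DERIV_pow [of n r UNIV] by simp

lemma has_real_derivative_integral:
  fixes g :: "real \<Rightarrow> real"
  assumes g: "continuous_on {0..} g" and r: "0 < r"
  shows "((\<lambda>x. integral {0..x} g) has_real_derivative g r) (at r)"
proof -
  have "((\<lambda>x. integral {0..x} g) has_real_derivative g r) (at r within {0..r+1})"
    by (rule integral_has_real_derivative) (use r in \<open>auto intro: continuous_on_subset [OF g]\<close>)
  moreover have "at r within {0..r+1} = at r"
    by (rule at_within_interior) (use r in \<open>simp add: interior_atLeastAtMost_real\<close>)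
  ultimately show ?thesis by simp
qed

lemma has_real_derivative_integral_within:
  fixes g :: "real \<Rightarrow> real"
  assumes g: "continuous_on {0..} g" and r: "0 \<le> r"
  shows "((\<lambda>x. integral {0..x} g) has_real_derivative g r) (at r within {0..})"
proof -
  have "((\<lambda>x. integral {0..x} g) has_real_derivative g r) (at r within {0..r+1})"
    by (rule integral_has_real_derivative) (use r in \<open>auto intro: continuous_on_subset [OF g]\<close>)
  moreover have "at r within {0..r+1} = at r within {0..}"
    by (rule at_within_nhd [of _ "{..<r+1}"]) (use r in auto)
  ultimately show ?thesis by simp
qed

lemma continuous_on_rint_arg: "continuous_on S g \<Longrightarrow> continuous_on S (\<lambda>t::real. t ^ n * g t :: real)"
  by (intro continuous_intros)

lemma rint_has_derivative:
  assumes "continuous_on {0..} g" "0 < r"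
  shows "(rint n g has_real_derivative r ^ n * g r) (at r)"
  unfolding rint_def
  using has_real_derivative_integral [OF continuous_on_rint_arg [OF assms(1)] assms(2)] .

lemma rint_arg_integrable:
  assumes "continuous_on {0..} g"
  shows "(\<lambda>t::real. t ^ n * g t :: real) integrable_on {0..r}"
  by (rule integrable_continuous_real)
     (auto intro!: continuous_on_rint_arg continuous_on_subset [OF assms])

lemma has_integral_power:
  assumes "0 \<le> (r::real)"
  shows "((\<lambda>t. t ^ n) has_integral r ^ Suc n / Suc n) {0..r}"
proof -
  have "((\<lambda>t. t ^ n) has_integral (r ^ Suc n / Suc n - 0 ^ Suc n / Suc n)) {0..r}"
  proof (rule fundamental_theorem_of_calculus [OF assms])
    fix x assume "x \<in> {0..r}"
    have "((\<lambda>t. t ^ Suc n / Suc n) has_real_derivative x ^ n) (at x within {0..r})"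
      by (auto intro!: derivative_eq_intros simp del: power_Suc of_nat_Suc)
    then show "((\<lambda>t. t ^ Suc n / Suc n) has_vector_derivative x ^ n) (at x within {0..r})"
      by (simp add: has_real_derivative_iff_has_vector_derivative)
  qed
  then show ?thesis by simp
qed

lemma rint_mono:
  assumes g: "continuous_on {0..} g" and h: "continuous_on {0..} h"
    and "\<And>t. t \<in> {0..r} \<Longrightarrow> g t \<le> h t"
  shows "rint n g r \<le> rint n h r"
  unfolding rint_def
  by (rule integral_le) (use assms in \<open>auto intro!: rint_arg_integrable mult_left_mono\<close>)


lemma rint_const: "0 \<le> r \<Longrightarrow> rint n (\<lambda>_. M) r = M * r ^ Suc n / Suc n"
  using has_integral_mult_left [OF has_integral_power [of r n], of M]
  by (auto simp: rint_def mult.commute dest: integral_unique)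

lemma rint_bounds:
  assumes g: "continuous_on {0..} g" and r: "0 \<le> r"
  shows "(\<And>t. t \<in> {0..r} \<Longrightarrow> g t \<le> M) \<Longrightarrow> rint n g r \<le> M * r ^ Suc n / Suc n"
    and "(\<And>t. t \<in> {0..r} \<Longrightarrow> M \<le> g t) \<Longrightarrow> M * r ^ Suc n / Suc n \<le> rint n g r"
proof -
  show "rint n g r \<le> M * r ^ Suc n / Suc n" if "\<And>t. t \<in> {0..r} \<Longrightarrow> g t \<le> M"
    using rint_mono [of g "\<lambda>_. M" r n] rint_const [OF r, of n M] g that by simp
  show "M * r ^ Suc n / Suc n \<le> rint n g r" if "\<And>t. t \<in> {0..r} \<Longrightarrow> M \<le> g t"
    using rint_mono [of "\<lambda>_. M" g r n] rint_const [OF r, of n M] g that by simp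
qed

lemma rmean_bounds:
  assumes g: "continuous_on {0..} g" and r: "0 \<le> r"
  shows "(\<And>t. t \<in> {0..r} \<Longrightarrow> g t \<le> M) \<Longrightarrow> rmean n g r \<le> M * r / Suc n"
    and "(\<And>t. t \<in> {0..r} \<Longrightarrow> M \<le> g t) \<Longrightarrow> M * r / Suc n \<le> rmean n g r"
proof -
  show "rmean n g r \<le> M * r / Suc n" if "\<And>t. t \<in> {0..r} \<Longrightarrow> g t \<le> M"
  proof (cases "r = 0")
    case False
    then have "rint n g r / r ^ n \<le> (M * r ^ Suc n / Suc n) / r ^ n"
      using rint_bounds(1) [OF g r that] r by (intro divide_right_mono) auto
    with False show ?thesis by (simp add: rmean_def)
  qed (simp add: rmean_def rint_def)
  show "M * r / Suc n \<le> rmean n g r" if "\<And>t. t \<in> {0..r} \<Longrightarrow> M \<le> g t"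
  proof (cases "r = 0")
    case False
    then have "(M * r ^ Suc n / Suc n) / r ^ n \<le> rint n g r / r ^ n"
      using rint_bounds(2) [OF g r that] r by (intro divide_right_mono) auto
    with False show ?thesis by (simp add: rmean_def)
  qed (simp add: rmean_def rint_def)
qed

lemma rmean_abs_bound:
  assumes g: "continuous_on {0..} g" and r: "0 \<le> r"
    and M: "\<And>t. t \<in> {0..r} \<Longrightarrow> \<bar>g t\<bar> \<le> M"
  shows "\<bar>rmean n g r\<bar> \<le> M * r"
proof -
  have M0: "0 \<le> M" using M [of 0] r by auto
  have "rmean n g r \<le> M * r / Suc n"
    by (rule rmean_bounds(1) [OF g r]) (use M in \<open>auto simp: abs_le_iff\<close>)
  moreover have "- M * r / Suc n \<le> rmean n g r"
    by (rule rmean_bounds(2) [OF g r]) (use M in \<open>force simp: abs_le_iff\<close>)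
  moreover have "M * r / Suc n \<le> M * r / 1"
    by (rule divide_left_mono) (use M0 r in auto)
  ultimately show ?thesis by (auto simp: abs_le_iff)
qed

lemma rmean_zero [simp]: "rmean n g 0 = 0"
  by (simp add: rmean_def rint_def)

lemma continuous_on_rmean:
  assumes g: "continuous_on {0..} g"
  shows "continuous_on {0..} (rmean n g)"
proof -
  have "continuous (at r within {0..}) (rmean n g)" if r0: "0 \<le> r" for r
  proof (cases "r = 0")
    case False
    then have r: "0 < r" using r0 by simp
    have "isCont (rint n g) r"
      using rint_has_derivative [OF g r] DERIV_isCont by blast
    then have "isCont (rmean n g) r"
      unfolding rmean_def [abs_def] by (intro continuous_intros) (use r in auto)
    then show ?thesis by (rule continuous_at_imp_continuous_at_within)
  next
    case True
    \<comment> \<open>At the origin continuity comes from the bound \<open>M * x\<close> for the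
      mean, with \<open>M\<close> a bound for \<open>g\<close> near 0.\<close>
    have "compact (g ` {0..1})"
      by (rule compact_continuous_image) (auto intro: continuous_on_subset [OF g])
    then have "bounded (g ` {0..1})" by (rule compact_imp_bounded)
    then obtain M where M: "\<forall>t\<in>{0..1}. \<bar>g t\<bar> \<le> M"
      by (auto simp: bounded_iff)
    have "((rmean n g) \<longlongrightarrow> 0) (at 0 within {0..})"
    proof (rule Lim_null_comparison)
      have "\<forall>\<^sub>F x in at 0 within {0..}. x \<in> {0..1::real}"
        unfolding eventually_at by (rule exI [of _ 1]) (auto simp: dist_real_def)
      then show "\<forall>\<^sub>F x in at 0 within {0..}. norm (rmean n g x) \<le> M * x"
      proof eventually_elim
        case (elim x)
        then have "\<bar>rmean n g x\<bar> \<le> M * x"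
          using M by (intro rmean_abs_bound [OF g]) auto
        then show ?case by simp
      qed
      have "continuous (at 0 within {0..}) (\<lambda>x::real. M * x)" by (intro continuous_intros)
      then show "((\<lambda>x. M * x) \<longlongrightarrow> 0) (at 0 within {0..})"
        by (simp add: continuous_within)
    qed
    then show ?thesis using True by (simp add: continuous_within)
  qed
  then show ?thesis by (simp add: continuous_on_eq_continuous_within)
qed

lemma rmean_has_derivative:
  assumes "continuous_on {0..} g" "0 < r" "1 \<le> n"
  shows "(rmean n g has_real_derivative g r - n / r * rmean n g r) (at r)"
proof -
  obtain m where m: "n = Suc m" using assms(3) by (cases n) auto
  have "((\<lambda>r. rint n g r / r ^ n) has_real_derivative
         ((r ^ n * g r) * r ^ n - rint n g r * (n * r ^ m)) / (r ^ n * r ^ n)) (at r)"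
    using assms(2) by (intro DERIV_divide rint_has_derivative assms DERIV_pow_Suc m) auto
  moreover have "((r ^ n * g r) * r ^ n - rint n g r * (n * r ^ m)) / (r ^ n * r ^ n) = g r - n / r * rmean n g r"
    using assms(2) unfolding rmean_def m by (simp add: field_simps)
  ultimately show ?thesis by (simp add: rmean_def [abs_def])
qed

text \<open>Converse of \<open>v_eq\<close> and \<open>u_eq\<close>: limits and truncated solutions
  are first obtained from the integral equation, and this returns them to the differential
  equation.\<close>

lemma rsolI:
  assumes f: "continuous_on UNIV f" and u: "continuous_on {0..} u" and n: "1 \<le> n"
    and eq: "\<And>r. 0 \<le> r \<Longrightarrow> u r = a - integral {0..r} (rmean n (\<lambda>t. f (u t)))"
  shows "rsol n f u (\<lambda>r. - rmean n (\<lambda>t. f (u t)) r)"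
  unfolding rsol_def
proof (intro conjI allI impI)
  have g: "continuous_on {0..} (\<lambda>t. f (u t))"
    by (rule continuous_on_compose2 [OF f u]) auto
  show "- rmean n (\<lambda>t. f (u t)) 0 = 0" by simp
  fix r :: real
  show "(u has_real_derivative - rmean n (\<lambda>t. f (u t)) r) (at r within {0..})" if r: "0 \<le> r"
  proof -
    have "((\<lambda>r. a - integral {0..r} (rmean n (\<lambda>t. f (u t)))) has_real_derivative
           0 - rmean n (\<lambda>t. f (u t)) r) (at r within {0..})"
      by (intro DERIV_diff DERIV_const has_real_derivative_integral_within continuous_on_rmean g r)
    then have "((\<lambda>r. a - integral {0..r} (rmean n (\<lambda>t. f (u t)))) has_real_derivative
           - rmean n (\<lambda>t. f (u t)) r) (at r within {0..})" by simp
    then show ?thesis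
      by (rule has_field_derivative_transform_within [where d = 1]) (use r in \<open>auto simp: eq\<close>)
  qed
  show "((\<lambda>r. - rmean n (\<lambda>t. f (u t)) r) has_real_derivative
      - (n / r) * - rmean n (\<lambda>t. f (u t)) r - f (u r)) (at r)" if r: "0 < r"
    using DERIV_minus [OF rmean_has_derivative [OF g r n]] by simp
qed

locale radial_solution =
  fixes n :: nat and f u v :: "real \<Rightarrow> real"
  assumes n: "2 \<le> n" and contf: "continuous_on UNIV f" and sol: "rsol n f u v"
begin

lemma u_deriv_within: "0 \<le> r \<Longrightarrow> (u has_real_derivative v r) (at r within {0..})"
  using sol by (auto simp: rsol_def)

lemma u_deriv: "0 < r \<Longrightarrow> (u has_real_derivative v r) (at r)"
  using u_deriv_within [of r] at_within_interior [of r "{0..}"]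
  by (simp add: interior_real_atLeast)

lemma v_deriv: "0 < r \<Longrightarrow> (v has_real_derivative (- (n / r) * v r - f (u r))) (at r)"
  using sol by (auto simp: rsol_def)

lemma v0 [simp]: "v 0 = 0" using sol by (auto simp: rsol_def)

lemma u_cont: "continuous_on {0..} u"
  unfolding continuous_on_eq_continuous_within
  by (auto intro: DERIV_continuous u_deriv_within)

lemma fu_cont: "continuous_on {0..} (\<lambda>t. f (u t))"
  by (rule continuous_on_compose2 [OF contf u_cont]) auto

text \<open>\<open>r\<^sup>n u' + \<integral>\<^sub>0\<^sup>r t\<^sup>n f(u)\<close> is constant; as \<open>u'(0) = 0\<close>, the mean value theorem gives points
  tending to \<open>0\<close> at which \<open>u'\<close> tends to \<open>0\<close>, so that the constant vanishes.\<close>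
lemma v_eq:
  assumes "0 \<le> r"
  shows "v r = - rmean n (\<lambda>t. f (u t)) r"
proof (cases "r = 0")
  case False
  define C where "C r = r ^ n * (v r + rmean n (\<lambda>t. f (u t)) r)" for r
  have C: "(C has_real_derivative 0) (at r)" if r: "0 < r" for r
  proof -
    obtain m where m: "n = Suc m" using n by (cases n) auto
    have "(C has_real_derivative (n * r ^ m) * (v r + rmean n (\<lambda>t. f (u t)) r) +
        ((- (n / r) * v r - f (u r)) + (f (u r) - n / r * rmean n (\<lambda>t. f (u t)) r)) * r ^ n) (at r)"
      unfolding C_def [abs_def] using r n
      by (intro DERIV_mult DERIV_add v_deriv rmean_has_derivative fu_cont DERIV_pow_Suc [OF m]) auto
    moreover have "(n * r ^ m) * (v r + rmean n (\<lambda>t. f (u t)) r) +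
        ((- (n / r) * v r - f (u r)) + (f (u r) - n / r * rmean n (\<lambda>t. f (u t)) r)) * r ^ n = 0"
      using r by (simp add: field_simps m)
    ultimately show ?thesis by simp
  qed
  have const: "C r = C 1" if "0 < r" for r
    by (rule DERIV_zero_connected_constant [of "{0<..}" "{}"])
       (use that C in \<open>auto intro!: continuous_at_imp_continuous_on DERIV_isCont\<close>)
  have "C 1 = 0"
  proof (rule ccontr)
    assume C1: "C 1 \<noteq> 0"
    have "(u has_real_derivative 0) (at 0 within {0..})" using u_deriv_within [of 0] by simp
    then have lim: "((\<lambda>y. (u y - u 0) / y) \<longlongrightarrow> 0) (at 0 within {0..})"
      by (simp add: has_field_derivative_iff)
    have lim2: "((rmean n (\<lambda>t. f (u t))) \<longlongrightarrow> 0) (at 0 within {0..})"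
      using continuous_on_rmean [OF fu_cont, of n]
      unfolding continuous_on_eq_continuous_within continuous_within by force
    have "\<forall>\<^sub>F y in at 0 within {0..}. \<bar>(u y - u 0) / y\<bar> < \<bar>C 1\<bar> / 2"
      using order_tendstoD(2) [OF tendsto_rabs_zero [OF lim], of "\<bar>C 1\<bar> / 2"] C1 by simp
    then obtain d1 where d1: "d1 > 0"
      "\<And>y. 0 < y \<Longrightarrow> y < d1 \<Longrightarrow> \<bar>(u y - u 0) / y\<bar> < \<bar>C 1\<bar> / 2"
      unfolding eventually_at by (auto simp: dist_real_def)
    have "\<forall>\<^sub>F y in at 0 within {0..}. \<bar>rmean n (\<lambda>t. f (u t)) y\<bar> < \<bar>C 1\<bar> / 2"
      using order_tendstoD(2) [OF tendsto_rabs_zero [OF lim2], of "\<bar>C 1\<bar> / 2"] C1 by simp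
    then obtain d2 where d2: "d2 > 0"
      "\<And>y. 0 < y \<Longrightarrow> y < d2 \<Longrightarrow> \<bar>rmean n (\<lambda>t. f (u t)) y\<bar> < \<bar>C 1\<bar> / 2"
      unfolding eventually_at by (auto simp: dist_real_def)
    define y where "y = min (min d1 d2) 1 / 2"
    have y: "0 < y" "y < d1" "y < d2" "y < 1" using d1(1) d2(1) by (auto simp: y_def)
    obtain z where z: "0 < z" "z < y" "u y - u 0 = (y - 0) * v z"
      by (rule real_mvt [of 0 y u v])
         (use y in \<open>auto intro: u_deriv continuous_on_subset [OF u_cont]\<close>)
    have "\<bar>v z\<bar> < \<bar>C 1\<bar> / 2" using d1(2) [of y] y z by simp
    moreover have "\<bar>rmean n (\<lambda>t. f (u t)) z\<bar> < \<bar>C 1\<bar> / 2" using d2(2) [of z] y z by simp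
    ultimately have "\<bar>v z + rmean n (\<lambda>t. f (u t)) z\<bar> < \<bar>C 1\<bar>" by linarith
    moreover have "z ^ n \<le> 1" using z y by (intro power_le_one) auto
    then have "\<bar>C z\<bar> \<le> \<bar>v z + rmean n (\<lambda>t. f (u t)) z\<bar>"
      using z by (simp add: C_def abs_mult mult_left_le_one_le)
    ultimately show False using const [of z] z by simp
  qed
  then show ?thesis using const [of r] False assms by (simp add: C_def)
qed simp

lemma v_cont: "continuous_on {0..} v"
  by (rule continuous_on_eq [where f = "\<lambda>r. - rmean n (\<lambda>t. f (u t)) r"])
     (auto intro!: continuous_intros continuous_on_rmean fu_cont simp: v_eq)

lemma u_eq:
  assumes "0 \<le> r"
  shows "u r = u 0 - integral {0..r} (rmean n (\<lambda>t. f (u t)))"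
proof -
  have "(v has_integral u r - u 0) {0..r}"
  proof (rule fundamental_theorem_of_calculus [OF assms])
    fix x assume "x \<in> {0..r}"
    then have "(u has_real_derivative v x) (at x within {0..r})"
      by (intro has_field_derivative_subset [OF u_deriv_within]) auto
    then show "(u has_vector_derivative v x) (at x within {0..r})"
      by (simp add: has_real_derivative_iff_has_vector_derivative)
  qed
  then have "integral {0..r} v = u r - u 0" by (rule integral_unique)
  moreover have "integral {0..r} v = integral {0..r} (\<lambda>t. - rmean n (\<lambda>t. f (u t)) t)"
    by (rule integral_cong) (simp add: v_eq)
  ultimately show ?thesis by simp
qed

end

section \<open>Energy\<close>

definition crossing :: "(real \<Rightarrow> real) \<Rightarrow> bool" where
  "crossing u \<longleftrightarrow> (\<exists>R\<ge>0. u R < 0)"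

text \<open>Positivity on all of \<open>[0,R]\<close> excludes an earlier crossing; with the decay
  of the energy it makes crossing and trapped exclusive. Both notions are witnessed at a finite
  radius, which makes them open conditions.\<close>

definition trapped :: "(real \<Rightarrow> real) \<Rightarrow> (real \<Rightarrow> real) \<Rightarrow> (real \<Rightarrow> real) \<Rightarrow> bool" where
  "trapped F u v \<longleftrightarrow> (\<exists>R\<ge>0. (\<forall>r\<in>{0..R}. 0 < u r) \<and> (v R)\<^sup>2 / 2 + F (u R) < 0)"

lemma first_zero:
  fixes g :: "real \<Rightarrow> real"
  assumes g: "continuous_on {a..b} g" and a: "g a < 0" and b: "0 \<le> g b" and ab: "a \<le> b"
  obtains c where "a < c" "c \<le> b" "g c = 0" "\<And>x. a \<le> x \<Longrightarrow> x < c \<Longrightarrow> g x < 0"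
proof -
  define Z where "Z = {x\<in>{a..b}. g x = 0}"
  have Z0: "\<exists>z. a \<le> z \<and> z \<le> x \<and> g z = 0" if "x \<in> {a..b}" "0 \<le> g x" for x
    by (rule IVT') (use that a in \<open>auto intro: continuous_on_subset [OF g]\<close>)
  have "closed Z" unfolding Z_def
    by (rule continuous_closed_preimage_constant [OF g]) simp
  have "Z \<noteq> {}" using Z0 [of b] ab b by (auto simp: Z_def)
  have "bdd_below Z" by (rule bdd_belowI [of _ a]) (auto simp: Z_def)
  define c where "c = Inf Z"
  have cZ: "c \<in> Z" unfolding c_def by (rule closed_contains_Inf) fact+
  have lt: "g x < 0" if "a \<le> x" "x < c" for x
  proof (rule ccontr)
    assume "\<not> g x < 0"
    moreover have "x \<in> {a..b}" using that cZ by (simp add: Z_def)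
    ultimately obtain z where "a \<le> z" "z \<le> x" "g z = 0"
      using Z0 [of x] by auto
    then have "z \<in> Z" using that cZ by (auto simp: Z_def)
    then have "c \<le> z" unfolding c_def by (rule cInf_lower) fact
    with \<open>z \<le> x\<close> that show False by simp
  qed
  show ?thesis
    by (rule that [of c]) (use cZ a lt in \<open>auto simp: Z_def order_less_le\<close>)
qed

locale energy_solution = radial_solution +
  fixes F :: "real \<Rightarrow> real"
  assumes F_deriv: "(F has_real_derivative f s) (at s)"
begin

definition E :: "real \<Rightarrow> real" where "E r = (v r)\<^sup>2 / 2 + F (u r)"

lemma F_cont: "continuous_on S F"
  by (intro continuous_at_imp_continuous_on ballI) (rule DERIV_isCont [OF F_deriv])

lemma E_cont: "continuous_on {0..} E"
  unfolding E_def [abs_def]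
  by (intro continuous_intros v_cont continuous_on_compose2 [OF F_cont u_cont]) auto

lemma E_deriv: "0 < r \<Longrightarrow> (E has_real_derivative - (n / r) * (v r)\<^sup>2) (at r)"
  unfolding E_def [abs_def]
  by (auto intro!: derivative_eq_intros v_deriv DERIV_chain2 [OF F_deriv u_deriv])
     (simp add: algebra_simps power2_eq_square)

lemma E_diff:
  assumes "0 \<le> r" "r < s"
  obtains z where "r < z" "z < s" "E s = E r - (s - r) * ((n / z) * (v z)\<^sup>2)"
proof -
  obtain z where "r < z" "z < s" "E s - E r = (s - r) * (- (n / z) * (v z)\<^sup>2)"
    by (rule real_mvt [of r s E "\<lambda>z. - (n / z) * (v z)\<^sup>2"])
       (use assms in \<open>auto intro!: E_deriv [simplified] continuous_on_subset [OF E_cont]\<close>)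
  then show ?thesis using that by simp
qed

lemma E_antimono:
  assumes "0 \<le> r" "r \<le> s"
  shows "E s \<le> E r"
proof (cases "r = s")
  case False
  then obtain z where "r < z" "z < s" "E s = E r - (s - r) * ((n / z) * (v z)\<^sup>2)"
    using E_diff [of r s] assms by auto
  moreover have "0 \<le> (s - r) * ((n / z) * (v z)\<^sup>2)"
    using assms calculation by simp
  ultimately show ?thesis by simp
qed simp

lemma F_le_E: "F (u r) \<le> E r" by (simp add: E_def)

lemma E0: "E 0 = F (u 0)" by (simp add: E_def)

text \<open>At a zero of \<open>u\<close> the energy is nonnegative, so a solution with negative energy stays positive.\<close>
lemma trapped_not_crossing:
  assumes "trapped F u v" "F 0 = 0"
  shows "\<not> crossing u"
proof
  assume "crossing u"
  then obtain S where S: "0 \<le> S" "u S < 0" by (auto simp: crossing_def)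
  obtain R where R: "0 \<le> R" "\<And>r. r \<in> {0..R} \<Longrightarrow> 0 < u r" "E R < 0"
    using assms by (auto simp: trapped_def E_def)
  have "R < S" using R(2) [of S] S by force
  obtain z where "R \<le> z" "u z = 0"
    using IVT2' [of u S 0 R] R(1) R(2) [of R] S \<open>R < S\<close> continuous_on_subset [OF u_cont, of "{R..S}"]
    by force
  then have "0 \<le> E z" using assms(2) by (simp add: E_def)
  with E_antimono [of R z] R \<open>R \<le> z\<close> show False by simp
qed

lemma escape:
  assumes k: "0 < k" and R: "0 \<le> R" and v: "\<And>r. R < r \<Longrightarrow> v r \<le> - k"
  shows "\<exists>r\<ge>R. u r < 0"
proof -
  \<comment> \<open>At slope at most \<open>-k\<close> this radius suffices for a descent by
    \<open>\<bar>u R\<bar> + 1\<close>.\<close>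
  define T where "T = R + (\<bar>u R\<bar> + 1) / k"
  have T: "R < T" using k by (simp add: T_def)
  obtain z where z: "R < z" "z < T" "u T - u R = (T - R) * v z"
    by (rule real_mvt [of R T u v])
       (use T R in \<open>auto intro: u_deriv continuous_on_subset [OF u_cont]\<close>)
  have "(T - R) * v z \<le> (T - R) * (- k)"
    using v [OF z(1)] T by (intro mult_left_mono) auto
  also have "\<dots> = - (\<bar>u R\<bar> + 1)" using k by (simp add: T_def)
  finally have "u T < 0" using z(3) by linarith
  with T show ?thesis by (intro exI [of _ T]) auto
qed

end

text \<open>The features shared by \<open>f1\<close> extended by 0 and by all glued and truncated
  functions: a single well of \<open>F\<close> with bottom at \<open>b\<close> and right end
  \<open>\<beta>\<close>. (H2) stays outside, being available for \<open>f1\<close> only.\<close>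

locale well =
  fixes f F :: "real \<Rightarrow> real" and b \<beta> :: real
  assumes f_contU: "continuous_on UNIV f"
    and F_derivU: "(F has_real_derivative f s) (at s)"
    and f_nonpos0: "s \<le> 0 \<Longrightarrow> f s = 0"
    and F_nonpos0: "s \<le> 0 \<Longrightarrow> F s = 0"
    and b_pos: "0 < b" and b_less: "b < \<beta>"
    and f_le: "s \<le> b \<Longrightarrow> f s \<le> 0"
    and f_pos: "b < s \<Longrightarrow> 0 < f s"
    and F_neg: "0 < s \<Longrightarrow> s < \<beta> \<Longrightarrow> F s < 0"
    and F_beta: "F \<beta> = 0"
begin

lemma F_contU: "continuous_on S F"
  by (intro continuous_at_imp_continuous_on ballI) (rule DERIV_isCont [OF F_derivU])

lemma F_strict_mono:
  assumes "b \<le> s" "s < t"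
  shows "F s < F t"
proof -
  obtain z where "s < z" "z < t" "F t - F s = (t - s) * f z"
    by (rule real_mvt [OF assms(2) F_contU]) (use F_derivU in auto)
  with f_pos [of z] assms show ?thesis by (smt (verit) mult_pos_pos)
qed

lemma F_pos: "\<beta> < s \<Longrightarrow> 0 < F s"
  using F_strict_mono [of \<beta> s] b_less F_beta by simp

lemma F_le_0: "s \<le> \<beta> \<Longrightarrow> F s \<le> 0"
  using F_neg [of s] F_nonpos0 [of s] F_beta by (cases "s = \<beta>"; cases "s \<le> 0"; fastforce)

lemma F_nonneg_imp: "0 < s \<Longrightarrow> 0 \<le> F s \<Longrightarrow> \<beta> \<le> s"
  using F_neg [of s] by fastforce

end

locale well_solution = well f F b \<beta> + radial_solution n f u v
  for f F b \<beta> n u v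
begin

sublocale energy_solution n f u v F
  by unfold_locales (rule F_derivU)

text \<open>The energy does not increase, and \<open>F\<close> is strictly increasing above
  \<open>b\<close>.\<close>

lemma u_le:
  assumes "b \<le> u 0" "0 \<le> r"
  shows "u r \<le> u 0"
proof (rule ccontr)
  assume "\<not> u r \<le> u 0"
  then have "F (u 0) < F (u r)" using F_strict_mono assms by simp
  with F_le_E [of r] E_antimono [of 0 r] E0 assms show False by simp
qed

text \<open>At a critical point above the level \<open>b\<close> one has \<open>u'' = -f(u) < 0\<close>, so \<open>u\<close> cannot stop decreasing there.\<close>
lemma v_neg_if:
  assumes R: "0 < R" and crit: "\<And>r. r \<in> {0..R} \<Longrightarrow> v r = 0 \<Longrightarrow> b < u r"
  shows "v R < 0"
proof (rule ccontr)
  assume vR: "\<not> v R < 0"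
  have "b < u 0" using crit [of 0] R by simp
  then have fu0: "0 < f (u 0)" by (rule f_pos)
  \<comment> \<open>The radius 0, where \<open>v\<close> vanishes, has to be left first: a lower
    bound for the mean of \<open>f(u)\<close> near 0 gives some \<open>\<eta>\<close> with
    \<open>v \<eta> < 0\<close>.\<close>
  have "((\<lambda>t. f (u t)) \<longlongrightarrow> f (u 0)) (at 0 within {0..})"
    using fu_cont by (auto simp: continuous_on_def)
  then have "\<forall>\<^sub>F t in at 0 within {0..}. f (u 0) / 2 < f (u t)"
    by (rule order_tendstoD) (use fu0 in simp)
  then obtain d where d: "0 < d" "\<And>t. 0 < t \<Longrightarrow> t < d \<Longrightarrow> f (u 0) / 2 < f (u t)"
    unfolding eventually_at by (auto simp: dist_real_def)
  define \<eta> where "\<eta> = min d R / 2"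
  have \<eta>: "0 < \<eta>" "\<eta> < d" "\<eta> < R" using d(1) R by (auto simp: \<eta>_def)
  have "f (u 0) / 2 * \<eta> / Suc n \<le> rmean n (\<lambda>t. f (u t)) \<eta>"
  proof (rule rmean_bounds(2) [OF fu_cont])
    show "f (u 0) / 2 \<le> f (u t)" if "t \<in> {0..\<eta>}" for t
      using d(2) [of t] that \<eta> fu0 by (cases "t = 0") auto
  qed (use \<eta> in simp)
  moreover have "0 < f (u 0) / 2 * \<eta> / Suc n" using fu0 \<eta> by simp
  ultimately have "v \<eta> < 0" using v_eq [of \<eta>] \<eta> by simp
  have "continuous_on {\<eta>..R} v" by (rule continuous_on_subset [OF v_cont]) (use \<eta> in auto)
  then obtain c where c: "\<eta> < c" "c \<le> R" "v c = 0" "\<And>x. \<eta> \<le> x \<Longrightarrow> x < c \<Longrightarrow> v x < 0"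
    by (rule first_zero) (use \<open>v \<eta> < 0\<close> vR \<eta> in auto)
  have "0 < f (u c)" using crit [of c] c \<eta> by (intro f_pos) simp
  then have "- (n / c) * v c - f (u c) < 0" using c by simp
  then obtain e where e: "0 < e" "\<And>h. 0 < h \<Longrightarrow> h < e \<Longrightarrow> v c < v (c - h)"
    using DERIV_neg_dec_left [OF v_deriv] c \<eta> by (metis less_trans)
  define h where "h = min e (c - \<eta>) / 2"
  have h: "0 < h" "h < e" "h \<le> c - \<eta>" using e(1) c(1) by (auto simp: h_def min_def field_simps)
  have "v c < v (c - h)" by (rule e(2)) fact+
  moreover have "v (c - h) < 0" by (rule c(4)) (use h in auto)
  ultimately show False using c by simp
qed

text \<open>A critical point with \<open>u > 0\<close> and nonnegative energy has
  \<open>F(u) \<ge> 0\<close>, hence lies at a level at least \<open>\<beta> > b\<close>.\<close>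

lemma v_neg:
  assumes R: "0 < R" and u: "\<And>r. r \<in> {0..R} \<Longrightarrow> 0 < u r" and E: "\<And>r. r \<in> {0..R} \<Longrightarrow> 0 \<le> E r"
  shows "v R < 0"
proof (rule v_neg_if [OF R])
  fix r assume r: "r \<in> {0..R}" "v r = 0"
  then have "\<beta> \<le> u r" using F_nonneg_imp [OF u] E [of r] by (simp add: E_def)
  then show "b < u r" using b_less by simp
qed

lemma f_lower_bound:
  assumes "b < s"
  obtains k where "0 < k" "\<And>t. s \<le> t \<Longrightarrow> t \<le> a \<Longrightarrow> k \<le> f t"
proof (cases "s \<le> a")
  case True
  have "continuous_on {s..a} f" by (rule continuous_on_subset [OF f_contU]) simp
  then obtain x where x: "x \<in> {s..a}" "\<And>t. t \<in> {s..a} \<Longrightarrow> f x \<le> f t"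
    using continuous_attains_inf [of "{s..a}" f] True by auto
  show ?thesis by (rule that [of "f x"]) (use x assms f_pos in auto)
qed (use that [of 1] in auto)

text \<open>Above such an \<open>s\<close> the values \<open>f(u)\<close> would be bounded below by
  some \<open>k > 0\<close>, the speed would grow at least linearly, and \<open>u\<close> would
  become negative.\<close>

lemma v_escape:
  assumes s: "b < s" and u: "\<And>r. 0 \<le> r \<Longrightarrow> s \<le> u r"
  shows False
proof -
  have b0: "b \<le> u 0" using u [of 0] s by simp
  obtain k where k: "0 < k" "\<And>t. s \<le> t \<Longrightarrow> t \<le> u 0 \<Longrightarrow> k \<le> f t"
    using f_lower_bound [OF s] by blast
  have "\<exists>r\<ge>1. u r < 0"
  proof (rule escape)
    show "0 < k / Suc n" using k by simp
    fix r :: real assume r: "1 < r"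
    have "k * r / Suc n \<le> rmean n (\<lambda>t. f (u t)) r"
      by (rule rmean_bounds(2) [OF fu_cont]) (use r in \<open>auto intro!: k u u_le b0\<close>)
    moreover have "k * 1 / Suc n \<le> k * r / Suc n"
      using k r by (intro divide_right_mono mult_left_mono) auto
    ultimately show "v r \<le> - (k / Suc n)" using v_eq [of r] r by simp
  qed simp
  then obtain r where "1 \<le> r" "u r < 0" by blast
  with u [of r] s b_pos show False by simp
qed

lemma level_reached:
  assumes s: "b < s" "s \<le> u 0"
  obtains r where "0 \<le> r" "u r = s" "\<And>t. 0 \<le> t \<Longrightarrow> t < r \<Longrightarrow> s < u t"
proof (cases "s = u 0")
  case False
  obtain R where R: "0 \<le> R" "u R < s"
    using v_escape [OF s(1)] by force
  have "continuous_on {0..R} (\<lambda>r. s - u r)"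
    by (intro continuous_intros continuous_on_subset [OF u_cont]) auto
  then obtain r where "0 < r" "r \<le> R" "s - u r = 0" "\<And>x. 0 \<le> x \<Longrightarrow> x < r \<Longrightarrow> s - u x < 0"
    by (rule first_zero) (use False s R in auto)
  then show ?thesis by (intro that [of r]) auto
qed (use that [of 0] in auto)

text \<open>\<open>u\<close> decreases to some \<open>l \<ge> 0\<close>. A limit above
  \<open>b\<close> contradicts \<open>v_escape\<close>; a limit in \<open>(0, \<beta>)\<close> has
  \<open>F l < 0\<close>, and nonnegative energy then forces a speed bounded away from 0.\<close>

lemma u_tendsto_0:
  assumes u: "\<And>r. 0 \<le> r \<Longrightarrow> 0 < u r" and E: "\<And>r. 0 \<le> r \<Longrightarrow> 0 \<le> E r"
  shows "(u \<longlongrightarrow> 0) at_top"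
proof -
  have vn: "v r < 0" if "0 < r" for r
    by (rule v_neg) (use that u E in auto)
  have dec: "u t \<le> u r" if "0 \<le> r" "r \<le> t" for r t
  proof (rule DERIV_nonpos_imp_decreasing_open [OF that(2)])
    show "\<exists>y. (u has_real_derivative y) (at x) \<and> y \<le> 0" if "r < x" "x < t" for x
      using u_deriv [of x] vn [of x] that \<open>0 \<le> r\<close> by (intro exI [of _ "v x"]) auto
    show "continuous_on {r..t} u" by (rule continuous_on_subset [OF u_cont]) (use \<open>0 \<le> r\<close> in auto)
  qed
  define l where "l = Inf (u ` {0..})"
  have bdd: "bdd_below (u ` {0..})" by (rule bdd_belowI [of _ 0]) (use u in \<open>auto intro: less_imp_le\<close>)
  have lu: "l \<le> u r" if "0 \<le> r" for r
    unfolding l_def by (rule cInf_lower) (use that bdd in auto)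
  have l0: "0 \<le> l" unfolding l_def by (rule cInf_greatest) (use u in \<open>auto intro: less_imp_le\<close>)
  have lim: "(u \<longlongrightarrow> l) at_top"
  proof (rule order_tendstoI)
    fix a assume "a < l"
    then have "a < u x" if "0 \<le> x" for x using lu [OF that] by simp
    then show "\<forall>\<^sub>F x in at_top. a < u x" by (rule eventually_at_top_linorderI)
  next
    fix a assume "l < a"
    then obtain R where "0 \<le> R" "u R < a"
      unfolding l_def using cInf_less_iff [of "u ` {0..}" a] bdd by auto
    then have "u x < a" if "R \<le> x" for x using dec [of R x] that by simp
    then show "\<forall>\<^sub>F x in at_top. u x < a" by (rule eventually_at_top_linorderI)
  qed
  have "l = 0"
  proof (rule ccontr)
    assume "l \<noteq> 0"
    then have lpos: "0 < l" using l0 by simp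
    have "\<not> b < l" using v_escape lu by blast
    then have "l < \<beta>" using b_less by simp
    then have Fl: "F l < 0" using F_neg lpos by simp
    have "isCont F l" by (rule DERIV_isCont [OF F_derivU])
    then have "((\<lambda>r. F (u r)) \<longlongrightarrow> F l) at_top" by (rule isCont_tendsto_compose [OF _ lim])
    then have "\<forall>\<^sub>F r in at_top. F (u r) < F l / 2"
      by (rule order_tendstoD) (use Fl in simp)
    then obtain R where R: "\<And>r. R \<le> r \<Longrightarrow> F (u r) < F l / 2"
      unfolding eventually_at_top_linorder by blast
    \<comment> \<open>Where \<open>F(u) < F l / 2\<close>, nonnegative energy gives
      \<open>v^2 \<ge> - 2 F(u) > - F l\<close>.\<close>
    define k where "k = sqrt (- F l)"
    have k: "0 < k" "k\<^sup>2 = - F l"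
      unfolding k_def by (rule real_sqrt_gt_zero real_sqrt_pow2, use Fl in linarith)+
    have "\<exists>r\<ge>max R 0. u r < 0"
    proof (rule escape [OF k(1)])
      fix r assume "max R 0 < r"
      then have r: "0 < r" "R \<le> r" by auto
      have "0 \<le> E r" by (rule E) (use r in simp)
      moreover have "F (u r) < F l / 2" by (rule R) (rule r)
      moreover have "E r = (- v r)\<^sup>2 / 2 + F (u r)" by (simp add: E_def)
      ultimately have "k\<^sup>2 < (- v r)\<^sup>2" using k(2) by linarith
      then have "k < - v r"
        by (rule power_less_imp_less_base) (use vn [OF r(1)] in linarith)
      then show "v r \<le> - k" by linarith
    qed (rule max.cobounded2)
    then obtain r where "max R 0 \<le> r" "u r < 0" by blast
    with u [of r] show False by simp
  qed
  with lim show ?thesis by simp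
qed

end

lemma last_zero:
  fixes g :: "real \<Rightarrow> real"
  assumes g: "continuous_on {a..b} g" and a: "0 \<le> g a" and b: "g b < 0" and ab: "a \<le> b"
  obtains c where "a \<le> c" "c < b" "g c = 0" "\<And>x. c < x \<Longrightarrow> x \<le> b \<Longrightarrow> g x < 0"
proof -
  have "continuous_on {- b..- a} (\<lambda>x. g (- x))"
    by (rule continuous_on_compose2 [OF g]) (auto intro!: continuous_intros)
  then obtain c where c: "- b < c" "c \<le> - a" "g (- c) = 0" "\<And>x. - b \<le> x \<Longrightarrow> x < c \<Longrightarrow> g (- x) < 0"
    by (rule first_zero) (use assms in auto)
  show ?thesis
  proof (rule that [of "- c"])
    show "g x < 0" if "- c < x" "x \<le> b" for x using c(4) [of "- x"] that by simp
  qed (use c in auto)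
qed

section \<open>Radius and speed as functions of the level\<close>

context radial_solution
begin

text \<open>The radius 0 is left out since \<open>v 0 = 0\<close>. The set is an initial interval of
  positive radii on which \<open>u\<close> is invertible; its image consists of the levels at which
  \<open>level\<close> and \<open>speed\<close> are meaningful.\<close>

definition descent :: "real set" where
  "descent = {r. 0 < r \<and> (\<forall>t\<in>{0<..r}. v t < 0 \<and> 0 < u t)}"

lemma descentI: "0 < r \<Longrightarrow> (\<And>t. 0 < t \<Longrightarrow> t \<le> r \<Longrightarrow> v t < 0 \<and> 0 < u t) \<Longrightarrow> r \<in> descent"
  by (auto simp: descent_def)

lemma descentD: "r \<in> descent \<Longrightarrow> 0 < r" "r \<in> descent \<Longrightarrow> v r < 0" "r \<in> descent \<Longrightarrow> 0 < u r"
  by (auto simp: descent_def)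

lemma descent_down: "r \<in> descent \<Longrightarrow> 0 < t \<Longrightarrow> t \<le> r \<Longrightarrow> t \<in> descent"
  by (auto simp: descent_def)

text \<open>Both conditions are strict and persist a little beyond \<open>r\<close>; thus every
  attained level is interior to the range, and derivatives in the level are two-sided.\<close>

lemma descent_open_right:
  assumes r: "r \<in> descent"
  obtains s where "r < s" "s \<in> descent"
proof -
  have r0: "0 < r" "v r < 0" "0 < u r" using descentD [OF r] by auto
  have "isCont v r" "isCont u r" using r0 v_deriv u_deriv DERIV_isCont by blast+
  then have "\<forall>\<^sub>F t in at r. v t < 0" "\<forall>\<^sub>F t in at r. 0 < u t"
    using r0 by (auto simp: isCont_def intro: order_tendstoD)
  then have "\<forall>\<^sub>F t in at r. v t < 0 \<and> 0 < u t" by eventually_elim simp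
  then obtain d where d: "0 < d" "\<And>t. t \<noteq> r \<Longrightarrow> dist t r < d \<Longrightarrow> v t < 0 \<and> 0 < u t"
    unfolding eventually_at by auto
  show ?thesis
  proof (rule that [of "r + d / 2"])
    show "r + d / 2 \<in> descent"
    proof (rule descentI)
      fix t assume t: "0 < t" "t \<le> r + d / 2"
      show "v t < 0 \<and> 0 < u t"
      proof (cases "t \<le> r")
        case True
        then show ?thesis using descentD descent_down [OF r t(1)] by blast
      next
        case False
        then show ?thesis using d(1) t by (intro d(2)) (auto simp: dist_real_def)
      qed
    qed (use r0 d in simp)
  qed (use d in simp)
qed

lemma u_less_on_descent:
  assumes "r \<in> descent" "0 \<le> t" "t < r"
  shows "u r < u t"
proof -
  obtain z where "t < z" "z < r" "u r - u t = (r - t) * v z"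
    by (rule real_mvt [of t r u v])
       (use assms in \<open>auto intro: u_deriv continuous_on_subset [OF u_cont]\<close>)
  moreover have "v z < 0" using descentD(2) descent_down [OF assms(1), of z] calculation assms by simp
  ultimately show ?thesis using assms by (smt (verit) mult_pos_neg)
qed

definition level :: "real \<Rightarrow> real" where "level s = inv_into descent u s"

lemma inj_on_descent: "inj_on u descent"
proof (rule inj_onI)
  fix x y assume "x \<in> descent" "y \<in> descent" "u x = u y"
  then show "x = y"
    using u_less_on_descent [of x y] u_less_on_descent [of y x] descentD(1)
    by (metis less_irrefl less_le linorder_less_linear)
qed

lemma level_u [simp]: "r \<in> descent \<Longrightarrow> level (u r) = r"
  by (simp add: level_def inj_on_descent)

lemma level_in: "s \<in> u ` descent \<Longrightarrow> level s \<in> descent"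
  and u_level: "s \<in> u ` descent \<Longrightarrow> u (level s) = s"
  by (auto simp: level_def inv_into_into f_inv_into_f)

lemma level_range_up:
  assumes "s \<in> u ` descent" "s \<le> t" "t < u 0"
  shows "t \<in> u ` descent"
proof -
  obtain r where r: "r \<in> descent" "s = u r" using assms by auto
  obtain x where x: "0 \<le> x" "x \<le> r" "u x = t"
    using IVT2' [of u r t 0] assms r descentD(1) [OF r(1)] continuous_on_subset [OF u_cont, of "{0..r}"]
    by (auto simp: less_imp_le)
  then have "x \<in> descent" using assms(3) by (intro descent_down [OF r(1)]) (auto simp: order_less_le)
  then show ?thesis using x by auto
qed

definition speed :: "real \<Rightarrow> real" where "speed s = - v (level s)"

lemma level_pos: "s \<in> u ` descent \<Longrightarrow> 0 < level s"
  and speed_pos: "s \<in> u ` descent \<Longrightarrow> 0 < speed s"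
  using level_in descentD by (auto simp: speed_def)

lemma level_deriv:
  assumes s: "s \<in> u ` descent"
  shows "(level has_real_derivative - 1 / speed s) (at s)"
proof -
  define x where "x = level s"
  have x: "x \<in> descent" "u x = s" "0 < x" using level_in u_level level_pos s by (auto simp: x_def)
  obtain y where y: "x < y" "y \<in> descent" using descent_open_right [OF x(1)] .
  have z: "x / 2 < x" "x / 2 \<in> descent" using x descent_down [OF x(1), of "x / 2"] by auto
  have cont: "isCont level (u x)"
  proof (rule isCont_inverse_function2 [of "x / 2" x y])
    show "x / 2 < x" "x < y" by fact+
    fix t assume t: "x / 2 \<le> t" "t \<le> y"
    then have "t \<in> descent" using descent_down [OF y(2)] x(3) by simp
    then show "level (u t) = t" "isCont u t"
      using DERIV_isCont [OF u_deriv [OF descentD(1)]] by auto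
  qed
  have "DERIV level s :> inverse (v x)"
  proof (rule DERIV_inverse_function [where f = u and a = "u y" and b = "u (x / 2)"])
    show "DERIV u (level s) :> v x" using u_deriv x by (simp add: x_def)
    show "v x \<noteq> 0" using descentD(2) [OF x(1)] by simp
    show "u y < s" "s < u (x / 2)"
      using u_less_on_descent [of y x] u_less_on_descent [of x "x / 2"] x y z by auto
    show "isCont level s" using cont x by simp
    fix t assume t: "u y < t" "t < u (x / 2)"
    then have "t < u 0" using u_less_on_descent [OF z(2), of 0] x by simp
    then have "t \<in> u ` descent" using level_range_up [of "u y" t] y t by auto
    then show "u (level t) = t" by (rule u_level)
  qed
  then show ?thesis by (simp add: speed_def x_def inverse_eq_divide)
qed

lemma speed_deriv:
  assumes s: "s \<in> u ` descent"
  shows "(speed has_real_derivative n / level s - f s / speed s) (at s)"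
proof -
  have "(speed has_real_derivative
      - ((- (n / level s) * v (level s) - f (u (level s))) * (- 1 / speed s))) (at s)"
    unfolding speed_def [abs_def]
    using level_pos s level_deriv [OF s, unfolded speed_def]
    by (intro DERIV_minus DERIV_chain2 [OF v_deriv]) auto
  moreover have "- ((- (n / level s) * v (level s) - f (u (level s))) * (- 1 / speed s))
      = n / level s - f s / speed s"
    using speed_pos [OF s] by (simp add: u_level s) (simp add: speed_def field_simps)
  ultimately show ?thesis by simp
qed

end

context energy_solution
begin

definition lenergy :: "real \<Rightarrow> real" where "lenergy s = (speed s)\<^sup>2 + 2 * F s"

lemma lenergy_eq: "s \<in> u ` descent \<Longrightarrow> lenergy s = 2 * E (level s)"
  by (simp add: lenergy_def E_def u_level speed_def)

lemma lenergy_deriv: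
  assumes s: "s \<in> u ` descent"
  shows "(lenergy has_real_derivative 2 * n * speed s / level s) (at s)"
proof -
  have "(lenergy has_real_derivative 2 * speed s * (n / level s - f s / speed s) + 2 * f s) (at s)"
    unfolding lenergy_def [abs_def]
    by (auto intro!: derivative_eq_intros speed_deriv [OF s] F_deriv)
  moreover have "2 * speed s * (n / level s - f s / speed s) + 2 * f s = 2 * n * speed s / level s"
    using speed_pos [OF s] level_pos [OF s] by (simp add: field_simps)
  ultimately show ?thesis by simp
qed

text \<open>A monotone quantity of Erbe--Tang type for levels at which \<open>F \<le> 0\<close>.\<close>
definition W :: "real \<Rightarrow> real" where "W s = level s * sqrt (lenergy s)"

text \<open>With \<open>y = p / sqrt e\<close>, where \<open>p\<close> is the speed and
  \<open>e\<close> the level energy, the derivative is \<open>n y - 1 / y\<close>, an increasing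
  function of \<open>y\<close> alone.\<close>

lemma W_deriv:
  assumes s: "s \<in> u ` descent" and e: "0 < lenergy s"
  shows "(W has_real_derivative n * (speed s / sqrt (lenergy s)) - sqrt (lenergy s) / speed s) (at s)"
proof -
  have "(W has_real_derivative - 1 / speed s * sqrt (lenergy s)
      + inverse (sqrt (lenergy s)) / 2 * (2 * n * speed s / level s) * level s) (at s)"
    unfolding W_def [abs_def]
    by (intro DERIV_mult level_deriv [OF s] DERIV_chain2 [where f = sqrt, OF DERIV_real_sqrt [OF e] lenergy_deriv [OF s]])
  moreover have "- 1 / speed s * sqrt (lenergy s)
      + inverse (sqrt (lenergy s)) / 2 * (2 * n * speed s / level s) * level s
      = n * (speed s / sqrt (lenergy s)) - sqrt (lenergy s) / speed s"
    using speed_pos [OF s] level_pos [OF s] e by (simp add: field_simps)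
  ultimately show ?thesis by simp
qed

end

section \<open>Levels attained, and the Pohozaev-type inequality\<close>

context well_solution
begin

text \<open>Above \<open>b\<close> no critical point can stop the descent, whatever the energy
  does.\<close>

lemma level_range_upper:
  assumes "b < s" "s < u 0"
  shows "s \<in> u ` descent"
proof -
  obtain r where r: "0 \<le> r" "u r = s" "\<And>t. 0 \<le> t \<Longrightarrow> t < r \<Longrightarrow> s < u t"
    using level_reached [OF assms(1) less_imp_le [OF assms(2)]] by blast
  have r0: "0 < r" using r assms by (cases "r = 0") auto
  have ge: "s \<le> u t" if "0 \<le> t" "t \<le> r" for t
    using r(2) r(3) [of t] that by (cases "t = r") auto
  have "r \<in> descent"
  proof (rule descentI [OF r0])
    fix t assume t: "0 < t" "t \<le> r"
    have "v t < 0"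
    proof (rule v_neg_if [OF t(1)])
      fix x assume "x \<in> {0..t}"
      then show "b < u x" using ge [of x] t assms by simp
    qed
    then show "v t < 0 \<and> 0 < u t" using ge [of t] t assms b_pos by simp
  qed
  then show ?thesis using r by auto
qed

lemma not_trappedD: "\<not> trapped F u v \<Longrightarrow> 0 \<le> R \<Longrightarrow> (\<And>r. r \<in> {0..R} \<Longrightarrow> 0 < u r) \<Longrightarrow> 0 \<le> E R"
  unfolding trapped_def E_def [symmetric] by (meson not_le)

text \<open>An untrapped solution staying above \<open>s\<close> would be positive with nonnegative
  energy and hence tend to 0. On the way down to \<open>s\<close> nonnegative energy excludes
  critical points.\<close>

lemma level_range_untrapped:
  assumes nt: "\<not> trapped F u v" and s: "0 < s" "s < u 0"
  shows "s \<in> u ` descent"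
proof -
  have "\<exists>R\<ge>0. u R \<le> s"
  proof (rule ccontr)
    assume "\<not> (\<exists>R\<ge>0. u R \<le> s)"
    then have gt: "s < u r" if "0 \<le> r" for r using that by force
    have pos: "0 < u r" if "0 \<le> r" for r using gt [OF that] s by simp
    have "0 \<le> E r" if "0 \<le> r" for r
      by (rule not_trappedD [OF nt that]) (simp add: pos)
    with pos have "(u \<longlongrightarrow> 0) at_top" by (rule u_tendsto_0)
    then have "\<forall>\<^sub>F r in at_top. u r < s" by (rule order_tendstoD) (use s in simp)
    then have "\<forall>\<^sub>F r in at_top. u r < s \<and> 0 \<le> r" using eventually_ge_at_top [of 0] by eventually_elim simp
    then obtain r where "u r < s" "0 \<le> r" using eventually_happens' [OF trivial_limit_at_top_linorder] by blast
    with gt [of r] show False by simp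
  qed
  then obtain R where R: "0 \<le> R" "u R \<le> s" by blast
  have "continuous_on {0..R} (\<lambda>r. s - u r)"
    by (intro continuous_intros continuous_on_subset [OF u_cont]) auto
  then obtain r where r: "0 < r" "r \<le> R" "s - u r = 0" "\<And>x. 0 \<le> x \<Longrightarrow> x < r \<Longrightarrow> s - u x < 0"
    by (rule first_zero) (use s R in auto)
  have pos: "0 < u x" if "0 \<le> x" "x \<le> r" for x
    using r(3) r(4) [of x] s that by (cases "x = r") auto
  have "r \<in> descent"
  proof (rule descentI)
    fix t assume t: "0 < t" "t \<le> r"
    have "v t < 0"
      by (rule v_neg) (use t pos not_trappedD [OF nt] in auto)
    then show "v t < 0 \<and> 0 < u t" using pos t by simp
  qed (use r in simp)
  then show ?thesis using r by force
qed

text \<open>Energy is lost strictly while \<open>v < 0\<close>, and it is still nonnegative slightly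
  later.\<close>

lemma E_pos_on_descent:
  assumes nt: "\<not> trapped F u v" and r: "r \<in> descent"
  shows "0 < E r"
proof -
  obtain s where s: "r < s" "s \<in> descent" using descent_open_right [OF r] .
  have u0: "0 < u 0" using u_less_on_descent [OF r, of 0] descentD [OF r] by simp
  have pos: "0 < u x" if "x \<in> {0..s}" for x
    using u0 descentD(3) [OF descent_down [OF s(2), of x]] that by (cases "x = 0") auto
  obtain z where z: "r < z" "z < s" "E s = E r - (s - r) * ((n / z) * (v z)\<^sup>2)"
    using E_diff [of r s] s descentD(1) [OF r] by auto
  have "v z < 0" using descentD descent_down [OF s(2), of z] z descentD(1) [OF r] by simp
  then have "0 < (s - r) * ((n / z) * (v z)\<^sup>2)"
    using s z n descentD(1) [OF r] by simp
  moreover have "0 \<le> E s" by (rule not_trappedD [OF nt]) (use pos descentD(1) [OF s(2)] in auto)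
  ultimately show ?thesis using z by simp
qed

text \<open>Pohozaev-type identity: under (H2) the function
  \<open>2 (n + 1) (F / f)(u) r\<^sup>n |u'| - r\<^bsup>n+1\<^esup> (u'\<^sup>2 + 2 F(u))\<close> vanishes at \<open>0\<close> and decreases while \<open>u > \<beta>\<close>.\<close>
lemma pohozaev:
  assumes H2: "\<And>s. \<beta> < s \<Longrightarrow> \<exists>d. ((\<lambda>t. F t / f t) has_real_derivative d) (at s) \<and>
                 (real n - 1) / (2 * (real n + 1)) < d"
    and r: "r \<in> descent" and u: "\<beta> < u r"
  shows "2 * (n + 1) * F (u r) * (- v r) < f (u r) * r * ((v r)\<^sup>2 + 2 * F (u r))"
proof -
  define P where "P r = 2 * (n + 1) * (F (u r) / f (u r)) * (r ^ n * (- v r)) - r ^ Suc n * ((v r)\<^sup>2 + 2 * F (u r))" for r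
  have r0: "0 < r" using descentD [OF r] by simp
  have ub: "\<beta> < u t" if "0 \<le> t" "t \<le> r" for t
    using u_less_on_descent [OF r, of t] that u by (cases "t = r") auto
  have "P r < P 0"
  proof (rule DERIV_neg_imp_decreasing_open [OF r0])
    show "continuous_on {0..r} P"
    proof -
      have sub: "{0..r} \<subseteq> {0..}" by auto
      have "continuous_on {0..r} (\<lambda>x. F (u x))"
        by (rule continuous_on_compose2 [OF F_contU [of UNIV] continuous_on_subset [OF u_cont sub]]) simp
      moreover have "\<forall>x\<in>{0..r}. f (u x) \<noteq> 0"
      proof
        fix x assume "x \<in> {0..r}"
        then have "b < u x" using ub [of x] b_less by simp
        then show "f (u x) \<noteq> 0" using f_pos [of "u x"] by simp
      qed
      ultimately show ?thesis
        unfolding P_def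
        by (intro continuous_intros continuous_on_subset [OF v_cont sub] continuous_on_subset [OF fu_cont sub])
    qed
    fix x assume x: "0 < x" "x < r"
    obtain d where d: "((\<lambda>t. F t / f t) has_real_derivative d) (at (u x))"
      "(real n - 1) / (2 * (real n + 1)) < d"
      using H2 [OF ub [of x]] x by auto
    obtain m where m: "n = Suc m" using n by (cases n) auto
    have vx: "v x < 0" using descentD descent_down [OF r, of x] x by simp
    have fx: "0 < f (u x)" using f_pos [of "u x"] ub [of x] b_less x by simp
    have dd: "(real n - 1) < 2 * (real n + 1) * d"
      using d(2) by (simp add: field_simps)
    have vsq: "((\<lambda>x. (v x)\<^sup>2) has_real_derivative 2 * v x * (- (n / x) * v x - f (u x))) (at x)"
      using DERIV_power [OF v_deriv [OF x(1)], of 2] by (simp add: algebra_simps)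
    have "(P has_real_derivative
       (2 * (n + 1) * (d * v x) * (x ^ n * (- v x)) +
        ((n * x ^ m) * (- v x) + - (- (n / x) * v x - f (u x)) * x ^ n) * (2 * (n + 1) * (F (u x) / f (u x)))) -
       ((Suc n * x ^ n) * ((v x)\<^sup>2 + 2 * F (u x)) +
        (2 * v x * (- (n / x) * v x - f (u x)) + 2 * (f (u x) * v x)) * x ^ Suc n)) (at x)"
      unfolding P_def [abs_def]
      by (intro DERIV_diff DERIV_mult DERIV_add DERIV_cmult DERIV_minus
          DERIV_chain2 [OF d(1) u_deriv] DERIV_pow_Suc m refl DERIV_chain2 [OF F_derivU u_deriv]
          v_deriv x vsq)
    \<comment> \<open>\<open>P\<close> is designed so that everything cancels except a multiple of
      \<open>(v x)^2\<close>; as \<open>n = N - 1\<close>, the remaining bracket is positive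
      precisely by (H2).\<close>
    moreover have "(2 * (n + 1) * (d * v x) * (x ^ n * (- v x)) +
        ((n * x ^ m) * (- v x) + - (- (n / x) * v x - f (u x)) * x ^ n) * (2 * (n + 1) * (F (u x) / f (u x)))) -
       ((Suc n * x ^ n) * ((v x)\<^sup>2 + 2 * F (u x)) +
        (2 * v x * (- (n / x) * v x - f (u x)) + 2 * (f (u x) * v x)) * x ^ Suc n)
       = - (x ^ n * (v x)\<^sup>2 * (2 * (real n + 1) * d - (real n - 1)))"
      using x fx by (simp add: m field_simps power2_eq_square)
    moreover have "- (x ^ n * (v x)\<^sup>2 * (2 * (real n + 1) * d - (real n - 1))) < 0"
      using x vx dd by (auto intro!: mult_pos_pos)
    ultimately show "\<exists>y. (P has_real_derivative y) (at x) \<and> y < 0" by (metis)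
  qed
  moreover have "P 0 = 0" by (simp add: P_def)
  moreover have "P r = r ^ n * (2 * (n + 1) * (F (u r) / f (u r)) * (- v r) - r * ((v r)\<^sup>2 + 2 * F (u r)))"
    by (simp add: P_def algebra_simps)
  ultimately have "2 * (n + 1) * (F (u r) / f (u r)) * (- v r) < r * ((v r)\<^sup>2 + 2 * F (u r))"
    using r0 by (simp add: mult_less_0_iff)
  moreover have "0 < f (u r)" using f_pos [of "u r"] u b_less by simp
  ultimately show ?thesis by (simp add: field_simps)
qed

end

section \<open>Comparison of two solutions\<close>

lemma tendsto_at_right_0:
  fixes g :: "real \<Rightarrow> real"
  assumes "continuous_on {0..} g"
  shows "(g \<longlongrightarrow> g 0) (at_right 0)"
proof -
  have "(g \<longlongrightarrow> g 0) (at 0 within {0..})" using assms by (simp add: continuous_on_def)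
  then show ?thesis by (rule tendsto_within_subset) auto
qed

lemma DERIV_tendsto_at_left:
  assumes "(g has_real_derivative d) (at x)"
  shows "(g \<longlongrightarrow> g x) (at_left x)"
  by (rule tendsto_within_subset [OF DERIV_isCont [OF assms, unfolded isCont_def]]) simp

text \<open>The aim is that the upper solution crosses. It is not known to be untrapped, so its
  level functions are at first available only above \<open>b\<close>; further down, membership in
  \<open>L2\<close> is carried along as an assumption.\<close>

locale two_solutions =
  s1: well_solution f F b \<beta> n u1 v1 + s2: well_solution f F b \<beta> n u2 v2
  for f F b \<beta> n u1 v1 u2 v2 +
  assumes H2: "\<beta> < s \<Longrightarrow> \<exists>d. ((\<lambda>t. F t / f t) has_real_derivative d) (at s) \<and>
                 (real n - 1) / (2 * (real n + 1)) < d"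
    and u1_pos: "0 < u1 0" and u_less: "u1 0 < u2 0" and u1_untrapped: "\<not> trapped F u1 v1"
begin

abbreviation "r1 \<equiv> s1.level"
abbreviation "r2 \<equiv> s2.level"
abbreviation "p1 \<equiv> s1.speed"
abbreviation "p2 \<equiv> s2.speed"
abbreviation "e1 \<equiv> s1.lenergy"
abbreviation "e2 \<equiv> s2.lenergy"
abbreviation "L1 \<equiv> u1 ` s1.descent"
abbreviation "L2 \<equiv> u2 ` s2.descent"

lemma L1: "0 < s \<Longrightarrow> s < u1 0 \<Longrightarrow> s \<in> L1"
  by (rule s1.level_range_untrapped [OF u1_untrapped])

lemma L2: "b < s \<Longrightarrow> s < u2 0 \<Longrightarrow> s \<in> L2"
  by (rule s2.level_range_upper)

lemma e1_pos: "s \<in> L1 \<Longrightarrow> 0 < e1 s"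
  using s1.E_pos_on_descent [OF u1_untrapped] s1.level_in s1.lenergy_eq by simp

text \<open>Starting exactly at \<open>\<beta>\<close> would mean zero energy at the origin, whereas
  the energy is strictly positive later on the descent.\<close>

lemma beta_less: "\<beta> < u1 0"
proof -
  have "0 \<le> F (u1 0)"
    using s1.not_trappedD [OF u1_untrapped, of 0] u1_pos by (simp add: s1.E0)
  then have ge: "\<beta> \<le> u1 0" by (rule s1.F_nonneg_imp [OF u1_pos])
  have "u1 0 \<noteq> \<beta>"
  proof
    assume eq: "u1 0 = \<beta>"
    obtain r where r: "r \<in> s1.descent" "u1 r = \<beta> / 2"
      using L1 [of "\<beta> / 2"] eq s1.b_pos s1.b_less by auto
    then have "s1.E r \<le> s1.E 0" using s1.E_antimono [of 0 r] s1.descentD(1) [OF r(1)] by simp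
    also have "\<dots> = 0" using eq s1.F_beta by (simp add: s1.E0)
    finally show False using s1.E_pos_on_descent [OF u1_untrapped r(1)] by simp
  qed
  with ge show ?thesis by simp
qed

text \<open>At equal speeds \<open>(p1 - p2)' = n / r1 - n / r2 > 0\<close>, so just above
  \<open>s\<close> the first solution would be the faster one.\<close>

lemma speed_gap:
  assumes s: "s \<in> L1" "s \<in> L2" and eq: "p1 s = p2 s" and less: "r1 s < r2 s"
    and lt: "s < t" and above: "\<And>x. s < x \<Longrightarrow> x \<le> t \<Longrightarrow> p1 x < p2 x"
  shows False
proof -
  have "((\<lambda>s. p1 s - p2 s) has_real_derivative
      (n / r1 s - f s / p1 s) - (n / r2 s - f s / p2 s)) (at s)"
    by (intro DERIV_diff s1.speed_deriv s2.speed_deriv s)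
  moreover have "0 < (n / r1 s - f s / p1 s) - (n / r2 s - f s / p2 s)"
    using eq less s1.level_pos [OF s(1)] s1.n by (simp add: divide_strict_left_mono)
  ultimately obtain d where d: "0 < d" "\<And>h. 0 < h \<Longrightarrow> h < d \<Longrightarrow> p1 s - p2 s < p1 (s + h) - p2 (s + h)"
    using DERIV_pos_inc_right by blast
  define h where "h = min d (t - s) / 2"
  have h: "0 < h" "h < d" "s + h \<le> t" using d(1) lt by (auto simp: h_def min_def field_simps)
  show False using d(2) [OF h(1,2)] above [of "s + h"] h eq by simp
qed

text \<open>The function of the Pohozaev-type identity for the first solution, with \<open>2 (n + 1) F / f\<close> replaced by
  the quantity \<open>r u' + 2 r F / u'\<close> (up to sign) that bounds it for the second one.\<close>
definition D :: "real \<Rightarrow> real" where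
  "D s = r1 s ^ n * p1 s * (r2 s * e2 s / p2 s) - r1 s ^ Suc n * e1 s"

text \<open>The last factor is negative by \<open>pohozaev\<close> for the second solution, the one
  before it is positive as soon as \<open>p1 < p2\<close>: comparing speeds decides the monotonicity
  of \<open>D\<close>.\<close>

lemma D_deriv:
  assumes s: "s \<in> L1" "s \<in> L2"
  shows "(D has_real_derivative r1 s ^ n * p1 s * (1 / (p1 s)\<^sup>2 - 1 / (p2 s)\<^sup>2) *
           (2 * (n + 1) * F s - f s * r2 s * e2 s / p2 s)) (at s)"
proof -
  obtain m where m: "n = Suc m" using s1.n by (cases n) auto
  have pos: "0 < r1 s" "0 < p1 s" "0 < r2 s" "0 < p2 s"
    using s1.level_pos s1.speed_pos s2.level_pos s2.speed_pos s by auto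
  define q1 q2 x1 x2 where "q1 = p1 s" "q2 = p2 s" "x1 = r1 s" "x2 = r2 s"
  have "(D has_real_derivative
      ((n * x1 ^ m * (- 1 / q1)) * q1 + (n / x1 - f s / q1) * x1 ^ n) * (x2 * e2 s / q2) +
      (((- 1 / q2 * e2 s + 2 * n * q2 / x2 * x2) * q2 - x2 * e2 s * (n / x2 - f s / q2)) / (q2 * q2)) * (x1 ^ n * q1)
      - ((Suc n * x1 ^ n * (- 1 / q1)) * e1 s + (2 * n * q1 / x1) * x1 ^ Suc n)) (at s)"
    unfolding D_def [abs_def] q1_q2_x1_x2_def
    by (intro DERIV_diff DERIV_mult DERIV_divide s1.speed_deriv s2.speed_deriv s
        DERIV_chain2 [OF DERIV_pow_Suc s1.level_deriv] s2.level_deriv s1.lenergy_deriv s2.lenergy_deriv m refl)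
       (use pos in simp)
  moreover have "((n * x1 ^ m * (- 1 / q1)) * q1 + (n / x1 - f s / q1) * x1 ^ n) * (x2 * e2 s / q2) +
      (((- 1 / q2 * e2 s + 2 * n * q2 / x2 * x2) * q2 - x2 * e2 s * (n / x2 - f s / q2)) / (q2 * q2)) * (x1 ^ n * q1)
      - ((Suc n * x1 ^ n * (- 1 / q1)) * e1 s + (2 * n * q1 / x1) * x1 ^ Suc n)
    = x1 ^ n * q1 * (1 / q1\<^sup>2 - 1 / q2\<^sup>2) * (2 * (n + 1) * F s - f s * x2 * e2 s / q2)"
    using pos unfolding s1.lenergy_def s2.lenergy_def q1_q2_x1_x2_def [symmetric]
    by (simp add: m divide_simps power2_eq_square) algebra
  ultimately show ?thesis by (simp add: q1_q2_x1_x2_def)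
qed

lemma D_mono:
  assumes "\<beta> \<le> s" "s < t" "t < u1 0" and p: "\<And>x. s < x \<Longrightarrow> x < t \<Longrightarrow> p1 x < p2 x"
  shows "D t < D s"
proof (rule DERIV_neg_imp_decreasing_open [OF assms(2)])
  have L: "x \<in> L1" "x \<in> L2" if "s \<le> x" "x \<le> t" for x
    using L1 [of x] L2 [of x] that assms u_less s1.b_less s1.b_pos by auto
  show "continuous_on {s..t} D"
    by (intro continuous_at_imp_continuous_on ballI DERIV_isCont [OF D_deriv]) (use L in auto)
  fix x assume x: "s < x" "x < t"
  have Lx: "x \<in> L1" "x \<in> L2" using L x by auto
  have pos: "0 < r1 x" "0 < p1 x" "0 < r2 x" "0 < p2 x"
    using s1.level_pos s1.speed_pos s2.level_pos s2.speed_pos Lx by auto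
  have "2 * (n + 1) * F (u2 (r2 x)) * (- v2 (r2 x)) <
      f (u2 (r2 x)) * r2 x * ((v2 (r2 x))\<^sup>2 + 2 * F (u2 (r2 x)))"
    by (rule s2.pohozaev [OF H2]) (use Lx s2.level_in s2.u_level x assms in auto)
  then have "2 * (n + 1) * F x * p2 x < f x * r2 x * e2 x"
    by (simp add: s2.u_level Lx s2.speed_def s2.lenergy_def)
  then have neg: "2 * (n + 1) * F x - f x * r2 x * e2 x / p2 x < 0"
    using pos by (simp add: field_simps)
  have "1 / (p2 x)\<^sup>2 < 1 / (p1 x)\<^sup>2"
    using p [OF x] pos by (intro divide_strict_left_mono power_strict_mono) auto
  then have "r1 x ^ n * p1 x * (1 / (p1 x)\<^sup>2 - 1 / (p2 x)\<^sup>2) *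
           (2 * (n + 1) * F x - f x * r2 x * e2 x / p2 x) < 0"
    using pos neg by (intro mult_pos_neg mult_pos_pos) auto
  then show "\<exists>y. (D has_real_derivative y) (at x) \<and> y < 0"
    using D_deriv [OF Lx] by blast
qed

lemma top_L2: "u1 0 \<in> L2"
  using L2 [of "u1 0"] beta_less u_less s1.b_less by simp

lemma descent1_nonempty: obtains \<eta> where "\<eta> \<in> s1.descent"
  using L1 [of "u1 0 / 2"] u1_pos by auto

lemma u1_at_right: "(u1 \<longlongrightarrow> u1 0) (at_right 0)"
  by (rule tendsto_at_right_0 [OF s1.u_cont])

lemma v1_at_right: "(v1 \<longlongrightarrow> 0) (at_right 0)"
  using tendsto_at_right_0 [OF s1.v_cont] by simp

lemma compose_top: "isCont g (u1 0) \<Longrightarrow> ((\<lambda>r. g (u1 r)) \<longlongrightarrow> g (u1 0)) (at_right 0)"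
  by (rule isCont_tendsto_compose [OF _ u1_at_right])

lemma eventually_descent1: "\<forall>\<^sub>F r in at_right 0. r \<in> s1.descent"
proof -
  obtain \<eta> where \<eta>: "\<eta> \<in> s1.descent" by (rule descent1_nonempty)
  have "\<forall>\<^sub>F r in at_right 0. r \<in> {0<..<\<eta>}"
    by (rule eventually_at_right_real) (rule s1.descentD(1) [OF \<eta>])
  then show ?thesis by eventually_elim (use s1.descent_down [OF \<eta>] in auto)
qed

text \<open>\<open>D\<close> tends to 0 at the top level of the first solution because
  \<open>r1\<close> does, and it decreases in the level. As \<open>level\<close> is not meaningful
  at \<open>u1 0\<close> itself, the limit is taken along radii tending to 0.\<close>

lemma D_top:
  assumes "\<beta> \<le> s" "s < u1 0" and p: "\<And>x. s < x \<Longrightarrow> x < u1 0 \<Longrightarrow> p1 x < p2 x"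
  shows "0 < D s"
proof -
  \<comment> \<open>The intermediate level turns the limit inequality \<open>0 \<le> D t\<close>
    into a strict one at \<open>s\<close>.\<close>
  define t where "t = (s + u1 0) / 2"
  have t: "s < t" "t < u1 0" using assms by (auto simp: t_def)
  have lim: "((\<lambda>r. r ^ n * (- v1 r) * (r2 (u1 r) * e2 (u1 r) / p2 (u1 r)) - r ^ Suc n * (2 * s1.E r))
      \<longlongrightarrow> 0 ^ n * (- 0) * (r2 (u1 0) * e2 (u1 0) / p2 (u1 0)) - 0 ^ Suc n * (2 * s1.E 0)) (at_right 0)"
    using s2.speed_pos [OF top_L2]
    by (intro tendsto_intros v1_at_right compose_top DERIV_isCont [OF s2.level_deriv]
        DERIV_isCont [OF s2.speed_deriv] DERIV_isCont [OF s2.lenergy_deriv] top_L2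
        tendsto_at_right_0 [OF s1.E_cont]) simp
  have "0 \<le> D t"
  proof (rule tendsto_upperbound)
    show "((\<lambda>r. r ^ n * (- v1 r) * (r2 (u1 r) * e2 (u1 r) / p2 (u1 r)) - r ^ Suc n * (2 * s1.E r))
      \<longlongrightarrow> 0) (at_right 0)" using lim by simp
    have "\<forall>\<^sub>F r in at_right 0. t < u1 r"
      by (rule order_tendstoD(1) [OF u1_at_right t(2)])
    with eventually_descent1
    show "\<forall>\<^sub>F r in at_right 0. r ^ n * (- v1 r) * (r2 (u1 r) * e2 (u1 r) / p2 (u1 r)) - r ^ Suc n * (2 * s1.E r) \<le> D t"
    proof eventually_elim
      case (elim r)
      then have "D (u1 r) < D t"
        using s1.u_less_on_descent [of r 0] s1.descentD(1) [of r] assms t by (intro D_mono) auto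
      moreover have "D (u1 r) = r ^ n * (- v1 r) * (r2 (u1 r) * e2 (u1 r) / p2 (u1 r)) - r ^ Suc n * (2 * s1.E r)"
        using elim by (simp add: D_def s1.lenergy_eq s1.speed_def)
      ultimately show ?case by simp
    qed
  qed simp
  moreover have "D t < D s" by (rule D_mono) (use t assms in auto)
  ultimately show ?thesis by simp
qed

text \<open>At the highest level \<open>c\<close> with \<open>p1 = p2\<close> the energies agree as
  well, so \<open>D c > 0\<close> reduces to \<open>r1 < r2\<close>, which \<open>speed_gap\<close>
  excludes.\<close>

lemma speed_less_upper:
  assumes s: "\<beta> \<le> s" "s < u1 0"
  shows "p1 s < p2 s"
proof (rule ccontr)
  assume ns: "\<not> p1 s < p2 s"
  \<comment> \<open>Near the top \<open>p1\<close> is close to 0 while \<open>p2\<close> is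
    positive; this starts the comparison.\<close>
  have "((\<lambda>r. p2 (u1 r) - (- v1 r)) \<longlongrightarrow> p2 (u1 0) - (- 0)) (at_right 0)"
    by (intro tendsto_intros v1_at_right compose_top DERIV_isCont [OF s2.speed_deriv] top_L2)
  then have "\<forall>\<^sub>F r in at_right 0. 0 < p2 (u1 r) - (- v1 r)"
    by (rule order_tendstoD) (use s2.speed_pos [OF top_L2] in simp)
  with eventually_descent1 have "\<forall>\<^sub>F r in at_right 0. r \<in> s1.descent \<and> 0 < p2 (u1 r) - (- v1 r)"
    by (rule eventually_conj)
  then obtain \<eta> where \<eta>: "0 < \<eta>"
      "\<forall>r>0. r < \<eta> \<longrightarrow> r \<in> s1.descent \<and> 0 < p2 (u1 r) - (- v1 r)"
    unfolding eventually_at_right_field by blast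
  define \<rho> where "\<rho> = \<eta> / 2"
  have \<rho>: "\<rho> \<in> s1.descent" using \<eta> by (simp add: \<rho>_def)
  have near: "p1 x < p2 x" if "u1 \<rho> \<le> x" "x < u1 0" for x
  proof -
    have xL: "x \<in> L1" using s1.level_range_up [of "u1 \<rho>" x] \<rho> that by auto
    have "r1 x \<le> \<rho>"
    proof (rule ccontr)
      assume "\<not> r1 x \<le> \<rho>"
      then have "u1 (r1 x) < u1 \<rho>"
        using s1.u_less_on_descent [OF s1.level_in [OF xL], of \<rho>] s1.descentD(1) [OF \<rho>] by simp
      with that s1.u_level [OF xL] show False by simp
    qed
    then have "r1 x < \<eta>" using \<eta>(1) by (simp add: \<rho>_def)
    then have "- v1 (r1 x) < p2 (u1 (r1 x))" using \<eta>(2) s1.level_pos [OF xL] by fastforce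
    then show ?thesis using s1.u_level [OF xL] by (simp add: s1.speed_def)
  qed
  define t where "t = max (u1 \<rho>) ((s + u1 0) / 2)"
  have t: "u1 \<rho> \<le> t" "s < t" "t < u1 0"
    using s s1.u_less_on_descent [OF \<rho>, of 0] s1.descentD(1) [OF \<rho>] by (auto simp: t_def less_max_iff_disj)
  have L: "x \<in> L1" "x \<in> L2" if "s \<le> x" "x < u1 0" for x
    using L1 [of x] L2 [of x] that s u_less s1.b_less s1.b_pos by auto
  have "continuous_on {s..t} (\<lambda>x. p1 x - p2 x)"
  proof (intro continuous_at_imp_continuous_on ballI isCont_diff)
    fix x assume "x \<in> {s..t}"
    then have "x \<in> L1" "x \<in> L2" using L t by auto
    then show "isCont p1 x" "isCont p2 x"
      using DERIV_isCont s1.speed_deriv s2.speed_deriv by blast+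
  qed
  then obtain c where c: "s \<le> c" "c < t" "p1 c - p2 c = 0" "\<And>x. c < x \<Longrightarrow> x \<le> t \<Longrightarrow> p1 x - p2 x < 0"
    by (rule last_zero) (use ns near t in auto)
  have above: "p1 x < p2 x" if "c < x" "x < u1 0" for x
    using c(4) [of x] near [of x] that t by (cases "x \<le> t") auto
  have Lc: "c \<in> L1" "c \<in> L2" using L c t by auto
  have pos: "0 < r1 c" "0 < p1 c" "0 < r2 c" "0 < p2 c"
    using s1.level_pos s1.speed_pos s2.level_pos s2.speed_pos Lc by auto
  have "0 < D c" by (rule D_top) (use c s t above in auto)
  moreover have "D c = r1 c ^ n * e1 c * (r2 c - r1 c)"
    using c(3) pos by (simp add: D_def s1.lenergy_def s2.lenergy_def field_simps)
  moreover have "0 < r1 c ^ n * e1 c" using pos e1_pos [OF Lc(1)] by simp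
  ultimately have "r1 c < r2 c" using zero_less_mult_pos [of "r1 c ^ n * e1 c" "r2 c - r1 c"] by simp
  then show False using speed_gap [OF Lc, of t] c by simp
qed

section \<open>From the level \<open>\<beta>\<close> downwards\<close>

lemma beta_L: "\<beta> \<in> L1" "\<beta> \<in> L2"
  using L1 [of \<beta>] L2 [of \<beta>] beta_less u_less s1.b_less s1.b_pos by auto

text \<open>Since \<open>F \<beta> = 0\<close>, positivity of \<open>D\<close> and the inequality
  for \<open>W\<close> both say \<open>r1 p1 < r2 p2\<close> here: the first comparison hands over
  to the second.\<close>

lemma W_less_beta: "s1.W \<beta> < s2.W \<beta>"
proof -
  have pos: "0 < r1 \<beta>" "0 < p1 \<beta>" "0 < r2 \<beta>" "0 < p2 \<beta>"
    using s1.level_pos s1.speed_pos s2.level_pos s2.speed_pos beta_L by auto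
  have "0 < D \<beta>" by (rule D_top) (use beta_less speed_less_upper in auto)
  also have "D \<beta> = r1 \<beta> ^ n * p1 \<beta> * (r2 \<beta> * p2 \<beta> - r1 \<beta> * p1 \<beta>)"
    using pos by (simp add: D_def s1.lenergy_def s2.lenergy_def s1.F_beta power2_eq_square field_simps)
  finally have "0 < r1 \<beta> ^ n * p1 \<beta> * (r2 \<beta> * p2 \<beta> - r1 \<beta> * p1 \<beta>)" .
  then have "r1 \<beta> * p1 \<beta> < r2 \<beta> * p2 \<beta>"
    using pos zero_less_mult_pos [of "r1 \<beta> ^ n * p1 \<beta>" "r2 \<beta> * p2 \<beta> - r1 \<beta> * p1 \<beta>"] by simp
  then show ?thesis
    using pos by (simp add: s1.W_def s2.W_def s1.lenergy_def s2.lenergy_def s1.F_beta)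
qed

text \<open>For \<open>y = p / sqrt e\<close> one has \<open>y^2 = 1 - 2 F / e\<close>. As
  \<open>F \<le> 0\<close>, the larger energy belongs to the smaller \<open>y\<close>, and
  \<open>n y - 1 / y\<close> increases in \<open>y\<close>.\<close>

lemma W_mono:
  assumes s: "0 < s" "s \<le> t" "t \<le> \<beta>" "s \<in> L2" and e: "\<And>x. s < x \<Longrightarrow> x < t \<Longrightarrow> e1 x < e2 x"
    and es: "e1 s \<le> e2 s" and et: "e1 t \<le> e2 t"
  shows "s2.W t - s1.W t \<le> s2.W s - s1.W s"
proof (rule DERIV_nonpos_imp_decreasing_open [OF s(2)])
  have L: "x \<in> L1" "x \<in> L2" if "s \<le> x" "x \<le> t" for x
    using L1 [of x] s2.level_range_up [OF s(4), of x] that s beta_less u_less by auto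
  have ee: "e1 x \<le> e2 x" if "s \<le> x" "x \<le> t" for x
    using e [of x] es et that by (cases "x = s"; cases "x = t") auto
  have e2p: "0 < e2 x" if "s \<le> x" "x \<le> t" for x using ee [OF that] e1_pos [OF L(1) [OF that]] by simp
  have der: "((\<lambda>x. s2.W x - s1.W x) has_real_derivative
      (n * (p2 x / sqrt (e2 x)) - sqrt (e2 x) / p2 x) - (n * (p1 x / sqrt (e1 x)) - sqrt (e1 x) / p1 x)) (at x)"
    if "s \<le> x" "x \<le> t" for x
    by (intro DERIV_diff s1.W_deriv s2.W_deriv L that e2p e1_pos)
  show "continuous_on {s..t} (\<lambda>x. s2.W x - s1.W x)"
    by (intro continuous_at_imp_continuous_on ballI DERIV_isCont [OF der]) auto
  fix x assume x: "s < x" "x < t"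
  then have x': "s \<le> x" "x \<le> t" by auto
  have F: "F x \<le> 0" by (rule s1.F_le_0) (use x s in simp)
  have pos: "0 < p1 x" "0 < p2 x" "0 < e1 x" "0 < e2 x"
    using s1.speed_pos s2.speed_pos L [OF x'] e1_pos e2p [OF x'] by auto
  define y1 where "y1 = p1 x / sqrt (e1 x)"
  define y2 where "y2 = p2 x / sqrt (e2 x)"
  have y: "0 < y1" "0 < y2" using pos by (auto simp: y1_def y2_def)
  have "y2\<^sup>2 = 1 - 2 * F x / e2 x" "y1\<^sup>2 = 1 - 2 * F x / e1 x"
    using pos by (simp_all add: y1_def y2_def power_divide s1.lenergy_def s2.lenergy_def field_simps)
  moreover have "- 2 * F x / e2 x \<le> - 2 * F x / e1 x"
    using ee [OF x'] F pos by (intro divide_left_mono) auto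
  ultimately have "y2\<^sup>2 \<le> y1\<^sup>2" by simp
  then have le: "y2 \<le> y1" by (rule power2_le_imp_le) (use y in simp)
  have "1 / y1 \<le> 1 / y2" using le y by (intro divide_left_mono) auto
  moreover have "n * y2 \<le> n * y1" using le by (intro mult_left_mono) auto
  ultimately have "(n * y2 - 1 / y2) - (n * y1 - 1 / y1) \<le> 0" by simp
  moreover have "1 / y1 = sqrt (e1 x) / p1 x" "1 / y2 = sqrt (e2 x) / p2 x"
    by (auto simp: y1_def y2_def)
  ultimately show "\<exists>y. ((\<lambda>x. s2.W x - s1.W x) has_real_derivative y) (at x) \<and> y \<le> 0"
    using der [OF x'] by (intro exI conjI) (auto simp: y1_def y2_def)
qed

text \<open>At the highest level where the energies agree the speeds agree too, and the inequality
  for \<open>W\<close> becomes \<open>r1 < r2\<close>; again \<open>speed_gap\<close>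
  applies.\<close>

lemma lenergy_less_lower:
  assumes s: "0 < s" "s \<le> \<beta>" "s \<in> L2"
  shows "e1 s < e2 s"
proof (rule ccontr)
  assume ns: "\<not> e1 s < e2 s"
  have L: "x \<in> L1" "x \<in> L2" if "s \<le> x" "x \<le> \<beta>" for x
    using L1 [of x] s2.level_range_up [OF s(3), of x] that s beta_less u_less by auto
  have less_beta: "e1 \<beta> < e2 \<beta>"
    using speed_less_upper [of \<beta>] beta_less s1.speed_pos [OF beta_L(1)]
    by (simp add: s1.lenergy_def s2.lenergy_def power_strict_mono)
  have "continuous_on {s..\<beta>} (\<lambda>x. e1 x - e2 x)"
  proof (intro continuous_at_imp_continuous_on ballI isCont_diff)
    fix x assume "x \<in> {s..\<beta>}"
    then have "x \<in> L1" "x \<in> L2" using L by auto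
    then show "isCont e1 x" "isCont e2 x"
      using DERIV_isCont s1.lenergy_deriv s2.lenergy_deriv by blast+
  qed
  then obtain c where c: "s \<le> c" "c < \<beta>" "e1 c - e2 c = 0" "\<And>x. c < x \<Longrightarrow> x \<le> \<beta> \<Longrightarrow> e1 x - e2 x < 0"
    by (rule last_zero) (use ns less_beta s in auto)
  have Lc: "c \<in> L1" "c \<in> L2" using L c by auto
  have pos: "0 < r1 c" "0 < p1 c" "0 < r2 c" "0 < p2 c"
    using s1.level_pos s1.speed_pos s2.level_pos s2.speed_pos Lc by auto
  have "s2.W \<beta> - s1.W \<beta> \<le> s2.W c - s1.W c"
  proof (rule W_mono)
    show "0 < c" "c \<le> \<beta>" "e1 c \<le> e2 c" using c s by auto
    show "c \<in> L2" "\<beta> \<le> \<beta>" "e1 \<beta> \<le> e2 \<beta>" using Lc less_beta by simp_all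
    show "e1 x < e2 x" if "c < x" "x < \<beta>" for x using c(4) [of x] that by simp
  qed
  with W_less_beta have "0 < s2.W c - s1.W c" by simp
  also have "\<dots> = (r2 c - r1 c) * sqrt (e1 c)"
    using c(3) by (simp add: s1.W_def s2.W_def algebra_simps)
  finally have r: "r1 c < r2 c"
    using e1_pos [OF Lc(1)] zero_less_mult_pos2 [of "r2 c - r1 c" "sqrt (e1 c)"] by simp
  have "(p1 c)\<^sup>2 = (p2 c)\<^sup>2" using c(3) by (simp add: s1.lenergy_def s2.lenergy_def)
  then have p: "p1 c = p2 c" using pos by (simp add: power2_eq_iff_nonneg)
  show False
  proof (rule speed_gap [OF Lc p r c(2)])
    fix x assume x: "c < x" "x \<le> \<beta>"
    then have "(p1 x)\<^sup>2 < (p2 x)\<^sup>2" using c(4) [of x] by (simp add: s1.lenergy_def s2.lenergy_def)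
    then show "p1 x < p2 x" using s2.speed_pos [of x] L [of x] x c
      by (intro power_less_imp_less_base [of "p1 x" 2 "p2 x"]) auto
  qed
qed

text \<open>Keeps \<open>r sqrt (2 E)\<close> of the second solution above a fixed positive number
  as the level decreases; \<open>crossing_above\<close> plays this against the two ways in which the
  solution could fail to cross.\<close>

lemma W_lower:
  assumes s: "0 < s" "s \<le> \<beta>" "s \<in> L2"
  shows "s2.W \<beta> - s1.W \<beta> \<le> s2.W s"
proof -
  have L: "x \<in> L2" if "s \<le> x" "x \<le> \<beta>" for x
    using s2.level_range_up [OF s(3), of x] that beta_less u_less by auto
  have "s2.W \<beta> - s1.W \<beta> \<le> s2.W s - s1.W s"
  proof (rule W_mono)
    show "0 < s" "s \<le> \<beta>" "s \<in> L2" "\<beta> \<le> \<beta>" using s by auto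
    have less: "e1 x < e2 x" if "s \<le> x" "x \<le> \<beta>" for x
      by (rule lenergy_less_lower) (use that s(1) L in auto)
    show "e1 x < e2 x" if "s < x" "x < \<beta>" for x using less [of x] that by simp
    show "e1 s \<le> e2 s" "e1 \<beta> \<le> e2 \<beta>" using less [of s] less [of \<beta>] s by auto
  qed
  moreover have "s \<in> L1" using L1 s beta_less by simp
  then have "0 \<le> s1.W s" using s1.level_pos e1_pos by (simp add: s1.W_def less_imp_le)
  ultimately show ?thesis by simp
qed

theorem crossing_above: "crossing u2"
proof (rule ccontr)
  assume nc: "\<not> crossing u2"
  then have u2_nonneg: "0 \<le> u2 r" if "0 \<le> r" for r using that by (force simp: crossing_def)
  define \<delta> where "\<delta> = s2.W \<beta> - s1.W \<beta>"
  have \<delta>: "0 < \<delta>" using W_less_beta by (simp add: \<delta>_def)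
  \<comment> \<open>The squared form passes to the limit at the end of the descent, where the sign
    of the energy is not known beforehand.\<close>
  have Elow: "\<delta>\<^sup>2 \<le> r\<^sup>2 * (2 * s2.E r)" if r: "r \<in> s2.descent" "u2 r \<le> \<beta>" for r
  proof -
    have "\<delta> \<le> s2.W (u2 r)" unfolding \<delta>_def
      by (rule W_lower) (use r s2.descentD(3) in auto)
    then have *: "\<delta> \<le> r * sqrt (2 * s2.E r)"
      using r by (simp add: s2.W_def s2.lenergy_eq)
    then have "0 < r * sqrt (2 * s2.E r)" using \<delta> by simp
    then have "0 < s2.E r" using s2.descentD(1) [OF r(1)] by (simp add: zero_less_mult_iff)
    moreover have "\<delta>\<^sup>2 \<le> (r * sqrt (2 * s2.E r))\<^sup>2" using * \<delta> by (intro power_mono) auto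
    ultimately show ?thesis by (simp add: power_mult_distrib)
  qed
  obtain R0 where R0: "R0 \<in> s2.descent" "u2 R0 = \<beta>" using beta_L by force
  have low: "u2 r \<le> \<beta>" if "r \<in> s2.descent" "R0 \<le> r" for r
    using s2.u_less_on_descent [OF that(1), of R0] R0 that s2.descentD(1) [OF R0(1)]
    by (cases "r = R0") auto
  show False
  proof (cases "bdd_above s2.descent")
    case True
    \<comment> \<open>The descent ends at \<open>R\<close>. As \<open>u2\<close> does not become
      negative, the end is a critical point; it lies at a level at most \<open>b\<close>, where the
      energy cannot be positive.\<close>
    define R where "R = Sup s2.descent"
    have le: "r \<le> R" if "r \<in> s2.descent" for r
      unfolding R_def by (rule cSup_upper [OF that True])
    have lt: "r < R" if "r \<in> s2.descent" for r
      by (rule s2.descent_open_right [OF that]) (meson le less_le_trans)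
    have Rpos: "0 < R" "R0 < R" using lt [OF R0(1)] s2.descentD(1) [OF R0(1)] by auto
    have in_d: "r \<in> s2.descent" if r: "0 < r" "r < R" for r
    proof -
      obtain x where "x \<in> s2.descent" "r < x"
        using r(2) less_cSupD [of s2.descent r] R0(1) by (auto simp: R_def)
      then show ?thesis using s2.descent_down [of x r] r by simp
    qed
    have vR_le: "v2 R \<le> 0"
    proof (rule tendsto_upperbound)
      show "(v2 \<longlongrightarrow> v2 R) (at_left R)"
        by (rule DERIV_tendsto_at_left [OF s2.v_deriv [OF Rpos(1)]])
      have "\<forall>\<^sub>F r in at_left R. r \<in> {0<..<R}" by (rule eventually_at_left_real [OF Rpos(1)])
      then show "\<forall>\<^sub>F r in at_left R. v2 r \<le> 0"
        by eventually_elim (use in_d s2.descentD(2) in \<open>auto intro: less_imp_le\<close>)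
    qed simp
    have vR: "v2 R = 0"
    proof (rule ccontr)
      assume "v2 R \<noteq> 0"
      then have neg: "v2 R < 0" using vR_le by simp
      have "0 < u2 R"
      proof (rule ccontr)
        assume "\<not> 0 < u2 R"
        obtain d where "0 < d" "\<And>h. 0 < h \<Longrightarrow> h < d \<Longrightarrow> u2 (R + h) < u2 R"
          using DERIV_neg_dec_right [OF s2.u_deriv [OF Rpos(1)] neg] by blast
        then have "u2 (R + d / 2) < u2 R" by simp
        with \<open>\<not> 0 < u2 R\<close> u2_nonneg [of "R + d / 2"] Rpos \<open>0 < d\<close> show False by simp
      qed
      then have "R \<in> s2.descent"
        using in_d s2.descentD neg Rpos(1) by (intro s2.descentI) (auto simp: order_le_less)
      then show False using lt by blast
    qed
    have "u2 R \<le> b"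
    proof (rule ccontr)
      assume "\<not> u2 R \<le> b"
      then have "- (n / R) * v2 R - f (u2 R) < 0" using vR s1.f_pos [of "u2 R"] by simp
      then obtain d where d: "0 < d" "\<And>h. 0 < h \<Longrightarrow> h < d \<Longrightarrow> v2 R < v2 (R - h)"
        using DERIV_neg_dec_left [OF s2.v_deriv [OF Rpos(1)]] by blast
      define h where "h = min d R / 2"
      have h: "0 < h" "h < d" "h < R" using d(1) Rpos by (auto simp: h_def)
      then show False using d(2) [OF h(1,2)] vR s2.descentD(2) [OF in_d [of "R - h"]] by simp
    qed
    then have "s2.E R \<le> 0"
      using vR s1.F_le_0 [of "u2 R"] s1.b_less by (simp add: s2.E_def)
    then have "R\<^sup>2 * (2 * s2.E R) \<le> 0" by (simp add: mult_nonneg_nonpos)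
    moreover have "\<delta>\<^sup>2 \<le> R\<^sup>2 * (2 * s2.E R)"
    proof (rule tendsto_lowerbound)
      have "(s2.E \<longlongrightarrow> s2.E R) (at_left R)"
        by (rule DERIV_tendsto_at_left [OF s2.E_deriv [OF Rpos(1)]])
      then show "((\<lambda>r. r\<^sup>2 * (2 * s2.E r)) \<longlongrightarrow> R\<^sup>2 * (2 * s2.E R)) (at_left R)"
        by (intro tendsto_intros)
      have "\<forall>\<^sub>F r in at_left R. r \<in> {R0<..<R}" by (rule eventually_at_left_real [OF Rpos(2)])
      then show "\<forall>\<^sub>F r in at_left R. \<delta>\<^sup>2 \<le> r\<^sup>2 * (2 * s2.E r)"
      proof eventually_elim
        case (elim r)
        then have "r \<in> s2.descent" using in_d s2.descentD(1) [OF R0(1)] by simp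
        then show ?case using Elow low elim by simp
      qed
    qed simp
    ultimately show False using \<delta> by (smt (verit) zero_less_power)
  next
    case False
    \<comment> \<open>The descent never ends, so \<open>u2\<close> tends to 0. Below
      \<open>b\<close> the flux \<open>r^n |v|\<close> does not increase, so \<open>r |v|\<close>
      decays like \<open>r^(1-n)\<close>, against the lower bound \<open>\<delta>\<close>. Here
      \<open>n \<ge> 2\<close> is essential.\<close>
    have in_d: "r \<in> s2.descent" if "0 < r" for r
    proof -
      obtain x where "x \<in> s2.descent" "r < x" using False by (auto simp: bdd_above_def not_le)
      then show ?thesis using s2.descent_down [of x r] that by simp
    qed
    have pos: "0 < u2 r" if "0 \<le> r" for r
      using in_d [of r] s2.descentD(3) that u1_pos u_less by (cases "r = 0") auto
    have E0: "0 \<le> s2.E r" if "0 \<le> r" for r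
    proof -
      define t where "t = max r R0"
      have t: "0 < t" "R0 \<le> t" "r \<le> t" using s2.descentD(1) [OF R0(1)] by (auto simp: t_def)
      have "\<delta>\<^sup>2 \<le> t\<^sup>2 * (2 * s2.E t)" by (rule Elow) (use t in_d low in auto)
      moreover have "0 < \<delta>\<^sup>2" using \<delta> by simp
      ultimately have "0 < t\<^sup>2 * (2 * s2.E t)" by linarith
      then have "0 < s2.E t" using t by (simp add: zero_less_mult_iff)
      then show ?thesis using s2.E_antimono [of r t] that t by simp
    qed
    have "(u2 \<longlongrightarrow> 0) at_top" by (rule s2.u_tendsto_0) (use pos E0 in auto)
    then have "\<forall>\<^sub>F r in at_top. u2 r < b" by (rule order_tendstoD) (rule s1.b_pos)
    then obtain R1 where R1: "\<And>r. R1 \<le> r \<Longrightarrow> u2 r < b" by (auto simp: eventually_at_top_linorder)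
    define R where "R = max (max R1 R0) 1"
    have R: "R1 \<le> R" "R0 \<le> R" "1 \<le> R" by (auto simp: R_def)
    obtain m where m: "n = Suc (Suc m)" using s1.n by (metis add_2_eq_Suc le_Suc_ex)
    define q where "q r = r ^ n * (- v2 r)" for r
    have q_le: "q r \<le> q R" if "R \<le> r" for r
    proof (rule DERIV_nonpos_imp_decreasing_open [OF that])
      have der: "(q has_real_derivative x ^ n * f (u2 x)) (at x)" if "R \<le> x" for x
      proof -
        have "(q has_real_derivative (n * x ^ Suc m) * (- v2 x) +
            - (- (n / x) * v2 x - f (u2 x)) * x ^ n) (at x)"
          unfolding q_def [abs_def]
          by (intro DERIV_mult DERIV_minus DERIV_pow_Suc m s2.v_deriv) (use that R in simp)
        moreover have "(n * x ^ Suc m) * (- v2 x) + - (- (n / x) * v2 x - f (u2 x)) * x ^ n = x ^ n * f (u2 x)"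
          using that R by (simp add: m field_simps)
        ultimately show ?thesis by simp
      qed
      show "continuous_on {R..r} q"
        by (intro continuous_at_imp_continuous_on ballI DERIV_isCont [OF der]) auto
      fix x assume x: "R < x" "x < r"
      have "x ^ n * f (u2 x) \<le> 0"
        using s1.f_le [of "u2 x"] R1 [of x] x R by (intro mult_nonneg_nonpos) auto
      then show "\<exists>y. (q has_real_derivative y) (at x) \<and> y \<le> 0" using der [of x] x by auto
    qed
    \<comment> \<open>Large enough that
      \<open>q R < r \<delta> \<le> r^(n-1) \<delta>\<close>.\<close>
    define r where "r = max R (q R / \<delta> + 1)"
    have r: "R \<le> r" "q R / \<delta> < r" "1 \<le> r" using R by (auto simp: r_def)
    have rd: "r \<in> s2.descent" using in_d r by simp
    have "\<delta>\<^sup>2 \<le> r\<^sup>2 * (2 * s2.E r)" by (rule Elow [OF rd low [OF rd]]) (use r R in simp)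
    also have "\<dots> \<le> r\<^sup>2 * (v2 r)\<^sup>2"
      using s1.F_le_0 [of "u2 r"] low [OF rd] r R by (intro mult_left_mono) (auto simp: s2.E_def)
    also have "\<dots> = (r * (- v2 r))\<^sup>2" by (simp add: power_mult_distrib)
    finally have sq: "\<delta>\<^sup>2 \<le> (r * (- v2 r))\<^sup>2" .
    have "0 \<le> r * (- v2 r)" using s2.descentD(2) [OF rd] r by (intro mult_nonneg_nonneg) auto
    with sq have "\<delta> \<le> r * (- v2 r)" by (rule power2_le_imp_le)
    then have "r ^ Suc m * \<delta> \<le> r ^ Suc m * (r * (- v2 r))"
      by (rule mult_left_mono) (use r in simp)
    also have "\<dots> = q r" by (simp add: q_def m)
    also have "\<dots> \<le> q R" by (rule q_le) fact
    finally have "r ^ Suc m * \<delta> \<le> q R" .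
    moreover have "r \<le> r ^ Suc m" by (rule self_le_power) (use r in auto)
    then have "r * \<delta> \<le> r ^ Suc m * \<delta>" by (rule mult_right_mono) (use \<delta> in simp)
    moreover have "q R < r * \<delta>" using r(2) \<delta> by (simp add: field_simps)
    ultimately show False by linarith
  qed
qed

end

section \<open>Ground states as solutions that are neither crossing nor trapped\<close>

context well_solution
begin

text \<open>If \<open>u\<close> stays positive, it tends to 0. Otherwise it touches 0 with zero
  slope; for lack of uniqueness it might leave 0 again, so it is replaced by 0 from there on, giving
  a compactly supported ground state.\<close>

lemma ground_state_if:
  assumes u0: "0 < u 0" and nc: "\<not> crossing u" and nt: "\<not> trapped F u v"
  shows "\<exists>w. radial_ground_state (Suc n) f w \<and> w 0 = u 0"
proof (cases "\<forall>r\<ge>0. 0 < u r")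
  case True
  then have "0 \<le> E r" if "0 \<le> r" for r
    by (intro not_trappedD [OF nt that]) auto
  then have "(u \<longlongrightarrow> 0) at_top" using True by (intro u_tendsto_0) auto
  then have "radial_ground_state (Suc n) f u"
    unfolding radial_ground_state_def using u_deriv_within v_deriv True u0
    by (intro exI [of _ v] conjI exI [of _ 0]) (simp_all add: less_imp_le less_imp_neq [OF u0, THEN not_sym])
  then show ?thesis by blast
next
  case False
  then obtain R' where R': "0 \<le> R'" "u R' \<le> 0" by (auto simp: not_less)
  have nonneg: "0 \<le> u r" if "0 \<le> r" for r using nc that by (auto simp: crossing_def not_less)
  have "continuous_on {0..R'} (\<lambda>r. - u r)"
    by (intro continuous_intros continuous_on_subset [OF u_cont]) auto
  then obtain R where R: "0 < R" "- u R = 0"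
    by (rule first_zero) (use u0 R' in auto)
  \<comment> \<open>As \<open>u\<close> does not become negative, its zero is a local
    minimum.\<close>
  have vR: "v R = 0"
  proof (rule DERIV_local_min [OF u_deriv [OF R(1)] R(1)])
    show "\<forall>y. \<bar>R - y\<bar> < R \<longrightarrow> u R \<le> u y" using nonneg R by auto
  qed
  define w where "w r = u (min r R)" for r
  have w_cont: "continuous_on {0..} w"
    unfolding w_def by (rule continuous_on_compose2 [OF u_cont]) (use R in \<open>auto intro!: continuous_intros\<close>)
  have fw_cont: "continuous_on {0..} (\<lambda>t. f (w t))"
    by (rule continuous_on_compose2 [OF contf w_cont]) auto
  have w_eq: "w t = u t" if "t \<le> R" for t using that by (simp add: w_def)
  have w0: "w t = 0" if "R \<le> t" for t using that R by (simp add: w_def)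
  have rint_w: "rint n (\<lambda>t. f (w t)) r = rint n (\<lambda>t. f (u t)) r" if "r \<le> R" for r
    unfolding rint_def by (rule integral_cong) (use that in \<open>simp add: w_eq\<close>)
  \<comment> \<open>The flux vanishes at \<open>R\<close>, so the continuation by 0 still satisfies
    the integral equation.\<close>
  have rint_R: "rint n (\<lambda>t. f (u t)) R = 0"
    using v_eq [of R] vR R(1) by (simp add: rmean_def)
  have rint_w0: "rint n (\<lambda>t. f (w t)) r = 0" if "R \<le> r" for r
  proof -
    have "integral {0..R} (\<lambda>t. t ^ n * f (w t)) + integral {R..r} (\<lambda>t. t ^ n * f (w t))
        = integral {0..r} (\<lambda>t. t ^ n * f (w t))"
      by (rule Henstock_Kurzweil_Integration.integral_combine)
         (use that R fw_cont in \<open>auto intro: rint_arg_integrable\<close>)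
    moreover have "integral {R..r} (\<lambda>t. t ^ n * f (w t)) = integral {R..r} (\<lambda>t. 0)"
      by (rule integral_cong) (simp add: w0 f_nonpos0)
    ultimately show ?thesis using rint_w [of R] rint_R by (simp add: rint_def)
  qed
  have "rsol n f w (\<lambda>r. - rmean n (\<lambda>t. f (w t)) r)"
  proof (rule rsolI [OF contf w_cont])
    show "1 \<le> n" using n by simp
    fix r :: real assume r: "0 \<le> r"
    show "w r = u 0 - integral {0..r} (rmean n (\<lambda>t. f (w t)))"
    proof (cases "r \<le> R")
      case True
      have "integral {0..r} (rmean n (\<lambda>t. f (w t))) = integral {0..r} (rmean n (\<lambda>t. f (u t)))"
        by (rule integral_cong) (use True in \<open>simp add: rmean_def rint_w\<close>)
      then show ?thesis using u_eq [OF r] True by (simp add: w_eq)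
    next
      case False
      have "integral {0..R} (rmean n (\<lambda>t. f (w t))) + integral {R..r} (rmean n (\<lambda>t. f (w t)))
          = integral {0..r} (rmean n (\<lambda>t. f (w t)))"
        by (rule Henstock_Kurzweil_Integration.integral_combine)
           (use False R in \<open>auto intro!: integrable_continuous_real
              continuous_on_subset [OF continuous_on_rmean [OF fw_cont]]\<close>)
      moreover have "integral {R..r} (rmean n (\<lambda>t. f (w t))) = integral {R..r} (\<lambda>t. 0)"
        by (rule integral_cong) (simp add: rmean_def rint_w0)
      moreover have "integral {0..R} (rmean n (\<lambda>t. f (w t))) = integral {0..R} (rmean n (\<lambda>t. f (u t)))"
        by (rule integral_cong) (simp add: rmean_def rint_w)
      ultimately show ?thesis using u_eq [of R] R False by (simp add: w0)
    qed
  qed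
  moreover have "(w \<longlongrightarrow> 0) at_top"
  proof (rule tendsto_eventually)
    show "\<forall>\<^sub>F r in at_top. w r = 0"
      by (rule eventually_at_top_linorderI [of R]) (rule w0)
  qed
  moreover have "\<forall>r\<ge>0. 0 \<le> w r" "w 0 = u 0" using nonneg R by (auto simp: w_def)
  moreover have "\<exists>r\<ge>0. w r \<noteq> 0" using calculation(4) u0 by (intro exI [of _ 0]) auto
  ultimately show ?thesis unfolding radial_ground_state_def rsol_def
    by (intro exI [of _ w] conjI exI [of _ "\<lambda>r. - rmean n (\<lambda>t. f (w t)) r"]) auto
qed

text \<open>The energy is nonincreasing and at least \<open>F(u)\<close>, which tends to
  \<open>F 0 = 0\<close>.\<close>

lemma ground_state_untrapped:
  assumes nonneg: "\<And>r. 0 \<le> r \<Longrightarrow> 0 \<le> u r" and lim: "(u \<longlongrightarrow> 0) at_top"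
  shows "0 \<le> r \<Longrightarrow> 0 \<le> E r" "\<not> trapped F u v"
proof -
  have "0 \<le> E r" if r: "0 \<le> r" for r
  proof (rule tendsto_upperbound)
    have "isCont F 0" by (rule DERIV_isCont [OF F_derivU])
    then have "((\<lambda>t. F (u t)) \<longlongrightarrow> F 0) at_top" by (rule isCont_tendsto_compose [OF _ lim])
    then show "((\<lambda>t. F (u t)) \<longlongrightarrow> 0) at_top" by (simp add: F_nonpos0)
    have "F (u t) \<le> E r" if "r \<le> t" for t
      using F_le_E [of t] E_antimono [OF r that] by simp
    then show "\<forall>\<^sub>F t in at_top. F (u t) \<le> E r" by (rule eventually_at_top_linorderI)
  qed simp
  then show "0 \<le> r \<Longrightarrow> 0 \<le> E r" "\<not> trapped F u v"
    unfolding trapped_def E_def [symmetric] by (auto simp: not_less)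
qed

text \<open>From height 0 the energy would be 0 forever, so its rate of loss would vanish and
  \<open>u\<close> would be constant.\<close>

lemma ground_state_pos:
  assumes nonneg: "\<And>r. 0 \<le> r \<Longrightarrow> 0 \<le> u r" and lim: "(u \<longlongrightarrow> 0) at_top"
    and nz: "0 \<le> x" "u x \<noteq> 0"
  shows "0 < u 0"
proof (rule ccontr)
  assume "\<not> 0 < u 0"
  then have u0: "u 0 = 0" using nonneg [of 0] by simp
  have E: "E r = 0" if "0 \<le> r" for r
    using ground_state_untrapped(1) [OF nonneg lim that] E_antimono [of 0 r] that
    by (simp add: E0 u0 F_nonpos0)
  have v: "v r = 0" if r: "0 < r" for r
  proof -
    have "((\<lambda>r. 0) has_real_derivative - (n / r) * (v r)\<^sup>2) (at r)"
      by (rule has_field_derivative_transform_within_open [OF E_deriv [OF r], of "{0<..}"])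
         (use r E in auto)
    then have "- (n / r) * (v r)\<^sup>2 = 0" using DERIV_const DERIV_unique by blast
    then show ?thesis using n r by simp
  qed
  have x: "0 < x" using nz u0 by (cases "x = 0") auto
  obtain z where "0 < z" "u x - u 0 = (x - 0) * v z"
    by (rule real_mvt [of 0 x u v])
       (use x in \<open>auto intro: u_deriv continuous_on_subset [OF u_cont]\<close>)
  then show False using v u0 nz by simp
qed

end

section \<open>Compactness and shooting\<close>

lemma continuous_on_integral_from_0:
  fixes g :: "real \<Rightarrow> real"
  assumes "continuous_on {0..} g"
  shows "continuous_on {0..} (\<lambda>r. integral {0..r} g)"
  unfolding continuous_on_eq_continuous_within
proof
  fix x :: real assume "x \<in> {0..}"
  then show "continuous (at x within {0..}) (\<lambda>r. integral {0..r} g)"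
    by (intro DERIV_continuous [OF has_real_derivative_integral_within [OF assms]]) simp
qed

text \<open>The slope at radius \<open>r\<close> is at most \<open>M r\<close>. The constant depends
  only on \<open>M\<close> and the radii, which is the equicontinuity needed for
  compactness.\<close>

lemma radial_lipschitz:
  assumes g: "continuous_on {0..} g" and M: "\<And>r. 0 \<le> r \<Longrightarrow> \<bar>g r\<bar> \<le> M"
    and w: "\<And>r. 0 \<le> r \<Longrightarrow> w r = d - integral {0..r} (rmean n g)"
    and xy: "0 \<le> x" "0 \<le> y"
  shows "\<bar>w x - w y\<bar> \<le> M * max x y * \<bar>x - y\<bar>"
proof -
  have M0: "0 \<le> M" using M [of 0] by simp
  have *: "\<bar>w a - w c\<bar> \<le> M * c * (c - a)" if ac: "0 \<le> a" "a < c" for a c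
  proof -
    have rc: "continuous_on {0..} (rmean n g)" by (rule continuous_on_rmean [OF g])
    obtain z where z: "a < z" "z < c"
      "integral {0..c} (rmean n g) - integral {0..a} (rmean n g) = (c - a) * rmean n g z"
    proof (rule real_mvt [OF ac(2)])
      have "continuous_on {0..} (\<lambda>r. integral {0..r} (rmean n g))"
        by (rule continuous_on_integral_from_0 [OF rc])
      then show "continuous_on {a..c} (\<lambda>r. integral {0..r} (rmean n g))"
        by (rule continuous_on_subset) (use ac in auto)
      show "((\<lambda>r. integral {0..r} (rmean n g)) has_real_derivative rmean n g x) (at x)"
        if "a < x" "x < c" for x
        by (rule has_real_derivative_integral [OF rc]) (use that ac in simp)
    qed
    have "\<bar>rmean n g z\<bar> \<le> M * z"
      by (rule rmean_abs_bound [OF g]) (use z ac M in auto)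
    also have "\<dots> \<le> M * c" using z M0 by (intro mult_left_mono) auto
    finally have "\<bar>rmean n g z\<bar> * (c - a) \<le> M * c * (c - a)"
      using ac by (intro mult_right_mono) auto
    moreover have "w a - w c = (c - a) * rmean n g z"
      using z(3) w ac by simp
    ultimately show ?thesis using ac by (simp add: abs_mult mult.commute)
  qed
  show ?thesis
    using *[of x y] *[of y x] xy by (cases x y rule: linorder_cases) (auto simp: abs_minus_commute max_def)
qed

text \<open>An Arzela-Ascoli argument. The sources \<open>g k\<close> need only approach
  \<open>f (w k)\<close> pointwise at positive radii; this covers Picard iterates, where the source
  comes from the preceding iterate, varying nonlinearities, and solutions with a singular part
  removed. The last conclusion carries positivity on \<open>[0,R]\<close> from the limit back to the
  sequence.\<close>

lemma radial_compactness:
  fixes w g :: "nat \<Rightarrow> real \<Rightarrow> real"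
  assumes n: "1 \<le> n" and f: "continuous_on UNIV f"
    and g: "\<And>k. continuous_on {0..} (g k)" and M: "\<And>k r. 0 \<le> r \<Longrightarrow> \<bar>g k r\<bar> \<le> M"
    and w: "\<And>k r. 0 \<le> r \<Longrightarrow> w k r = d k - integral {0..r} (rmean n (g k))"
    and d: "\<And>k. \<bar>d k\<bar> \<le> B"
    and conv: "\<And>r. 0 < r \<Longrightarrow> (\<lambda>k. g k r - f (w k r)) \<longlonglongrightarrow> 0"
  obtains h W where "strict_mono h"
    "rsol n f W (\<lambda>r. - rmean n (\<lambda>t. f (W t)) r)"
    "\<And>r. 0 \<le> r \<Longrightarrow> (\<lambda>k. w (h k) r) \<longlonglongrightarrow> W r"
    "\<And>r. 0 \<le> r \<Longrightarrow> (\<lambda>k. rmean n (g (h k)) r) \<longlonglongrightarrow> rmean n (\<lambda>t. f (W t)) r"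
    "\<And>R. (\<And>r. r \<in> {0..R} \<Longrightarrow> 0 < W r) \<Longrightarrow> \<forall>\<^sub>F k in sequentially. \<forall>r\<in>{0..R}. 0 < w (h k) r"
proof -
  have M0: "0 \<le> M" using M [of 0 0] by simp
  have cancel: "c * (e / (a * c)) = e / a" if "0 < c" for a c e :: real using that by simp
  have lip: "\<bar>w k x - w k y\<bar> \<le> M * max x y * \<bar>x - y\<bar>" if "0 \<le> x" "0 \<le> y" for k x y
    by (rule radial_lipschitz [OF g M w that])
  define S where "S = \<rat> \<inter> {0::real..}"
  \<comment> \<open>Division by \<open>1 + x^2\<close> makes the quadratic growth bound uniform over
    all rational radii, as the diagonal argument requires.\<close>
  have bnd: "norm (w k x / (1 + x\<^sup>2)) \<le> B + M" if "x \<in> S" for k x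
  proof -
    have x: "0 \<le> x" using that by (simp add: S_def)
    have "\<bar>w k x - w k 0\<bar> \<le> M * x * x" using lip [of x 0 k] x by simp
    moreover have "\<bar>w k 0\<bar> \<le> B" using w [of 0 k] d [of k] by simp
    ultimately have "\<bar>w k x\<bar> \<le> B + M * x\<^sup>2" by (simp add: power2_eq_square)
    also have "\<dots> \<le> (B + M) * (1 + x\<^sup>2)" using M0 d [of k] by (simp add: algebra_simps)
    finally show ?thesis by (simp add: divide_le_eq add_pos_nonneg)
  qed
  have "countable S" unfolding S_def using countable_rat by blast
  then obtain h where h: "strict_mono h"
    and hc: "\<And>x. x \<in> S \<Longrightarrow> \<exists>l. (\<lambda>k. w (h k) x / (1 + x\<^sup>2)) \<longlonglongrightarrow> l"
    by (rule function_convergent_subsequence [of S "\<lambda>k x. w k x / (1 + x\<^sup>2)" "B + M"])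
       (use bnd in auto)
  have convS: "convergent (\<lambda>k. w (h k) x)" if x: "x \<in> S" for x
  proof -
    obtain l where "(\<lambda>k. w (h k) x / (1 + x\<^sup>2)) \<longlonglongrightarrow> l" using hc [OF x] by blast
    then have "(\<lambda>k. w (h k) x / (1 + x\<^sup>2) * (1 + x\<^sup>2)) \<longlonglongrightarrow> l * (1 + x\<^sup>2)" by (intro tendsto_intros)
    moreover have "1 + x\<^sup>2 \<noteq> 0" by (smt (verit) zero_le_power2)
    ultimately show ?thesis by (auto simp: convergent_def)
  qed
  have conv_all: "convergent (\<lambda>k. w (h k) r)" if r: "0 \<le> r" for r
  proof (rule Cauchy_convergent, rule CauchyI)
    fix e :: real assume e: "0 < e"
    define \<delta> where "\<delta> = min 1 (e / (4 * (M * (r + 1) + 1)))"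
    have pos: "0 < M * (r + 1) + 1" using M0 r by (simp add: add_nonneg_pos)
    have \<delta>: "0 < \<delta>" "\<delta> \<le> 1" using e pos by (auto simp: \<delta>_def)
    obtain q where q: "q \<in> \<rat>" "r < q" "q < r + \<delta>" using Rats_dense_in_real [of r "r + \<delta>"] \<delta> by auto
    have close: "\<bar>w k r - w k q\<bar> \<le> e / 4" for k
    proof -
      have "\<bar>w k r - w k q\<bar> \<le> M * max r q * \<bar>r - q\<bar>" by (rule lip) (use q r in auto)
      also have "\<dots> \<le> (M * (r + 1) + 1) * \<delta>"
      proof (rule mult_mono)
        have "M * max r q \<le> M * (r + 1)" using q r M0 \<delta> by (intro mult_left_mono) auto
        then show "M * max r q \<le> M * (r + 1) + 1" by simp
      qed (use q pos in auto)
      also have "\<dots> \<le> (M * (r + 1) + 1) * (e / (4 * (M * (r + 1) + 1)))"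
        using pos by (intro mult_left_mono) (auto simp: \<delta>_def)
      also have "\<dots> = e / 4" using cancel [of "M * (r + 1) + 1" e 4] pos by simp
      finally show ?thesis .
    qed
    have "Cauchy (\<lambda>k. w (h k) q)"
      by (rule convergent_Cauchy, rule convS) (use q r in \<open>simp add: S_def\<close>)
    then obtain K where K: "\<And>i j. K \<le> i \<Longrightarrow> K \<le> j \<Longrightarrow> norm (w (h i) q - w (h j) q) < e / 4"
      using CauchyD [of _ "e / 4"] e by (metis zero_less_divide_iff zero_less_numeral)
    have "norm (w (h i) r - w (h j) r) < e" if "K \<le> i" "K \<le> j" for i j
      using close [of "h i"] close [of "h j"] K [OF that] e unfolding real_norm_def by linarith
    then show "\<exists>K. \<forall>i\<ge>K. \<forall>j\<ge>K. norm (w (h i) r - w (h j) r) < e" by blast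
  qed
  define W where "W r = lim (\<lambda>k. w (h k) r)" for r
  have W: "(\<lambda>k. w (h k) r) \<longlonglongrightarrow> W r" if "0 \<le> r" for r
    using conv_all [OF that] by (simp add: W_def convergent_LIMSEQ_iff)
  have W_lip: "\<bar>W x - W y\<bar> \<le> M * max x y * \<bar>x - y\<bar>" if "0 \<le> x" "0 \<le> y" for x y
  proof (rule tendsto_upperbound)
    show "(\<lambda>k. \<bar>w (h k) x - w (h k) y\<bar>) \<longlonglongrightarrow> \<bar>W x - W y\<bar>"
      by (intro tendsto_intros W that)
  qed (use lip that in auto)
  have W_cont: "continuous_on {0..} W"
    unfolding continuous_on_iff
  proof (intro ballI allI impI)
    fix x e :: real assume x: "x \<in> {0..}" and e: "0 < e"
    define \<delta> where "\<delta> = min 1 (e / (M * (x + 1) + 1))"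
    have pos: "0 < M * (x + 1) + 1" using M0 x by (simp add: add_nonneg_pos)
    have \<delta>: "0 < \<delta>" "\<delta> \<le> 1" using e pos by (auto simp: \<delta>_def)
    have "dist (W y) (W x) < e" if y: "y \<in> {0..}" "dist y x < \<delta>" for y
    proof -
      have yx: "\<bar>y - x\<bar> < \<delta>" using y by (simp add: dist_real_def)
      have "\<bar>W y - W x\<bar> \<le> M * max y x * \<bar>y - x\<bar>" using W_lip x y by simp
      also have "\<dots> \<le> M * (x + 1) * \<bar>y - x\<bar>"
        using yx \<delta> M0 by (intro mult_right_mono mult_left_mono) auto
      also have "\<dots> \<le> (M * (x + 1) + 1) * \<bar>y - x\<bar>" by (intro mult_right_mono) auto
      also have "\<dots> < (M * (x + 1) + 1) * \<delta>" using yx pos by (intro mult_strict_left_mono)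
      also have "\<dots> \<le> (M * (x + 1) + 1) * (e / (M * (x + 1) + 1))"
        using pos by (intro mult_left_mono) (auto simp: \<delta>_def)
      also have "\<dots> = e" using cancel [of "M * (x + 1) + 1" e 1] pos by simp
      finally show ?thesis by (simp add: dist_real_def)
    qed
    then show "\<exists>\<delta>>0. \<forall>y\<in>{0..}. dist y x < \<delta> \<longrightarrow> dist (W y) (W x) < e" using \<delta>(1) by blast
  qed
  have fW: "continuous_on {0..} (\<lambda>t. f (W t))"
    by (rule continuous_on_compose2 [OF f W_cont]) auto
  have gconv: "(\<lambda>k. g (h k) r) \<longlonglongrightarrow> f (W r)" if r: "0 < r" for r
  proof -
    have "isCont f (W r)" using f by (simp add: continuous_on_eq_continuous_at)
    then have "(\<lambda>k. f (w (h k) r)) \<longlonglongrightarrow> f (W r)"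
      by (rule isCont_tendsto_compose) (use W r in simp)
    moreover have "(\<lambda>k. g (h k) r - f (w (h k) r)) \<longlonglongrightarrow> 0"
      using LIMSEQ_subseq_LIMSEQ [OF conv [OF r] h] by (simp add: o_def)
    ultimately have "(\<lambda>k. (g (h k) r - f (w (h k) r)) + f (w (h k) r)) \<longlonglongrightarrow> 0 + f (W r)"
      by (intro tendsto_add)
    then show ?thesis by simp
  qed
  have rint_conv: "(\<lambda>k. rint n (g (h k)) r) \<longlonglongrightarrow> rint n (\<lambda>t. f (W t)) r" if r: "0 \<le> r" for r
    unfolding rint_def
  proof (rule dominated_convergence(2) [where h = "\<lambda>_. r ^ n * M"])
    show "(\<lambda>t. t ^ n * g (h k) t) integrable_on {0..r}" for k by (rule rint_arg_integrable [OF g])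
    show "(\<lambda>_. r ^ n * M) integrable_on {0..r}" by (rule integrable_const_ivl)
    show "norm (t ^ n * g (h k) t) \<le> r ^ n * M" if "t \<in> {0..r}" for k t
      using that M [of t "h k"] by (auto simp: abs_mult intro!: mult_mono power_mono)
    \<comment> \<open>Convergence of the sources is not assumed at \<open>t = 0\<close>, but the
      weight \<open>t^n\<close> vanishes there.\<close>
    show "(\<lambda>k. t ^ n * g (h k) t) \<longlonglongrightarrow> t ^ n * f (W t)" if "t \<in> {0..r}" for t
    proof (cases "t = 0")
      case False
      then show ?thesis using that by (intro tendsto_intros gconv) auto
    qed (use n in \<open>simp add: power_0_left\<close>)
  qed
  have rmean_conv: "(\<lambda>k. rmean n (g (h k)) r) \<longlonglongrightarrow> rmean n (\<lambda>t. f (W t)) r" if r: "0 \<le> r" for r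
  proof (cases "r = 0")
    case False
    then show ?thesis unfolding rmean_def by (intro tendsto_intros rint_conv r) simp
  qed simp
  have int_conv: "(\<lambda>k. integral {0..r} (rmean n (g (h k)))) \<longlonglongrightarrow> integral {0..r} (rmean n (\<lambda>t. f (W t)))"
    if r: "0 \<le> r" for r
  proof (rule dominated_convergence(2) [where h = "\<lambda>_. M * r"])
    show "rmean n (g (h k)) integrable_on {0..r}" for k
      by (intro integrable_continuous_real continuous_on_subset [OF continuous_on_rmean [OF g]]) auto
    show "(\<lambda>_. M * r) integrable_on {0..r}" by (rule integrable_const_ivl)
    show "norm (rmean n (g (h k)) t) \<le> M * r" if t: "t \<in> {0..r}" for k t
    proof -
      have "\<bar>rmean n (g (h k)) t\<bar> \<le> M * t" by (rule rmean_abs_bound [OF g]) (use t M in auto)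
      also have "\<dots> \<le> M * r" using t M0 by (intro mult_left_mono) auto
      finally show ?thesis by simp
    qed
    show "(\<lambda>k. rmean n (g (h k)) t) \<longlonglongrightarrow> rmean n (\<lambda>t. f (W t)) t" if "t \<in> {0..r}" for t
      using that by (intro rmean_conv) auto
  qed
  have W_eq: "W r = W 0 - integral {0..r} (rmean n (\<lambda>t. f (W t)))" if r: "0 \<le> r" for r
  proof (rule LIMSEQ_unique [OF W [OF r]])
    have "w (h k) r = w (h k) 0 - integral {0..r} (rmean n (g (h k)))" for k
      using w [OF r, of "h k"] w [of 0 "h k"] by simp
    moreover have "(\<lambda>k. w (h k) 0 - integral {0..r} (rmean n (g (h k)))) \<longlonglongrightarrow>
        W 0 - integral {0..r} (rmean n (\<lambda>t. f (W t)))"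
      by (intro tendsto_intros W int_conv r) simp
    ultimately show "(\<lambda>k. w (h k) r) \<longlonglongrightarrow> W 0 - integral {0..r} (rmean n (\<lambda>t. f (W t)))" by simp
  qed
  have "\<forall>\<^sub>F k in sequentially. \<forall>r\<in>{0..R}. 0 < w (h k) r"
    if pos: "\<And>r. r \<in> {0..R} \<Longrightarrow> 0 < W r" for R
  proof (cases "0 \<le> R")
    case True
    have "continuous_on {0..R} W" by (rule continuous_on_subset [OF W_cont]) auto
    then obtain x where x: "x \<in> {0..R}" "\<And>r. r \<in> {0..R} \<Longrightarrow> W x \<le> W r"
      using continuous_attains_inf [of "{0..R}" W] True by auto
    define \<mu> where "\<mu> = W x"
    have \<mu>: "0 < \<mu>" using pos [OF x(1)] by (simp add: \<mu>_def)
    define \<delta> where "\<delta> = \<mu> / (2 * (M * R + 1))"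
    have MR: "0 < M * R + 1" using M0 True by (simp add: add_nonneg_pos)
    have \<delta>: "0 < \<delta>" using \<mu> MR by (simp add: \<delta>_def)
    \<comment> \<open>Positivity with a margin at the points of a finite net extends to the whole
      interval by the common Lipschitz bound.\<close>
    obtain T where T: "finite T" "T \<subseteq> {0..R}" "{0..R} \<subseteq> (\<Union>x\<in>T. ball x \<delta>)"
      using seq_compact_imp_totally_bounded [of "{0..R}"] \<delta>
      unfolding compact_eq_seq_compact_metric [symmetric] by (meson compact_Icc)
    have "\<forall>\<^sub>F k in sequentially. \<mu> / 2 < w (h k) t" if "t \<in> T" for t
    proof (rule order_tendstoD(1) [OF W])
      show "0 \<le> t" using T that by auto
      have "\<mu> \<le> W t" using x(2) [of t] T that by (auto simp: \<mu>_def)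
      then show "\<mu> / 2 < W t" using \<mu> by simp
    qed
    then have "\<forall>\<^sub>F k in sequentially. \<forall>t\<in>T. \<mu> / 2 < w (h k) t"
      by (intro eventually_ball_finite T(1)) auto
    then show ?thesis
    proof eventually_elim
      case (elim k)
      show ?case
      proof
        fix r assume r: "r \<in> {0..R}"
        then obtain t where t: "t \<in> T" "dist t r < \<delta>" using T by auto
        have tR: "t \<in> {0..R}" using t T by auto
        have "\<bar>w (h k) r - w (h k) t\<bar> \<le> M * max r t * \<bar>r - t\<bar>" using lip r tR by auto
        also have "\<dots> \<le> (M * R + 1) * \<bar>r - t\<bar>"
        proof (rule mult_right_mono)
          have "M * max r t \<le> M * R" using r tR M0 by (intro mult_left_mono) auto
          then show "M * max r t \<le> M * R + 1" by simp
        qed simp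
        also have "\<dots> \<le> (M * R + 1) * \<delta>"
          using t MR by (intro mult_left_mono) (auto simp: dist_real_def)
        also have "\<dots> = \<mu> / 2" using cancel [of "M * R + 1" \<mu> 2] MR by (simp add: \<delta>_def)
        finally have "\<bar>w (h k) r - w (h k) t\<bar> \<le> \<mu> / 2" .
        moreover have "\<mu> / 2 < w (h k) t" using elim t by blast
        ultimately show "0 < w (h k) r" by linarith
      qed
    qed
  qed simp
  then show ?thesis
    by (intro that [OF h rsolI [OF f W_cont n W_eq] W rmean_conv]) auto
qed

section \<open>Picard iteration for Lipschitz nonlinearities\<close>

lemma rmean_diff:
  assumes "continuous_on {0..} g" "continuous_on {0..} h"
  shows "rmean n (\<lambda>t. g t - h t) r = rmean n g r - rmean n h r"
proof -
  have "rint n (\<lambda>t. g t - h t) r = rint n g r - rint n h r"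
    unfolding rint_def right_diff_distrib
    by (rule integral_diff) (use assms in \<open>auto intro: rint_arg_integrable\<close>)
  then show ?thesis by (simp add: rmean_def diff_divide_distrib)
qed

text \<open>For increasing \<open>G\<close> the mean at \<open>t\<close> is at most
  \<open>t * G t\<close>. This reduces the double integration to one integration against
  \<open>t\<close> and produces the even powers and \<open>exp (L * r^2)\<close> below.\<close>

lemma integral_rmean_bound:
  assumes g: "continuous_on {0..} g" and r: "0 \<le> r"
    and G: "\<And>t. t \<in> {0..r} \<Longrightarrow> \<bar>g t\<bar> \<le> G t" and mono: "\<And>s t. 0 \<le> s \<Longrightarrow> s \<le> t \<Longrightarrow> t \<le> r \<Longrightarrow> G s \<le> G t"
    and H: "\<And>t. (H has_real_derivative t * G t) (at t)"
  shows "\<bar>integral {0..r} (rmean n g)\<bar> \<le> H r - H 0"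
proof -
  have int: "((\<lambda>t. t * G t) has_integral H r - H 0) {0..r}"
    by (rule fundamental_theorem_of_calculus [OF r])
       (use H in \<open>simp add: has_real_derivative_iff_has_vector_derivative [symmetric] has_field_derivative_at_within\<close>)
  have "norm (integral {0..r} (rmean n g)) \<le> integral {0..r} (\<lambda>t. t * G t)"
  proof (rule integral_norm_bound_integral)
    show "rmean n g integrable_on {0..r}"
      by (intro integrable_continuous_real continuous_on_subset [OF continuous_on_rmean [OF g]]) auto
    show "(\<lambda>t. t * G t) integrable_on {0..r}" using int by blast
    fix t assume t: "t \<in> {0..r}"
    have "\<bar>rmean n g t\<bar> \<le> G t * t"
    proof (rule rmean_abs_bound [OF g])
      fix s assume s: "s \<in> {0..t}"
      then have "\<bar>g s\<bar> \<le> G s" using t by (intro G) auto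
      also have "G s \<le> G t" using s t by (intro mono) auto
      finally show "\<bar>g s\<bar> \<le> G t" .
    qed (use t in simp)
    then show "norm (rmean n g t) \<le> t * G t" by (simp add: mult.commute)
  qed
  also have "\<dots> = H r - H 0" using int by (rule integral_unique)
  finally show ?thesis by simp
qed

lemma convergent_if_summable_diff:
  fixes x :: "nat \<Rightarrow> real"
  assumes "\<And>k. \<bar>x (Suc k) - x k\<bar> \<le> c k" "summable c"
  shows "convergent x"
proof -
  have "summable (\<lambda>k. x (Suc k) - x k)"
    by (rule summable_comparison_test' [OF assms(2)]) (use assms(1) in simp)
  then have "convergent (\<lambda>n. \<Sum>k<n. x (Suc k) - x k)" by (simp add: summable_iff_convergent)
  then have "convergent (\<lambda>n. x n - x 0)" by (simp add: sum_lessThan_telescope)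
  then have "convergent (\<lambda>n. (x n - x 0) + x 0)" by (intro convergent_add convergent_const)
  then show ?thesis by simp
qed

primrec picard :: "nat \<Rightarrow> (real \<Rightarrow> real) \<Rightarrow> real \<Rightarrow> nat \<Rightarrow> real \<Rightarrow> real" where
  "picard n f a 0 = (\<lambda>r. a)"
| "picard n f a (Suc k) = (\<lambda>r. a - integral {0..r} (rmean n (\<lambda>t. f (picard n f a k t))))"

context
  fixes n :: nat and f :: "real \<Rightarrow> real" and L M :: real
  assumes n: "1 \<le> n" and L: "\<And>x y. \<bar>f x - f y\<bar> \<le> L * \<bar>x - y\<bar>" and M: "\<And>x. \<bar>f x\<bar> \<le> M"
begin

lemma L_nonneg: "0 \<le> L" using L [of 1 0] by simp

lemma lipschitz_cont: "continuous_on UNIV f"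
proof -
  have "L-lipschitz_on UNIV f"
    by (rule lipschitz_onI) (use L L_nonneg in \<open>auto simp: dist_real_def\<close>)
  then show ?thesis by (rule lipschitz_on_continuous_on)
qed

lemma picard_cont: "continuous_on {0..} (picard n f a k)"
proof (induction k)
  case (Suc k)
  have "continuous_on {0..} (\<lambda>t. f (picard n f a k t))"
    by (rule continuous_on_compose2 [OF lipschitz_cont Suc]) auto
  then have "continuous_on {0..} (\<lambda>r. integral {0..r} (rmean n (\<lambda>t. f (picard n f a k t))))"
    by (intro continuous_on_integral_from_0 continuous_on_rmean)
  then show ?case by (auto intro!: continuous_intros)
qed simp

lemma f_picard_cont: "continuous_on {0..} (\<lambda>t. f (picard n f a k t))"
  by (rule continuous_on_compose2 [OF lipschitz_cont picard_cont]) auto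

lemma picard_Suc_diff:
  assumes "0 \<le> r"
  shows "picard n f a (Suc k) r - picard n f c (Suc j) r =
    (a - c) - integral {0..r} (rmean n (\<lambda>t. f (picard n f a k t) - f (picard n f c j t)))"
proof -
  have int: "rmean n (\<lambda>t. f (picard n f a k t)) integrable_on {0..r}" for a k
    by (intro integrable_continuous_real continuous_on_subset [OF continuous_on_rmean [OF f_picard_cont]]) auto
  have "integral {0..r} (rmean n (\<lambda>t. f (picard n f a k t) - f (picard n f c j t)))
      = integral {0..r} (\<lambda>t. rmean n (\<lambda>t. f (picard n f a k t)) t - rmean n (\<lambda>t. f (picard n f c j t)) t)"
    by (rule integral_cong) (rule rmean_diff [OF f_picard_cont f_picard_cont])
  also have "\<dots> = integral {0..r} (rmean n (\<lambda>t. f (picard n f a k t)))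
      - integral {0..r} (rmean n (\<lambda>t. f (picard n f c j t)))"
    by (rule integral_diff) (rule int)+
  finally show ?thesis by simp
qed

text \<open>Each iteration multiplies by \<open>L\<close> and integrates \<open>t^(2k+3)\<close>;
  the gain \<open>1 / (2k+4)\<close> is weakened to \<open>1 / (k+1)\<close> so that a factorial
  builds up.\<close>

lemma picard_step:
  "0 \<le> r \<Longrightarrow> \<bar>picard n f a (Suc k) r - picard n f a k r\<bar> \<le> M * L ^ k / fact k * r ^ (2 * k + 2)"
proof (induction k arbitrary: r)
  case 0
  have M0: "0 \<le> M" using M [of 0] by simp
  have "\<bar>integral {0..r} (rmean n (\<lambda>t. f a))\<bar> \<le> M * r\<^sup>2 / 2 - M * 0\<^sup>2 / 2"
    by (rule integral_rmean_bound [where G = "\<lambda>_. M"]) (use 0 M in \<open>auto intro!: derivative_eq_intros\<close>)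
  also have "\<dots> \<le> M * r\<^sup>2" using M0 by simp
  finally show ?case by (simp add: power2_eq_square)
next
  case (Suc k)
  define A where "A = L * (M * L ^ k / fact k)"
  have M0: "0 \<le> M" using M [of 0] by simp
  have A0: "0 \<le> A" using M0 L_nonneg by (simp add: A_def)
  have "\<bar>picard n f a (Suc (Suc k)) r - picard n f a (Suc k) r\<bar> =
      \<bar>integral {0..r} (rmean n (\<lambda>t. f (picard n f a (Suc k) t) - f (picard n f a k t)))\<bar>"
    using picard_Suc_diff [OF Suc.prems, of a "Suc k" a k] by (simp del: picard.simps)
  also have "\<dots> \<le> A * r ^ (2 * k + 4) / (2 * k + 4) - A * 0 ^ (2 * k + 4) / (2 * k + 4)"
  proof (rule integral_rmean_bound [where G = "\<lambda>t. A * t ^ (2 * k + 2)"])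
    show "continuous_on {0..} (\<lambda>t. f (picard n f a (Suc k) t) - f (picard n f a k t))"
      by (intro continuous_on_diff f_picard_cont)
    fix t assume t: "t \<in> {0..r}"
    have "\<bar>f (picard n f a (Suc k) t) - f (picard n f a k t)\<bar> \<le> L * \<bar>picard n f a (Suc k) t - picard n f a k t\<bar>"
      by (rule L)
    also have "\<dots> \<le> L * (M * L ^ k / fact k * t ^ (2 * k + 2))"
      using t by (intro mult_left_mono Suc.IH L_nonneg) auto
    finally show "\<bar>f (picard n f a (Suc k) t) - f (picard n f a k t)\<bar> \<le> A * t ^ (2 * k + 2)"
      by (simp add: A_def)
  next
    fix s t :: real assume "0 \<le> s" "s \<le> t"
    then show "A * s ^ (2 * k + 2) \<le> A * t ^ (2 * k + 2)" using A0 by (intro mult_left_mono power_mono)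
  next
    fix t :: real
    have "((\<lambda>r. A * r ^ (2 * k + 4) / (2 * k + 4)) has_real_derivative
        A * (real (2 * k + 4) * t ^ (2 * k + 3)) / (2 * k + 4)) (at t)"
      by (intro DERIV_cdivide DERIV_cmult DERIV_pow_Suc) simp
    moreover have "A * (real (2 * k + 4) * t ^ (2 * k + 3)) / (2 * k + 4) = t * (A * t ^ (2 * k + 2))"
    proof -
      have "t ^ (2 * k + 3) = t * t ^ (2 * k + 2)" by (simp add: eval_nat_numeral)
      then show ?thesis by (simp add: field_simps del: power_add)
    qed
    ultimately show "((\<lambda>r. A * r ^ (2 * k + 4) / (2 * k + 4)) has_real_derivative t * (A * t ^ (2 * k + 2))) (at t)"
      by (simp only:)
  qed (rule Suc.prems)
  also have "\<dots> = A * r ^ (2 * k + 4) / (2 * k + 4)" by simp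
  also have "\<dots> \<le> A * r ^ (2 * k + 4) / (k + 1)"
    using A0 Suc.prems by (intro divide_left_mono) auto
  also have "\<dots> = M * L ^ Suc k / fact (Suc k) * r ^ (2 * Suc k + 2)"
  proof -
    have "2 * Suc k + 2 = 2 * k + 4" by simp
    then show ?thesis by (simp only:) (simp add: A_def mult_ac)
  qed
  finally show ?case .
qed

lemma picard_convergent:
  assumes r: "0 \<le> r"
  shows "convergent (\<lambda>k. picard n f a k r)"
proof (rule convergent_if_summable_diff)
  show "\<bar>picard n f a (Suc k) r - picard n f a k r\<bar> \<le> M * r\<^sup>2 * (inverse (fact k) * (L * r\<^sup>2) ^ k)" for k
  proof -
    have "r ^ (2 * k + 2) = r\<^sup>2 * (r\<^sup>2) ^ k" by (simp only: power_mult power_add mult.commute [of "(r\<^sup>2) ^ k"])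
    then show ?thesis using picard_step [OF r, of a k]
      by (simp add: power_mult_distrib divide_inverse mult_ac del: picard.simps)
  qed
  show "summable (\<lambda>k. M * r\<^sup>2 * (inverse (fact k) * (L * r\<^sup>2) ^ k))"
    by (intro summable_mult summable_exp)
qed

text \<open>The bound reproduces itself, since \<open>t * L * exp (L * t^2)\<close> integrates to
  \<open>(exp (L * r^2) - 1) / 2\<close>; being uniform in \<open>k\<close>, it survives the
  limit.\<close>

lemma picard_dep:
  "0 \<le> r \<Longrightarrow> \<bar>picard n f a k r - picard n f c k r\<bar> \<le> \<bar>a - c\<bar> * exp (L * r\<^sup>2)"
proof (induction k arbitrary: r)
  case 0
  have "\<bar>a - c\<bar> * 1 \<le> \<bar>a - c\<bar> * exp (L * r\<^sup>2)" using L_nonneg by (intro mult_left_mono) auto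
  then show ?case by simp
next
  case (Suc k)
  have "\<bar>integral {0..r} (rmean n (\<lambda>t. f (picard n f a k t) - f (picard n f c k t)))\<bar>
      \<le> \<bar>a - c\<bar> * exp (L * r\<^sup>2) / 2 - \<bar>a - c\<bar> * exp (L * 0\<^sup>2) / 2"
  proof (rule integral_rmean_bound [where G = "\<lambda>t. L * (\<bar>a - c\<bar> * exp (L * t\<^sup>2))"])
    show "continuous_on {0..} (\<lambda>t. f (picard n f a k t) - f (picard n f c k t))"
      by (intro continuous_on_diff f_picard_cont)
    fix t assume t: "t \<in> {0..r}"
    have "\<bar>f (picard n f a k t) - f (picard n f c k t)\<bar> \<le> L * \<bar>picard n f a k t - picard n f c k t\<bar>"
      by (rule L)
    also have "\<dots> \<le> L * (\<bar>a - c\<bar> * exp (L * t\<^sup>2))"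
      using t by (intro mult_left_mono Suc.IH L_nonneg) auto
    finally show "\<bar>f (picard n f a k t) - f (picard n f c k t)\<bar> \<le> L * (\<bar>a - c\<bar> * exp (L * t\<^sup>2))" .
  next
    fix s t :: real assume "0 \<le> s" "s \<le> t"
    then show "L * (\<bar>a - c\<bar> * exp (L * s\<^sup>2)) \<le> L * (\<bar>a - c\<bar> * exp (L * t\<^sup>2))"
      using L_nonneg by (intro mult_left_mono) (auto intro!: mult_left_mono power_mono)
  next
    fix t :: real
    show "((\<lambda>r. \<bar>a - c\<bar> * exp (L * r\<^sup>2) / 2) has_real_derivative t * (L * (\<bar>a - c\<bar> * exp (L * t\<^sup>2)))) (at t)"
      by (auto intro!: derivative_eq_intros)
  qed (rule Suc.prems)
  moreover have "\<bar>a - c\<bar> \<le> \<bar>a - c\<bar> * exp (L * r\<^sup>2)"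
    using mult_left_mono [of 1 "exp (L * r\<^sup>2)" "\<bar>a - c\<bar>"] L_nonneg by simp
  ultimately show ?case
    using abs_triangle_ineq4 [of "a - c" "integral {0..r} (rmean n (\<lambda>t. f (picard n f a k t) - f (picard n f c k t)))"]
    unfolding picard_Suc_diff [OF Suc.prems] by (simp only: power_zero_numeral mult_zero_right exp_zero)
qed

definition flow :: "real \<Rightarrow> real \<Rightarrow> real" where "flow a r = lim (\<lambda>k. picard n f a k r)"

lemma picard_lim: "0 \<le> r \<Longrightarrow> (\<lambda>k. picard n f a k r) \<longlonglongrightarrow> flow a r"
  using picard_convergent by (simp add: flow_def convergent_LIMSEQ_iff)

lemma flow_dep: "0 \<le> r \<Longrightarrow> \<bar>flow a r - flow c r\<bar> \<le> \<bar>a - c\<bar> * exp (L * r\<^sup>2)"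
  by (rule tendsto_upperbound [where f = "\<lambda>k. \<bar>picard n f a k r - picard n f c k r\<bar>" and F = sequentially])
     (intro tendsto_intros picard_lim always_eventually allI picard_dep | simp)+

lemma flow_0: "flow a 0 = a"
proof -
  have "picard n f a k 0 = a" for k by (cases k) auto
  then show ?thesis using picard_lim [of 0 a] by (simp add: LIMSEQ_const_iff)
qed

text \<open>Compactness is applied to the iterates with the source computed from their predecessors;
  convergence of the iterates makes the discrepancy vanish.\<close>

lemma flow_sol: "rsol n f (flow a) (\<lambda>r. - rmean n (\<lambda>t. f (flow a t)) r)"
proof -
  obtain h W where hW: "strict_mono h" "rsol n f W (\<lambda>r. - rmean n (\<lambda>t. f (W t)) r)"
    "\<And>r. 0 \<le> r \<Longrightarrow> (\<lambda>k. picard n f a (Suc (h k)) r) \<longlonglongrightarrow> W r"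
  proof (rule radial_compactness [OF n lipschitz_cont, where w = "\<lambda>k. picard n f a (Suc k)" and
        g = "\<lambda>k t. f (picard n f a k t)" and d = "\<lambda>_. a" and M = M and B = "\<bar>a\<bar>"])
    fix r :: real assume r: "0 < r"
    show "(\<lambda>k. f (picard n f a k r) - f (picard n f a (Suc k) r)) \<longlonglongrightarrow> 0"
    proof -
      have c: "isCont f x" for x using lipschitz_cont by (simp add: continuous_on_eq_continuous_at)
      have "(\<lambda>k. f (picard n f a k r) - f (picard n f a (Suc k) r)) \<longlonglongrightarrow> f (flow a r) - f (flow a r)"
        using picard_lim [of r a] LIMSEQ_Suc [OF picard_lim [of r a]] r
        by (intro tendsto_diff isCont_tendsto_compose [OF c]) (simp_all del: picard.simps)
      then show ?thesis by simp
    qed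
  qed (use f_picard_cont M in auto)
  have W: "W r = flow a r" if "0 \<le> r" for r
  proof (rule LIMSEQ_unique [OF hW(3) [OF that]])
    have "strict_mono (\<lambda>k. Suc (h k))" using hW(1) by (auto simp: strict_mono_def)
    then show "(\<lambda>k. picard n f a (Suc (h k)) r) \<longlonglongrightarrow> flow a r"
      using LIMSEQ_subseq_LIMSEQ [OF picard_lim [OF that]] by (simp add: o_def del: picard.simps)
  qed
  have "rint n (\<lambda>t. f (W t)) r = rint n (\<lambda>t. f (flow a t)) r" for r
    unfolding rint_def by (rule integral_cong) (simp add: W)
  then have eq: "rmean n (\<lambda>t. f (W t)) = rmean n (\<lambda>t. f (flow a t))"
    by (simp add: rmean_def fun_eq_iff)
  show ?thesis unfolding rsol_def
  proof (intro conjI allI impI)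
    fix r :: real
    show "(flow a has_real_derivative - rmean n (\<lambda>t. f (flow a t)) r) (at r within {0..})" if r: "0 \<le> r"
    proof (rule has_field_derivative_transform_within [where d = 1])
      show "(W has_real_derivative - rmean n (\<lambda>t. f (flow a t)) r) (at r within {0..})"
        using hW(2) r unfolding rsol_def eq by blast
      show "W x = flow a x" if "x \<in> {0..}" for x using W that by simp
    qed (use r in auto)
    show "((\<lambda>r. - rmean n (\<lambda>t. f (flow a t)) r) has_real_derivative
        - (n / r) * - rmean n (\<lambda>t. f (flow a t)) r - f (flow a r)) (at r)" if r: "0 < r"
    proof -
      have "W r = flow a r" using W r by simp
      then show ?thesis using hW(2) r unfolding rsol_def eq by auto
    qed
  qed simp
qed

lemma flow_mean_dep:
  assumes r: "0 \<le> r"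
  shows "\<bar>rmean n (\<lambda>t. f (flow a t)) r - rmean n (\<lambda>t. f (flow c t)) r\<bar> \<le> L * (\<bar>a - c\<bar> * exp (L * r\<^sup>2)) * r"
proof -
  have cont: "continuous_on {0..} (\<lambda>t. f (flow a t))" for a
  proof -
    have "continuous_on {0..} (flow a)"
      using flow_sol [of a] DERIV_continuous
      unfolding rsol_def continuous_on_eq_continuous_within by (metis atLeast_iff)
    then show ?thesis by (rule continuous_on_compose2 [OF lipschitz_cont]) auto
  qed
  have "\<bar>rmean n (\<lambda>t. f (flow a t) - f (flow c t)) r\<bar> \<le> L * (\<bar>a - c\<bar> * exp (L * r\<^sup>2)) * r"
  proof (rule rmean_abs_bound)
    show "continuous_on {0..} (\<lambda>t. f (flow a t) - f (flow c t))" by (intro continuous_on_diff cont)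
    fix t assume t: "t \<in> {0..r}"
    have "\<bar>f (flow a t) - f (flow c t)\<bar> \<le> L * \<bar>flow a t - flow c t\<bar>" by (rule L)
    also have "\<dots> \<le> L * (\<bar>a - c\<bar> * exp (L * t\<^sup>2))"
      using t by (intro mult_left_mono flow_dep L_nonneg) auto
    also have "\<dots> \<le> L * (\<bar>a - c\<bar> * exp (L * r\<^sup>2))"
      using t L_nonneg by (intro mult_left_mono) (auto intro!: mult_left_mono power_mono)
    finally show "\<bar>f (flow a t) - f (flow c t)\<bar> \<le> L * (\<bar>a - c\<bar> * exp (L * r\<^sup>2))" .
  qed (rule r)
  then show ?thesis by (simp add: rmean_diff [OF cont cont])
qed

lemma lipschitz_flow_exists:
  "\<exists>U V. \<forall>a. rsol n f (U a) (V a) \<and> U a 0 = a \<and>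
     (\<forall>c. \<forall>r\<ge>0. \<bar>U a r - U c r\<bar> \<le> \<bar>a - c\<bar> * exp (L * r\<^sup>2) \<and>
        \<bar>V a r - V c r\<bar> \<le> L * (\<bar>a - c\<bar> * exp (L * r\<^sup>2)) * r)"
proof (rule exI [of _ flow], rule exI [of _ "\<lambda>a r. - rmean n (\<lambda>t. f (flow a t)) r"], intro allI conjI impI)
  show "\<bar>- rmean n (\<lambda>t. f (flow a t)) r - - rmean n (\<lambda>t. f (flow c t)) r\<bar>
      \<le> L * (\<bar>a - c\<bar> * exp (L * r\<^sup>2)) * r" if "0 \<le> r" for a c r
    using flow_mean_dep [OF that, of a c] by simp
  show "rsol n f (flow a) (\<lambda>r. - rmean n (\<lambda>t. f (flow a t)) r)" for a by (rule flow_sol)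
  show "flow a 0 = a" for a by (rule flow_0)
  show "\<bar>flow a r - flow c r\<bar> \<le> \<bar>a - c\<bar> * exp (L * r\<^sup>2)" if "0 \<le> r" for a c r
    by (rule flow_dep [OF that])
qed

end

section \<open>Lipschitz approximation of the nonlinearity\<close>

lemma antiderivative_exists:
  fixes g :: "real \<Rightarrow> real"
  assumes "continuous_on UNIV g"
  obtains G where "\<And>s. (G has_real_derivative g s) (at s)" "G 0 = 0"
proof -
  have "\<exists>G. \<forall>x. - \<infinity> < ereal x \<longrightarrow> ereal x < \<infinity> \<longrightarrow> (G has_vector_derivative g x) (at x)"
    by (rule einterval_antiderivative) (use assms in \<open>auto simp: continuous_on_eq_continuous_at\<close>)
  then obtain G where G: "\<And>s. (G has_real_derivative g s) (at s)"
    by (auto simp: has_real_derivative_iff_has_vector_derivative)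
  show ?thesis
  proof (rule that)
    fix s
    have "((\<lambda>s. G s - G 0) has_real_derivative g s - 0) (at s)"
      by (intro DERIV_diff G DERIV_const)
    then show "((\<lambda>s. G s - G 0) has_real_derivative g s) (at s)" by simp
  qed simp
qed

text \<open>The approximations are the averages of \<open>f\<close> over intervals of length \<open>1 / k\<close>.\<close>
lemma lipschitz_approximation:
  fixes f F :: "real \<Rightarrow> real"
  assumes F: "\<And>s. (F has_real_derivative f s) (at s)" and uc: "uniformly_continuous_on UNIV f"
    and M: "\<And>s. \<bar>f s\<bar> \<le> M"
  obtains \<phi> :: "nat \<Rightarrow> real \<Rightarrow> real" and \<Phi> :: "nat \<Rightarrow> real \<Rightarrow> real" and L :: "nat \<Rightarrow> real"
  where "\<And>k x y. \<bar>\<phi> k x - \<phi> k y\<bar> \<le> L k * \<bar>x - y\<bar>" "\<And>k s. \<bar>\<phi> k s\<bar> \<le> M"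
    "\<And>k s. (\<Phi> k has_real_derivative \<phi> k s) (at s)" "\<And>k. \<Phi> k 0 = 0"
    "\<And>e. 0 < e \<Longrightarrow> \<forall>\<^sub>F k in sequentially. \<forall>s. \<bar>\<phi> k s - f s\<bar> \<le> e"
proof -
  define \<phi> where "\<phi> k s = Suc k * (F (s + 1 / Suc k) - F s)" for k s
  have F_cont: "continuous_on S F" for S
    by (intro continuous_at_imp_continuous_on ballI) (rule DERIV_isCont [OF F])
  \<comment> \<open>The average is a value of \<open>f\<close> at a nearby point. This gives the
    bound \<open>M\<close> and, by uniform continuity, uniform convergence.\<close>
  have mean: "\<exists>z. s < z \<and> z < s + 1 / Suc k \<and> \<phi> k s = f z" for k s
  proof -
    have less: "s < s + 1 / Suc k" by simp
    obtain z where "s < z" "z < s + 1 / Suc k" "F (s + 1 / Suc k) - F s = (s + 1 / Suc k - s) * f z"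
      by (rule real_mvt [OF less F_cont F])
    then show ?thesis by (intro exI [of _ z]) (simp add: \<phi>_def)
  qed
  have F_lip: "\<bar>F x - F y\<bar> \<le> M * \<bar>x - y\<bar>" for x y
  proof -
    have *: "\<bar>F x - F y\<bar> \<le> M * \<bar>x - y\<bar>" if xy: "x < y" for x y
    proof -
      obtain z where "F y - F x = (y - x) * f z" by (rule real_mvt [OF xy F_cont F])
      then have "\<bar>F y - F x\<bar> = \<bar>y - x\<bar> * \<bar>f z\<bar>" by (simp add: abs_mult)
      then have "\<bar>F x - F y\<bar> = \<bar>y - x\<bar> * \<bar>f z\<bar>" by (simp only: abs_minus_commute [of "F x"])
      also have "\<dots> \<le> \<bar>y - x\<bar> * M" by (intro mult_left_mono M) simp
      finally show ?thesis by (simp add: mult.commute abs_minus_commute)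
    qed
    show ?thesis using *[of x y] *[of y x] by (cases x y rule: linorder_cases) (auto simp: abs_minus_commute)
  qed
  have lip: "\<bar>\<phi> k x - \<phi> k y\<bar> \<le> (Suc k * (2 * M)) * \<bar>x - y\<bar>" for k x y
  proof -
    define e where "e = 1 / real (Suc k)"
    have "\<phi> k x - \<phi> k y = Suc k * ((F (x + e) - F (y + e)) - (F x - F y))"
      by (simp add: \<phi>_def e_def algebra_simps)
    then have "\<bar>\<phi> k x - \<phi> k y\<bar> = Suc k * \<bar>(F (x + e) - F (y + e)) - (F x - F y)\<bar>"
      by (simp add: abs_mult)
    also have "\<dots> \<le> Suc k * (2 * M * \<bar>x - y\<bar>)"
    proof (rule mult_left_mono)
      have "\<bar>(F (x + e) - F (y + e)) - (F x - F y)\<bar> \<le> \<bar>F (x + e) - F (y + e)\<bar> + \<bar>F x - F y\<bar>"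
        by (rule abs_triangle_ineq4)
      also have "\<dots> \<le> M * \<bar>(x + e) - (y + e)\<bar> + M * \<bar>x - y\<bar>" by (intro add_mono F_lip)
      finally show "\<bar>(F (x + e) - F (y + e)) - (F x - F y)\<bar> \<le> 2 * M * \<bar>x - y\<bar>" by simp
    qed simp
    finally show ?thesis by (simp add: mult.assoc)
  qed
  have bound: "\<bar>\<phi> k s\<bar> \<le> M" for k s using mean [of s k] M by auto
  have "continuous_on UNIV (\<phi> k)" for k
    unfolding \<phi>_def by (intro continuous_intros continuous_on_compose2 [OF F_cont [of UNIV]] F_cont) auto
  then have "\<forall>k. \<exists>G. (\<forall>s. (G has_real_derivative \<phi> k s) (at s)) \<and> G 0 = 0"
    using antiderivative_exists by metis
  then obtain \<Phi> where \<Phi>: "\<And>k s. (\<Phi> k has_real_derivative \<phi> k s) (at s)" "\<And>k. \<Phi> k 0 = 0" by metis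
  have conv: "\<forall>\<^sub>F k in sequentially. \<forall>s. \<bar>\<phi> k s - f s\<bar> \<le> e" if e: "0 < e" for e
  proof -
    obtain d where d: "0 < d" "\<And>x y. dist x y < d \<Longrightarrow> dist (f x) (f y) < e"
      using uc e unfolding uniformly_continuous_on_def by (metis UNIV_I)
    have "\<forall>\<^sub>F k in sequentially. inverse (real (Suc k)) < d"
      by (rule order_tendstoD(2) [OF LIMSEQ_inverse_real_of_nat d(1)])
    then show ?thesis
    proof eventually_elim
      case (elim k)
      show ?case
      proof
        fix s
        obtain z where z: "s < z" "z < s + 1 / Suc k" "\<phi> k s = f z" using mean by blast
        then have "dist z s < d" using elim by (simp add: dist_real_def inverse_eq_divide)
        then have "dist (f z) (f s) < e" by (rule d(2))
        then show "\<bar>\<phi> k s - f s\<bar> \<le> e" using z by (simp add: dist_real_def)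
      qed
    qed
  qed
  show ?thesis by (rule that [OF lip bound \<Phi> conv])
qed

section \<open>Shooting\<close>

lemma not_eventually_subseq:
  assumes "\<not> (\<forall>\<^sub>F k in sequentially. P k)"
  obtains h :: "nat \<Rightarrow> nat" where "strict_mono h" "\<And>k. \<not> P (h k)"
proof -
  have "infinite {k. \<not> P k}"
  proof
    assume "finite {k. \<not> P k}"
    then obtain K where K: "\<And>k. \<not> P k \<Longrightarrow> k < K" using finite_nat_set_iff_bounded by auto
    then have "P k" if "K \<le> k" for k using that not_le by blast
    then show False using assms eventually_sequentially by blast
  qed
  from infinite_enumerate [OF this] show ?thesis using that by auto
qed

lemma open_crossing:
  fixes U :: "real \<Rightarrow> real \<Rightarrow> real"
  assumes dep: "\<And>a c r. 0 \<le> r \<Longrightarrow> \<bar>U a r - U c r\<bar> \<le> \<bar>a - c\<bar> * K r" and K: "\<And>r. 0 \<le> r \<Longrightarrow> 0 < K r"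
  shows "0 \<le> r \<Longrightarrow> isCont (\<lambda>a. U a r) a" "open {a. crossing (U a)}"
proof -
  have cont: "isCont (\<lambda>a. U a r) a" if r: "0 \<le> r" for r a
  proof -
    have "((\<lambda>c. U c r - U a r) \<longlongrightarrow> 0) (at a)"
    proof (rule Lim_null_comparison)
      show "\<forall>\<^sub>F c in at a. norm (U c r - U a r) \<le> \<bar>c - a\<bar> * K r"
        using dep [OF r] by (intro always_eventually) auto
      have "((\<lambda>c. \<bar>c - a\<bar> * K r) \<longlongrightarrow> \<bar>a - a\<bar> * K r) (at a)" by (intro tendsto_intros)
      then show "((\<lambda>c. \<bar>c - a\<bar> * K r) \<longlongrightarrow> 0) (at a)" by simp
    qed
    then show ?thesis by (simp add: isCont_def LIM_zero_iff)
  qed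
  then show "0 \<le> r \<Longrightarrow> isCont (\<lambda>a. U a r) a" .
  have "open (\<Union>R\<in>{0..}. {a. U a R < 0})"
    by (intro open_UN ballI open_Collect_less continuous_at_imp_continuous_on cont) auto
  moreover have "(\<Union>R\<in>{0..}. {a. U a R < 0}) = {a. crossing (U a)}" by (auto simp: crossing_def)
  ultimately show "open {a. crossing (U a)}" by simp
qed

text \<open>The witness \<open>R\<close> can be kept: the energy at \<open>R\<close> is continuous
  in the height, and the minimum \<open>\<mu>\<close> of the solution on \<open>[0,R]\<close> is a
  margin for its positivity.\<close>

lemma open_trapped:
  fixes U V :: "real \<Rightarrow> real \<Rightarrow> real"
  assumes dep: "\<And>a c r. 0 \<le> r \<Longrightarrow> \<bar>U a r - U c r\<bar> \<le> \<bar>a - c\<bar> * K r" and K: "\<And>r. 0 \<le> r \<Longrightarrow> 0 < K r"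
    and K_mono: "\<And>r s. 0 \<le> r \<Longrightarrow> r \<le> s \<Longrightarrow> K r \<le> K s"
    and V: "\<And>a r. 0 \<le> r \<Longrightarrow> isCont (\<lambda>a. V a r) a"
    and U: "\<And>a. continuous_on {0..} (U a)" and F: "\<And>s. isCont F s"
  shows "open {a. trapped F (U a) (V a)}"
proof (subst open_subopen, rule ballI)
  fix a assume "a \<in> {a. trapped F (U a) (V a)}"
  then obtain R where R: "0 \<le> R" "\<And>r. r \<in> {0..R} \<Longrightarrow> 0 < U a r" "(V a R)\<^sup>2 / 2 + F (U a R) < 0"
    by (auto simp: trapped_def)
  obtain x where x: "x \<in> {0..R}" "\<And>r. r \<in> {0..R} \<Longrightarrow> U a x \<le> U a r"
    using continuous_attains_inf [of "{0..R}" "U a"] R(1) continuous_on_subset [OF U, of "{0..R}" a] by auto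
  define \<mu> where "\<mu> = U a x"
  have \<mu>: "0 < \<mu>" using R x by (simp add: \<mu>_def)
  define T where "T = {c. (V c R)\<^sup>2 / 2 + F (U c R) < 0} \<inter> ball a (\<mu> / K R)"
  have UR: "isCont (\<lambda>a. U a R) c" for c by (rule open_crossing(1) [OF dep K R(1)])
  have "isCont (\<lambda>c. F (U c R)) c" for c
    by (rule isCont_o2 [OF UR F])
  then have "isCont (\<lambda>c. (V c R)\<^sup>2 / 2 + F (U c R)) c" for c
    by (intro isCont_add isCont_divide isCont_power V R(1) continuous_const) auto
  then have "continuous_on UNIV (\<lambda>c. (V c R)\<^sup>2 / 2 + F (U c R))"
    by (intro continuous_at_imp_continuous_on ballI)
  then have "open {c. (V c R)\<^sup>2 / 2 + F (U c R) < 0}"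
    by (rule open_Collect_less) (rule continuous_on_const)
  then have "open T" unfolding T_def by (intro open_Int open_ball)
  moreover have "a \<in> T" using R \<mu> K [OF R(1)] by (simp add: T_def)
  moreover have "T \<subseteq> {a. trapped F (U a) (V a)}"
  proof
    fix c assume c: "c \<in> T"
    have "0 < U c r" if r: "r \<in> {0..R}" for r
    proof -
      have "\<bar>a - c\<bar> < \<mu> / K R" using c by (simp add: T_def dist_real_def)
      then have "\<bar>a - c\<bar> * K R < \<mu>" using K [OF R(1)] by (simp add: field_simps)
      moreover have "\<bar>a - c\<bar> * K r \<le> \<bar>a - c\<bar> * K R" using r by (intro mult_left_mono K_mono) auto
      moreover have "\<bar>U a r - U c r\<bar> \<le> \<bar>a - c\<bar> * K r" using r by (intro dep) auto
      moreover have "\<mu> \<le> U a r" using x(2) [OF r] by (simp add: \<mu>_def)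
      ultimately show ?thesis by linarith
    qed
    then show "c \<in> {a. trapped F (U a) (V a)}" using c R(1) by (auto simp: trapped_def T_def)
  qed
  ultimately show "\<exists>T. open T \<and> a \<in> T \<and> T \<subseteq> {a. trapped F (U a) (V a)}" by blast
qed

text \<open>For the Lipschitz approximations crossing and trapped initial values form disjoint open sets,
  so a connectedness argument applies; its outcome survives the passage to the limit.\<close>
theorem shooting:
  fixes f F :: "real \<Rightarrow> real"
  assumes n: "2 \<le> n" and F: "\<And>s. (F has_real_derivative f s) (at s)" and F0: "F 0 = 0"
    and uc: "uniformly_continuous_on UNIV f" and M: "\<And>s. \<bar>f s\<bar> \<le> M"
    and A: "\<And>u v. rsol n f u v \<Longrightarrow> u 0 = a \<Longrightarrow> crossing u"
    and B: "\<And>u v. rsol n f u v \<Longrightarrow> u 0 = c \<Longrightarrow> trapped F u v"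
  obtains u v where "rsol n f u v" "\<not> crossing u" "\<not> trapped F u v" "min a c < u 0" "u 0 < max a c"
proof -
  have f: "continuous_on UNIV f" by (rule uniformly_continuous_imp_continuous [OF uc])
  have n1: "1 \<le> n" using n by simp
  obtain \<phi> \<Phi> :: "nat \<Rightarrow> real \<Rightarrow> real" and L :: "nat \<Rightarrow> real"
    where lip: "\<And>k x y. \<bar>\<phi> k x - \<phi> k y\<bar> \<le> L k * \<bar>x - y\<bar>" and \<phi>M: "\<And>k s. \<bar>\<phi> k s\<bar> \<le> M"
    and \<Phi>: "\<And>k s. (\<Phi> k has_real_derivative \<phi> k s) (at s)" "\<And>k. \<Phi> k 0 = 0"
    and unif: "\<And>e. 0 < e \<Longrightarrow> \<forall>\<^sub>F k in sequentially. \<forall>s. \<bar>\<phi> k s - f s\<bar> \<le> e"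
    by (rule lipschitz_approximation [OF F uc M]) blast
  have "\<forall>k. \<exists>U V. \<forall>a. rsol n (\<phi> k) (U a) (V a) \<and> U a 0 = a \<and>
     (\<forall>c. \<forall>r\<ge>0. \<bar>U a r - U c r\<bar> \<le> \<bar>a - c\<bar> * exp (L k * r\<^sup>2) \<and>
        \<bar>V a r - V c r\<bar> \<le> L k * (\<bar>a - c\<bar> * exp (L k * r\<^sup>2)) * r)"
    by (intro allI lipschitz_flow_exists [OF n1 lip \<phi>M])
  then obtain U V where UV: "\<And>k a. rsol n (\<phi> k) (U k a) (V k a)" "\<And>k a. U k a 0 = a"
    "\<And>k a c r. 0 \<le> r \<Longrightarrow> \<bar>U k a r - U k c r\<bar> \<le> \<bar>a - c\<bar> * exp (L k * r\<^sup>2)"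
    "\<And>k a c r. 0 \<le> r \<Longrightarrow> \<bar>V k a r - V k c r\<bar> \<le> L k * (\<bar>a - c\<bar> * exp (L k * r\<^sup>2)) * r"
    by metis
  have L0: "0 \<le> L k" for k using lip [of k 1 0] by simp
  have \<phi>cont: "continuous_on UNIV (\<phi> k)" for k by (rule lipschitz_cont [OF n1 lip \<phi>M])
  have sol: "energy_solution n (\<phi> k) (U k a) (V k a) (\<Phi> k)" for k a
    by unfold_locales (use n UV \<phi>cont \<Phi> in auto)
  have rad: "radial_solution n (\<phi> k) (U k a) (V k a)" for k a
    by unfold_locales (use n UV \<phi>cont in auto)
  have op: "open {a. crossing (U k a)}" "open {a. trapped (\<Phi> k) (U k a) (V k a)}" for k
  proof -
    show "open {a. crossing (U k a)}"
      by (rule open_crossing(2) [where K = "\<lambda>r. exp (L k * r\<^sup>2)", OF UV(3)]) auto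
    show "open {a. trapped (\<Phi> k) (U k a) (V k a)}"
    proof (rule open_trapped [where K = "\<lambda>r. exp (L k * r\<^sup>2)", OF UV(3)])
      show "exp (L k * r\<^sup>2) \<le> exp (L k * s\<^sup>2)" if "0 \<le> r" "r \<le> s" for r s
        using that L0 [of k] by (auto intro!: mult_left_mono power_mono)
      show "isCont (\<lambda>a. V k a r) a" if "0 \<le> r" for a r
      proof (rule open_crossing(1) [where K = "\<lambda>r. L k * exp (L k * r\<^sup>2) * r + 1"])
        show "\<bar>V k a r - V k c r\<bar> \<le> \<bar>a - c\<bar> * (L k * exp (L k * r\<^sup>2) * r + 1)" if "0 \<le> r" for a c r
          using UV(4) [OF that, of k a c] by (simp add: algebra_simps)
        show "0 < L k * exp (L k * r\<^sup>2) * r + 1" if "0 \<le> r" for r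
          using that L0 [of k] by (intro add_nonneg_pos mult_nonneg_nonneg) auto
      qed fact
      show "continuous_on {0..} (U k a)" for a by (rule radial_solution.u_cont [OF rad])
      show "isCont (\<Phi> k) s" for s by (rule DERIV_isCont [OF \<Phi>(1)])
    qed simp_all
  qed
  have disj: "\<not> crossing (U k x)" if "trapped (\<Phi> k) (U k x) (V k x)" for k x
    by (rule energy_solution.trapped_not_crossing [OF sol that \<Phi>(2)])
  \<comment> \<open>Not crossing and not trapped are closed conditions under convergence of
    approximate solutions. Which of several solutions from a height appears in the limit does not
    matter, as \<open>A\<close> and \<open>B\<close> speak of all of them.\<close>
  have limit: "\<exists>W X. rsol n f W X \<and> (\<exists>h. strict_mono h \<and> (\<lambda>k. \<alpha> (h k)) \<longlonglongrightarrow> W 0) \<and>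
      ((\<forall>k. \<not> crossing (U (\<kappa> k) (\<alpha> k))) \<longrightarrow> \<not> crossing W) \<and>
      ((\<forall>k. \<not> trapped (\<Phi> (\<kappa> k)) (U (\<kappa> k) (\<alpha> k)) (V (\<kappa> k) (\<alpha> k))) \<longrightarrow> \<not> trapped F W X)"
    if \<kappa>: "strict_mono \<kappa>" and \<alpha>: "\<And>k. \<bar>\<alpha> k\<bar> \<le> Bd" for \<kappa> :: "nat \<Rightarrow> nat" and \<alpha> :: "nat \<Rightarrow> real" and Bd
  proof -
    define w where "w k = U (\<kappa> k) (\<alpha> k)" for k
    define g where "g k t = \<phi> (\<kappa> k) (w k t)" for k t
    have unif\<kappa>: "\<forall>\<^sub>F k in sequentially. \<forall>s. \<bar>\<phi> (\<kappa> k) s - f s\<bar> \<le> e" if "0 < e" for e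
      by (rule eventually_subseq [OF \<kappa> unif [OF that]])
    have V_eq: "V (\<kappa> k) (\<alpha> k) r = - rmean n (g k) r" if "0 \<le> r" for k r
      using radial_solution.v_eq [OF rad that] by (simp add: g_def [abs_def] w_def)
    obtain h W where hW: "strict_mono h" "rsol n f W (\<lambda>r. - rmean n (\<lambda>t. f (W t)) r)"
      and wW: "\<And>r. 0 \<le> r \<Longrightarrow> (\<lambda>k. w (h k) r) \<longlonglongrightarrow> W r"
      and mW: "\<And>r. 0 \<le> r \<Longrightarrow> (\<lambda>k. rmean n (g (h k)) r) \<longlonglongrightarrow> rmean n (\<lambda>t. f (W t)) r"
      and pW: "\<And>R. (\<And>r. r \<in> {0..R} \<Longrightarrow> 0 < W r) \<Longrightarrow> \<forall>\<^sub>F k in sequentially. \<forall>r\<in>{0..R}. 0 < w (h k) r"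
    proof (rule radial_compactness [OF n1 f, where w = w and g = g and d = \<alpha> and M = M and B = Bd])
      show "continuous_on {0..} (g k)" for k
        using radial_solution.fu_cont [OF rad] by (simp add: g_def [abs_def] w_def)
      show "\<bar>g k r\<bar> \<le> M" for k r by (simp add: g_def \<phi>M)
      show "w k r = \<alpha> k - integral {0..r} (rmean n (g k))" if "0 \<le> r" for k r
        using radial_solution.u_eq [OF rad that, of "\<kappa> k" "\<alpha> k"] UV(2) by (simp add: g_def [abs_def] w_def)
      show "(\<lambda>k. g k r - f (w k r)) \<longlonglongrightarrow> 0" for r
      proof (rule tendstoI)
        fix e :: real assume "0 < e"
        then have "\<forall>\<^sub>F k in sequentially. \<forall>s. \<bar>\<phi> (\<kappa> k) s - f s\<bar> \<le> e / 2" by (intro unif\<kappa>) simp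
        then show "\<forall>\<^sub>F k in sequentially. dist (g k r - f (w k r)) 0 < e"
        proof eventually_elim
          case (elim k)
          have "\<bar>g k r - f (w k r)\<bar> \<le> e / 2" unfolding g_def using elim by blast
          then show ?case using \<open>0 < e\<close> by (simp add: dist_real_def)
        qed
      qed
    qed (rule \<alpha>, blast)
    define X where "X r = - rmean n (\<lambda>t. f (W t)) r" for r
    have \<alpha>W: "(\<lambda>k. \<alpha> (h k)) \<longlonglongrightarrow> W 0" using wW [of 0] UV(2) by (simp add: w_def)
    have ncW: "\<not> crossing W" if nc: "\<forall>k. \<not> crossing (U (\<kappa> k) (\<alpha> k))"
    proof -
      have "0 \<le> W R" if R: "0 \<le> R" for R
      proof (rule tendsto_lowerbound [OF wW [OF R]])
        show "\<forall>\<^sub>F k in sequentially. 0 \<le> w (h k) R"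
          using nc R by (intro always_eventually) (auto simp: w_def crossing_def not_less)
      qed simp
      then show ?thesis by (auto simp: crossing_def not_less)
    qed
    have ntW: "\<not> trapped F W X" if nt: "\<forall>k. \<not> trapped (\<Phi> (\<kappa> k)) (U (\<kappa> k) (\<alpha> k)) (V (\<kappa> k) (\<alpha> k))"
    proof
      assume "trapped F W X"
      then obtain R where R: "0 \<le> R" "\<And>r. r \<in> {0..R} \<Longrightarrow> 0 < W r" "(X R)\<^sup>2 / 2 + F (W R) < 0"
        unfolding trapped_def by blast
      \<comment> \<open>Both primitives vanish at 0, so uniform closeness of the functions passes to
        the primitives on bounded sets.\<close>
      have \<Phi>_close: "\<bar>\<Phi> j x - F x\<bar> \<le> e * \<bar>x\<bar>" if "\<forall>s. \<bar>\<phi> j s - f s\<bar> \<le> e" for j x e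
      proof (cases "x = 0")
        case False
        have der: "((\<lambda>x. \<Phi> j x - F x) has_real_derivative \<phi> j s - f s) (at s)" for s
          by (intro DERIV_diff \<Phi> F)
        have mv: "\<exists>z. (\<Phi> j y - F y) - (\<Phi> j x - F x) = (y - x) * (\<phi> j z - f z)" if xy: "x < y" for x y
        proof -
          obtain z where "(\<Phi> j y - F y) - (\<Phi> j x - F x) = (y - x) * (\<phi> j z - f z)"
            by (rule real_mvt [OF xy, where f = "\<lambda>x. \<Phi> j x - F x"])
               (auto intro!: der continuous_at_imp_continuous_on DERIV_isCont [OF der])
          then show ?thesis by blast
        qed
        have "\<exists>z. \<Phi> j x - F x = x * (\<phi> j z - f z)"
        proof (cases "0 < x")
          case True
          then show ?thesis using mv [of 0 x] F0 \<Phi>(2) by simp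
        next
          case neg: False
          obtain z where "(\<Phi> j 0 - F 0) - (\<Phi> j x - F x) = (0 - x) * (\<phi> j z - f z)"
            using mv [of x 0] neg False by auto
          then have "\<Phi> j x - F x = x * (\<phi> j z - f z)" using F0 \<Phi>(2) [of j] by simp
          then show ?thesis by blast
        qed
        then obtain z where "\<Phi> j x - F x = x * (\<phi> j z - f z)" by blast
        then have "\<bar>\<Phi> j x - F x\<bar> = \<bar>x\<bar> * \<bar>\<phi> j z - f z\<bar>" by (simp add: abs_mult)
        also have "\<dots> \<le> \<bar>x\<bar> * e" using that by (intro mult_left_mono) auto
        finally show ?thesis by (simp add: mult.commute)
      qed (use F0 \<Phi> in simp)
      have wR: "(\<lambda>k. w (h k) R) \<longlonglongrightarrow> W R" by (rule wW [OF R(1)])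
      have "(\<lambda>k. \<Phi> (\<kappa> (h k)) (w (h k) R) - F (w (h k) R)) \<longlonglongrightarrow> 0"
      proof (rule tendstoI)
        fix e :: real assume e: "0 < e"
        define B where "B = \<bar>W R\<bar> + 1"
        have B: "0 < B" by (simp add: B_def)
        have "\<forall>\<^sub>F k in sequentially. \<forall>s. \<bar>\<phi> (\<kappa> (h k)) s - f s\<bar> \<le> e / (2 * B)"
          by (rule eventually_subseq [OF hW(1) unif\<kappa>]) (use e B in simp)
        moreover have "\<forall>\<^sub>F k in sequentially. \<bar>w (h k) R\<bar> < B"
          by (rule order_tendstoD(2) [OF tendsto_rabs [OF wR]]) (simp add: B_def)
        ultimately show "\<forall>\<^sub>F k in sequentially. dist (\<Phi> (\<kappa> (h k)) (w (h k) R) - F (w (h k) R)) 0 < e"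
        proof eventually_elim
          case (elim k)
          have "\<bar>\<Phi> (\<kappa> (h k)) (w (h k) R) - F (w (h k) R)\<bar> \<le> e / (2 * B) * \<bar>w (h k) R\<bar>"
            by (rule \<Phi>_close [OF elim(1)])
          also have "\<dots> \<le> e / (2 * B) * B" using elim(2) e B by (intro mult_left_mono) auto
          also have "\<dots> < e" using e B by simp
          finally show ?case by (simp add: dist_real_def)
        qed
      qed
      moreover have "(\<lambda>k. F (w (h k) R)) \<longlonglongrightarrow> F (W R)"
        by (rule isCont_tendsto_compose [OF DERIV_isCont [OF F] wR])
      ultimately have "(\<lambda>k. (\<Phi> (\<kappa> (h k)) (w (h k) R) - F (w (h k) R)) + F (w (h k) R)) \<longlonglongrightarrow> 0 + F (W R)"
        by (rule tendsto_add)
      then have FW: "(\<lambda>k. \<Phi> (\<kappa> (h k)) (w (h k) R)) \<longlonglongrightarrow> F (W R)" by simp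
      have VX: "(\<lambda>k. V (\<kappa> (h k)) (\<alpha> (h k)) R) \<longlonglongrightarrow> X R"
        unfolding V_eq [OF R(1)] X_def by (intro tendsto_minus mW R(1))
      have "(\<lambda>k. (V (\<kappa> (h k)) (\<alpha> (h k)) R)\<^sup>2 / 2 + \<Phi> (\<kappa> (h k)) (w (h k) R)) \<longlonglongrightarrow> (X R)\<^sup>2 / 2 + F (W R)"
        by (intro tendsto_intros VX FW) simp
      then have "\<forall>\<^sub>F k in sequentially. (V (\<kappa> (h k)) (\<alpha> (h k)) R)\<^sup>2 / 2 + \<Phi> (\<kappa> (h k)) (w (h k) R) < 0"
        by (rule order_tendstoD(2)) (rule R(3))
      with pW [OF R(2)] have "\<forall>\<^sub>F k in sequentially. (\<forall>r\<in>{0..R}. 0 < w (h k) r) \<and>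
          (V (\<kappa> (h k)) (\<alpha> (h k)) R)\<^sup>2 / 2 + \<Phi> (\<kappa> (h k)) (w (h k) R) < 0"
        by (rule eventually_conj)
      then obtain k where "\<forall>r\<in>{0..R}. 0 < w (h k) r"
          "(V (\<kappa> (h k)) (\<alpha> (h k)) R)\<^sup>2 / 2 + \<Phi> (\<kappa> (h k)) (w (h k) R) < 0"
        using eventually_happens' [OF sequentially_bot] by blast
      then have "trapped (\<Phi> (\<kappa> (h k))) (U (\<kappa> (h k)) (\<alpha> (h k))) (V (\<kappa> (h k)) (\<alpha> (h k)))"
        unfolding trapped_def w_def using R(1) by blast
      with nt show False by blast
    qed
    have "rsol n f W X" using hW(2) by (simp add: X_def [abs_def])
    then show ?thesis
      by (rule_tac exI [of _ W], rule_tac exI [of _ X], intro conjI exI [of _ h] impI hW(1) \<alpha>W ncW ntW)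
  qed
  \<comment> \<open>Otherwise infinitely many approximations fail to cross, and their limit is a
    solution from \<open>a\<close> that does not cross.\<close>
  have evA: "\<forall>\<^sub>F k in sequentially. crossing (U k a)"
  proof (rule ccontr)
    assume "\<not> ?thesis"
    then obtain \<kappa> :: "nat \<Rightarrow> nat" where \<kappa>: "strict_mono \<kappa>" "\<And>k. \<not> crossing (U (\<kappa> k) a)"
      by (rule not_eventually_subseq) blast
    obtain W X where W: "rsol n f W X" "(\<lambda>k. a) \<longlonglongrightarrow> W 0" "\<not> crossing W"
      using limit [OF \<kappa>(1), of "\<lambda>_. a" "\<bar>a\<bar>"] \<kappa>(2) by auto
    then have "W 0 = a" by (simp add: LIMSEQ_const_iff)
    with A W show False by blast
  qed
  have evB: "\<forall>\<^sub>F k in sequentially. trapped (\<Phi> k) (U k c) (V k c)"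
  proof (rule ccontr)
    assume "\<not> ?thesis"
    then obtain \<kappa> :: "nat \<Rightarrow> nat" where \<kappa>: "strict_mono \<kappa>" "\<And>k. \<not> trapped (\<Phi> (\<kappa> k)) (U (\<kappa> k) c) (V (\<kappa> k) c)"
      by (rule not_eventually_subseq) blast
    obtain W X where W: "rsol n f W X" "(\<lambda>k. c) \<longlonglongrightarrow> W 0" "\<not> trapped F W X"
      using limit [OF \<kappa>(1), of "\<lambda>_. c" "\<bar>c\<bar>"] \<kappa>(2) by auto
    then have "W 0 = c" by (simp add: LIMSEQ_const_iff)
    with B W show False by blast
  qed
  define I where "I = {min a c..max a c}"
  have mid: "\<exists>x\<in>I. \<not> crossing (U k x) \<and> \<not> trapped (\<Phi> k) (U k x) (V k x)"
    if "crossing (U k a)" "trapped (\<Phi> k) (U k c) (V k c)" for k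
  proof (rule ccontr)
    assume "\<not> ?thesis"
    then have "I \<subseteq> {a. crossing (U k a)} \<union> {a. trapped (\<Phi> k) (U k a) (V k a)}" by blast
    moreover have "{a. crossing (U k a)} \<inter> {a. trapped (\<Phi> k) (U k a) (V k a)} \<inter> I = {}"
      using disj by blast
    moreover have "connected I" by (simp add: I_def)
    ultimately have "{a. crossing (U k a)} \<inter> I = {} \<or> {a. trapped (\<Phi> k) (U k a) (V k a)} \<inter> I = {}"
      using connectedD op by metis
    moreover have "a \<in> I" "c \<in> I" by (auto simp: I_def)
    ultimately show False using that by blast
  qed
  obtain K where K: "\<And>k. K \<le> k \<Longrightarrow> crossing (U k a) \<and> trapped (\<Phi> k) (U k c) (V k c)"
    using eventually_conj [OF evA evB] unfolding eventually_sequentially by blast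
  have "\<exists>x\<in>I. \<not> crossing (U (k + K) x) \<and> \<not> trapped (\<Phi> (k + K)) (U (k + K) x) (V (k + K) x)" for k
    using mid K [of "k + K"] by simp
  then obtain \<alpha> where \<alpha>: "\<And>k. \<alpha> k \<in> I" "\<And>k. \<not> crossing (U (k + K) (\<alpha> k))"
    "\<And>k. \<not> trapped (\<Phi> (k + K)) (U (k + K) (\<alpha> k)) (V (k + K) (\<alpha> k))" by metis
  have "strict_mono (\<lambda>k. k + K)" by (simp add: strict_mono_def)
  moreover have "\<bar>\<alpha> k\<bar> \<le> \<bar>a\<bar> + \<bar>c\<bar>" for k
    using \<alpha>(1) [of k] unfolding I_def by (auto simp: min_def max_def split: if_splits)
  ultimately obtain W X h where W: "rsol n f W X" "(\<lambda>k. \<alpha> (h k)) \<longlonglongrightarrow> W 0" "\<not> crossing W" "\<not> trapped F W X"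
    using limit [of "\<lambda>k. k + K" \<alpha> "\<bar>a\<bar> + \<bar>c\<bar>"] \<alpha>(2,3) by blast
  have "closed I" by (simp add: I_def)
  then have "W 0 \<in> I"
    by (rule Lim_in_closed_set [OF _ _ sequentially_bot W(2)]) (use \<alpha> in auto)
  \<comment> \<open>The limiting height might be an endpoint of \<open>I\<close>; the type
    prescribed there excludes it.\<close>
  moreover have "W 0 \<noteq> a" "W 0 \<noteq> c" using A B W by blast+
  ultimately show ?thesis
    by (intro that [OF W(1,3,4)]) (auto simp: I_def min_def max_def split: if_splits)
qed

section \<open>Large amplitudes\<close>

context well_solution
begin

text \<open>An untrapped solution that has come down to a level \<open>a > \<beta>\<close> stays below it: it decreases until its
  first zero, and afterwards it either stays negative or has nonpositive energy.\<close>
lemma stays_below: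
  assumes nt: "\<not> trapped F u v" and a: "\<beta> < a" and r1: "0 \<le> r1" "u r1 = a" and t: "r1 \<le> t"
  shows "u t \<le> a"
proof (rule ccontr)
  assume ut: "\<not> u t \<le> a"
  have rt: "r1 < t" using ut r1 t by (cases "r1 = t") auto
  show False
  proof (cases "\<forall>x\<in>{0..t}. 0 < u x")
    case True
    obtain z where z: "r1 < z" "z < t" "u t - u r1 = (t - r1) * v z"
      by (rule real_mvt [OF rt, of u v])
         (use r1 in \<open>auto intro: u_deriv continuous_on_subset [OF u_cont]\<close>)
    have "v z < 0"
    proof (rule v_neg)
      show "0 < z" using z r1 by simp
      show pos: "0 < u r" if "r \<in> {0..z}" for r using True that z by simp
      show "0 \<le> E r" if "r \<in> {0..z}" for r
        by (rule not_trappedD [OF nt]) (use that pos in auto)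
    qed
    then have "(t - r1) * v z < 0" using rt by (simp add: mult_less_0_iff)
    then show False using z ut r1 by simp
  next
    case False
    then obtain x where x: "0 \<le> x" "x \<le> t" "u x \<le> 0" by (auto simp: not_less)
    have "0 < u 0"
    proof (rule ccontr)
      assume "\<not> 0 < u 0"
      then have "E 0 \<le> 0" by (simp add: E0 F_nonpos0)
      then have "E t \<le> 0" using E_antimono [of 0 t] x by simp
      then show False using F_le_E [of t] F_pos [of "u t"] ut a by simp
    qed
    moreover have "continuous_on {0..x} (\<lambda>r. - u r)"
      by (intro continuous_intros continuous_on_subset [OF u_cont]) auto
    ultimately obtain R where R: "0 < R" "R \<le> x" "- u R = 0" "\<And>y. 0 \<le> y \<Longrightarrow> y < R \<Longrightarrow> - u y < 0"
      using first_zero [of 0 x "\<lambda>r. - u r"] x by auto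
    have Rt: "R < t" using R x ut a b_pos b_less by (cases "R = t") auto
    \<comment> \<open>A zero with zero slope has zero energy, which rules out levels above
      \<open>\<beta>\<close> afterwards.\<close>
    have vR: "v R \<noteq> 0"
    proof
      assume "v R = 0"
      then have "E R = 0" using R(3) by (simp add: E_def F_nonpos0)
      then have "E t \<le> 0" using E_antimono [of R t] R(1) Rt by simp
      then show False using F_le_E [of t] F_pos [of "u t"] ut a by simp
    qed
    have "v R < 0"
    proof (rule ccontr)
      assume "\<not> v R < 0"
      then have "0 < v R" using vR by simp
      then obtain d where d: "0 < d" "\<And>h. 0 < h \<Longrightarrow> h < d \<Longrightarrow> u (R - h) < u R"
        using DERIV_pos_inc_left [OF u_deriv [OF R(1)]] by blast
      define h where "h = min d R / 2"
      have h: "0 < h" "h < d" "h < R" using d(1) R(1) by (auto simp: h_def)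
      have "u (R - h) < 0" using d(2) [OF h(1,2)] R(3) by simp
      moreover have "- u (R - h) < 0" by (rule R(4)) (use h in auto)
      ultimately show False by simp
    qed
    then obtain d where d: "0 < d" "\<And>h. 0 < h \<Longrightarrow> h < d \<Longrightarrow> u (R + h) < u R"
      using DERIV_neg_dec_right [OF u_deriv [OF R(1)]] by blast
    define s where "s = R + min d (t - R) / 2"
    have s: "R < s" "s < R + d" "s < t" using d(1) Rt by (auto simp: s_def min_def field_simps)
    have neg: "u y < 0" if "R < y" "y \<le> s" for y
      using d(2) [of "y - R"] that s R(3) by simp
    have "continuous_on {s..t} u" by (rule continuous_on_subset [OF u_cont]) (use s R in auto)
    then obtain c where c: "s < c" "c \<le> t" "u c = 0" "\<And>y. s \<le> y \<Longrightarrow> y < c \<Longrightarrow> u y < 0"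
      by (rule first_zero) (use neg s ut a b_pos b_less in auto)
    have negc: "u y \<le> 0" if "R \<le> y" "y \<le> c" for y
      using neg [of y] c(3) c(4) [of y] R(3) that by (cases "y = R"; cases "y = c"; cases "y \<le> s"; force)
    have Rc: "R < c" using s c by simp
    \<comment> \<open>Where \<open>u \<le> 0\<close> there is no source, so the flux keeps its
      nonzero value; but between the zeros \<open>R\<close> and \<open>c\<close> the slope has to
      vanish somewhere.\<close>
    have rint_const: "rint n (\<lambda>t. f (u t)) y = rint n (\<lambda>t. f (u t)) R" if y: "R < y" "y \<le> c" for y
    proof -
      obtain z where "R < z" "z < y"
        "rint n (\<lambda>t. f (u t)) y - rint n (\<lambda>t. f (u t)) R = (y - R) * (z ^ n * f (u z))"
      proof (rule real_mvt [OF y(1)])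
        show der: "(rint n (\<lambda>t. f (u t)) has_real_derivative x ^ n * f (u x)) (at x)" if "R < x" "x < y" for x
          by (rule rint_has_derivative [OF fu_cont]) (use that R in simp)
        have "(rint n (\<lambda>t. f (u t)) has_real_derivative x ^ n * f (u x)) (at x)" if "R \<le> x" for x
          by (rule rint_has_derivative [OF fu_cont]) (use that R in simp)
        then show "continuous_on {R..y} (rint n (\<lambda>t. f (u t)))"
          by (intro continuous_at_imp_continuous_on ballI DERIV_isCont) auto
      qed
      moreover have "f (u z) = 0" by (rule f_nonpos0) (use negc [of z] calculation y in simp)
      ultimately show ?thesis by simp
    qed
    obtain z where z: "R < z" "z < c" "u c - u R = (c - R) * v z"
      by (rule real_mvt [OF Rc, of u v])
         (use R in \<open>auto intro: u_deriv continuous_on_subset [OF u_cont]\<close>)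
    have "0 < rint n (\<lambda>t. f (u t)) R"
      using \<open>v R < 0\<close> v_eq [of R] R(1) by (simp add: rmean_def zero_less_divide_iff)
    then have "v z < 0"
      using v_eq [of z] rint_const [of z] z R(1) by (simp add: rmean_def)
    moreover have "v z = 0" using z(3) c(3) R(3) Rc by simp
    ultimately show False by simp
  qed
qed

text \<open>A positive witness is wanted because the convergence used for fast descents holds only
  away from the origin.\<close>

lemma trapped_pos_radius:
  assumes "trapped F u v"
  obtains R where "0 < R" "\<And>r. r \<in> {0..R} \<Longrightarrow> 0 < u r" "E R < 0"
proof -
  obtain R where R: "0 \<le> R" "\<And>r. r \<in> {0..R} \<Longrightarrow> 0 < u r" "E R < 0"
    using assms unfolding trapped_def E_def by blast
  have "(u \<longlongrightarrow> u R) (at R within {0..})" using u_cont R(1) by (simp add: continuous_on_def)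
  then have "(u \<longlongrightarrow> u R) (at_right R)"
    by (rule tendsto_within_subset) (use R(1) in auto)
  then have "\<forall>\<^sub>F y in at_right R. 0 < u y"
    by (rule order_tendstoD(1)) (use R in simp)
  then obtain b where b: "R < b" "\<And>y. R < y \<Longrightarrow> y < b \<Longrightarrow> 0 < u y"
    unfolding eventually_at_right_field by blast
  show ?thesis
  proof (rule that [of "(R + b) / 2"])
    show "0 < (R + b) / 2" using b R by simp
    show "0 < u r" if "r \<in> {0..(R + b) / 2}" for r
    proof (cases "r \<le> R")
      case False
      then show ?thesis using that b(1) by (intro b(2)) (auto simp: field_simps)
    qed (use R that in simp)
    show "E ((R + b) / 2) < 0" using E_antimono [of R "(R + b) / 2"] R b by simp
  qed
qed

end

text \<open>The amplitude \<open>A\<close> is large between the levels \<open>a1\<close> and \<open>c\<close>. The solution then reaches the level \<open>a1\<close>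
  at a radius \<open>r1\<close> of order \<open>1 / A\<close>, and \<open>u + r u' / (real n - 1)\<close>, whose derivative is \<open>- r g(u) / (real n - 1)\<close>,
  gives the height from which the solution seems to start when seen from radii of order one.\<close>
locale fast_descent =
  g: well_solution g G b \<beta> n u v + well f F b \<beta>
  for f F g G b \<beta> n u v +
  fixes A m M a1 a2 c :: real
  assumes agree: "s \<le> a1 \<Longrightarrow> g s = f s" "s \<le> a1 \<Longrightarrow> G s = F s"
    and low: "a2 \<le> s \<Longrightarrow> s \<le> c \<Longrightarrow> A\<^sup>2 * m \<le> g s" and low': "a1 \<le> s \<Longrightarrow> s \<le> c \<Longrightarrow> f a1 \<le> g s"
    and up: "a1 \<le> s \<Longrightarrow> s \<le> c \<Longrightarrow> g s \<le> A\<^sup>2 * M"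
    and A: "1 \<le> A" and mM: "0 < m" "m \<le> M" and a: "\<beta> < a1" "a1 < a2" "a2 < c"
    and u0: "u 0 = c"
    and ramp: "a2 - a1 \<le> 2 * (m / M) * (c - a2) / 2 ^ n"
begin

section \<open>Radii and heights of a fast descent\<close>

lemma g_nonneg: "a1 \<le> s \<Longrightarrow> s \<le> c \<Longrightarrow> 0 \<le> g s"
  using low' [of s] f_pos [of a1] a b_less by simp

lemma u_le_c: "0 \<le> r \<Longrightarrow> u r \<le> c"
  using g.u_le [of r] u0 a b_less by simp

definition r0 where "r0 = (SOME r. 0 \<le> r \<and> u r = a2 \<and> (\<forall>t. 0 \<le> t \<longrightarrow> t < r \<longrightarrow> a2 < u t))"
definition r1 where "r1 = (SOME r. 0 \<le> r \<and> u r = a1 \<and> (\<forall>t. 0 \<le> t \<longrightarrow> t < r \<longrightarrow> a1 < u t))"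

lemma r0: "0 < r0" "u r0 = a2" "0 \<le> t \<Longrightarrow> t < r0 \<Longrightarrow> a2 < u t"
proof -
  have "\<exists>r. 0 \<le> r \<and> u r = a2 \<and> (\<forall>t. 0 \<le> t \<longrightarrow> t < r \<longrightarrow> a2 < u t)"
    by (rule g.level_reached [of a2]) (use a b_less u0 in auto)
  then have *: "0 \<le> r0 \<and> u r0 = a2 \<and> (\<forall>t. 0 \<le> t \<longrightarrow> t < r0 \<longrightarrow> a2 < u t)"
    unfolding r0_def by (rule someI_ex)
  then show "u r0 = a2" "0 \<le> t \<Longrightarrow> t < r0 \<Longrightarrow> a2 < u t" by auto
  show "0 < r0" using * u0 a by (cases "r0 = 0") auto
qed

lemma r1: "0 < r1" "u r1 = a1" "0 \<le> t \<Longrightarrow> t < r1 \<Longrightarrow> a1 < u t"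
proof -
  have "\<exists>r. 0 \<le> r \<and> u r = a1 \<and> (\<forall>t. 0 \<le> t \<longrightarrow> t < r \<longrightarrow> a1 < u t)"
    by (rule g.level_reached [of a1]) (use a b_less u0 in auto)
  then have *: "0 \<le> r1 \<and> u r1 = a1 \<and> (\<forall>t. 0 \<le> t \<longrightarrow> t < r1 \<longrightarrow> a1 < u t)"
    unfolding r1_def by (rule someI_ex)
  then show "u r1 = a1" "0 \<le> t \<Longrightarrow> t < r1 \<Longrightarrow> a1 < u t" by auto
  show "0 < r1" using * u0 a by (cases "r1 = 0") auto
qed

lemma r0_r1: "r0 < r1"
proof (rule ccontr)
  assume "\<not> r0 < r1"
  then have "a2 \<le> u r1" using r0(2) r0(3) [of r1] r1(1) by (cases "r1 = r0") auto
  then show False using r1 a by simp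
qed

lemma u_ge: "0 \<le> t \<Longrightarrow> t \<le> r1 \<Longrightarrow> a1 \<le> u t" "0 \<le> t \<Longrightarrow> t \<le> r0 \<Longrightarrow> a2 \<le> u t"
proof -
  show "0 \<le> t \<Longrightarrow> t \<le> r1 \<Longrightarrow> a1 \<le> u t" using r1(2) r1(3) [of t] by (cases "t = r1") auto
  show "0 \<le> t \<Longrightarrow> t \<le> r0 \<Longrightarrow> a2 \<le> u t" using r0(2) r0(3) [of t] by (cases "t = r0") auto
qed

lemma gu_bounds:
  "0 \<le> t \<Longrightarrow> t \<le> r1 \<Longrightarrow> 0 \<le> g (u t)" "0 \<le> t \<Longrightarrow> t \<le> r1 \<Longrightarrow> g (u t) \<le> A\<^sup>2 * M"
  "0 \<le> t \<Longrightarrow> t \<le> r0 \<Longrightarrow> A\<^sup>2 * m \<le> g (u t)"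
  using u_ge u_le_c by (auto intro: g_nonneg up low)

text \<open>Comparison of \<open>u\<close> with the parabolas
  \<open>c - A^2 m r^2 / (2 (n + 1))\<close> and \<open>c - A^2 M r^2 / (2 (n + 1))\<close>; so
  \<open>A r0\<close> is bounded above and below independently of \<open>A\<close>.\<close>

lemma r0_bounds:
  "A\<^sup>2 * m * r0\<^sup>2 \<le> 2 * (real n + 1) * (c - a2)" "2 * (real n + 1) * (c - a2) \<le> A\<^sup>2 * M * r0\<^sup>2"
proof -
  have r00: "0 \<le> r0" using r0 by simp
  define K where "K = real n + 1"
  have K: "0 < K" by (simp add: K_def)
  have der: "((\<lambda>x. u x + B * x\<^sup>2 / (2 * K)) has_real_derivative v x + B * x / K) (at x)" if "0 < x" for B x
    using K by (auto intro!: derivative_eq_intros g.u_deriv that)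
  have cont: "continuous_on {0..r0} (\<lambda>x. u x + B * x\<^sup>2 / (2 * K))" for B
    using K by (intro continuous_intros continuous_on_subset [OF g.u_cont]) auto
  have v: "A\<^sup>2 * m * x / K \<le> - v x" "- v x \<le> A\<^sup>2 * M * x / K" if x: "0 < x" "x < r0" for x
  proof -
    have "A\<^sup>2 * m * x / Suc n \<le> rmean n (\<lambda>t. g (u t)) x"
      by (rule rmean_bounds(2) [OF g.fu_cont]) (use x gu_bounds(3) in auto)
    moreover have "rmean n (\<lambda>t. g (u t)) x \<le> A\<^sup>2 * M * x / Suc n"
      by (rule rmean_bounds(1) [OF g.fu_cont]) (use x r0_r1 gu_bounds(2) in auto)
    ultimately show "A\<^sup>2 * m * x / K \<le> - v x" "- v x \<le> A\<^sup>2 * M * x / K"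
      using g.v_eq [of x] x by (simp_all add: K_def add.commute)
  qed
  have "u r0 + (A\<^sup>2 * m) * r0\<^sup>2 / (2 * K) \<le> u 0 + (A\<^sup>2 * m) * 0\<^sup>2 / (2 * K)"
  proof (rule DERIV_nonpos_imp_decreasing_open [OF r00 _ cont])
    fix x assume x: "0 < x" "x < r0"
    show "\<exists>y. ((\<lambda>x. u x + A\<^sup>2 * m * x\<^sup>2 / (2 * K)) has_real_derivative y) (at x) \<and> y \<le> 0"
      using der [OF x(1), of "A\<^sup>2 * m"] v(1) [OF x] by (intro exI conjI) auto
  qed
  then show "A\<^sup>2 * m * r0\<^sup>2 \<le> 2 * (real n + 1) * (c - a2)"
    using K u0 r0(2) by (simp add: field_simps K_def)
  have "u 0 + (A\<^sup>2 * M) * 0\<^sup>2 / (2 * K) \<le> u r0 + (A\<^sup>2 * M) * r0\<^sup>2 / (2 * K)"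
  proof (rule DERIV_nonneg_imp_increasing_open [OF r00 _ cont])
    fix x assume x: "0 < x" "x < r0"
    show "\<exists>y. ((\<lambda>x. u x + A\<^sup>2 * M * x\<^sup>2 / (2 * K)) has_real_derivative y) (at x) \<and> 0 \<le> y"
      using der [OF x(1), of "A\<^sup>2 * M"] v(2) [OF x] by (intro exI conjI) auto
  qed
  then show "2 * (real n + 1) * (c - a2) \<le> A\<^sup>2 * M * r0\<^sup>2"
    using K u0 r0(2) by (simp add: field_simps K_def)
qed

lemma rint_mono_r:
  assumes "0 < x" "x \<le> y" "y \<le> r1"
  shows "rint n (\<lambda>t. g (u t)) x \<le> rint n (\<lambda>t. g (u t)) y"
proof (rule DERIV_nonneg_imp_nondecreasing [OF assms(2)])
  fix t assume t: "x \<le> t" "t \<le> y"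
  have "(rint n (\<lambda>t. g (u t)) has_real_derivative t ^ n * g (u t)) (at t)"
    by (rule rint_has_derivative [OF g.fu_cont]) (use t assms in simp)
  moreover have "0 \<le> t ^ n * g (u t)" using gu_bounds(1) t assms by simp
  ultimately show "\<exists>d. (rint n (\<lambda>t. g (u t)) has_real_derivative d) (at t) \<and> 0 \<le> d" by blast
qed

text \<open>The flux collected up to \<open>r0\<close> does not decrease while
  \<open>u \<ge> a1\<close>. Over \<open>[r0, 2 r0]\<close> it forces a drop of at least
  \<open>2 (m / M) (c - a2) / 2^n\<close>, and by \<open>ramp\<close> this suffices to come from
  \<open>a2\<close> to \<open>a1\<close>.\<close>

lemma r1_le: "r1 \<le> 2 * r0"
proof (rule ccontr)
  assume "\<not> r1 \<le> 2 * r0"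
  then have lt: "2 * r0 < r1" by simp
  have r00: "0 < r0" "r0 < 2 * r0" using r0 by auto
  define Q where "Q = rint n (\<lambda>t. g (u t)) r0"
  obtain z where z: "r0 < z" "z < 2 * r0" "u (2 * r0) - u r0 = (2 * r0 - r0) * v z"
    by (rule real_mvt [OF r00(2), of u v])
       (use r00 in \<open>auto intro: g.u_deriv continuous_on_subset [OF g.u_cont]\<close>)
  have Q: "A\<^sup>2 * m * r0 ^ Suc n / Suc n \<le> Q"
    unfolding Q_def by (rule rint_bounds(2) [OF g.fu_cont]) (use r00 gu_bounds(3) in auto)
  have Q0: "0 \<le> Q" using order_trans [OF _ Q] r00 mM by simp
  have "Q / (2 * r0) ^ n \<le> Q / z ^ n"
    using z r00 Q0 by (intro divide_left_mono power_mono mult_pos_pos) auto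
  also have "\<dots> \<le> rint n (\<lambda>t. g (u t)) z / z ^ n"
    unfolding Q_def using z r00 lt by (intro divide_right_mono rint_mono_r) auto
  also have "\<dots> = - v z" using g.v_eq [of z] z r00 by (simp add: rmean_def)
  finally have vz: "Q / (2 * r0) ^ n \<le> - v z" .
  define K where "K = real n + 1"
  have K: "0 < K" "K = real (Suc n)" by (simp_all add: K_def)
  have "2 * (m / M) * (c - a2) / 2 ^ n = (2 * K * (c - a2)) * (m / M) / (K * 2 ^ n)"
    using K(1) by simp
  also have "\<dots> \<le> (A\<^sup>2 * M * r0\<^sup>2) * (m / M) / (K * 2 ^ n)"
    using r0_bounds(2) mM K(1) by (intro divide_right_mono mult_right_mono) (auto simp: K_def)
  also have "\<dots> = r0 * ((A\<^sup>2 * m * r0 ^ Suc n / K) / (2 * r0) ^ n)"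
    using mM r00 K(1) by (simp add: field_simps power2_eq_square)
  also have "\<dots> = r0 * ((A\<^sup>2 * m * r0 ^ Suc n / Suc n) / (2 * r0) ^ n)" by (simp only: K(2))
  also have "\<dots> \<le> r0 * (Q / (2 * r0) ^ n)"
    using Q r00 by (intro mult_left_mono divide_right_mono) auto
  also have "\<dots> \<le> r0 * (- v z)" using vz r00 by (intro mult_left_mono) auto
  also have "\<dots> = a2 - u (2 * r0)" using z(3) r0(2) by simp
  also have "\<dots> < a2 - a1" using r1(3) [of "2 * r0"] lt r00 by simp
  finally show False using ramp by simp
qed

lemma r1_sq: "A\<^sup>2 * r1\<^sup>2 \<le> 8 * (real n + 1) * (c - a2) / m"
proof -
  have "A\<^sup>2 * m * r1\<^sup>2 \<le> A\<^sup>2 * m * (2 * r0)\<^sup>2"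
    using r1_le r1 mM by (intro mult_left_mono power_mono) auto
  also have "\<dots> \<le> 4 * (2 * (real n + 1) * (c - a2))" using r0_bounds(1) by simp
  finally show ?thesis using mM by (simp add: field_simps)
qed

text \<open>The limit at infinity of the function \<open>const + q / r^(n-1)\<close> that agrees
  with \<open>u\<close> to first order at \<open>r1\<close>, that is, of the continuation without
  source.\<close>

definition apparent :: real where "apparent = a1 + r1 * v r1 / (real n - 1)"

text \<open>The upper bound uses \<open>g \<ge> A^2 m\<close> up to \<open>r0\<close>, the lower one
  \<open>g \<le> A^2 M\<close> up to \<open>r1\<close>. The amplitude cancels because
  \<open>r0\<close> and \<open>r1\<close> are of order \<open>1 / A\<close>.\<close>

lemma apparent_bounds:
  "apparent \<le> c - (real n + 1) / (real n - 1) * (m / M) * (c - a2)"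
  "c - 4 * (M / m) * ((real n + 1) / (real n - 1)) * (c - a2) \<le> apparent"
proof -
  define k where "k = real n - 1"
  have k: "0 < k" using g.n by (simp add: k_def)
  have kn: "real n = k + 1" by (simp add: k_def)
  define Y where "Y x = u x + x * v x / k" for x
  have der: "((\<lambda>x. Y x + B * x\<^sup>2 / (2 * k)) has_real_derivative x * (B - g (u x)) / k) (at x)" if x: "0 < x" for B x
  proof -
    have "((\<lambda>x. Y x + B * x\<^sup>2 / (2 * k)) has_real_derivative
       v x + (1 * v x + (- (n / x) * v x - g (u x)) * x) / k + B * (2 * x) / (2 * k)) (at x)"
      unfolding Y_def
      by (intro DERIV_add DERIV_cdivide DERIV_cmult DERIV_mult DERIV_ident g.u_deriv g.v_deriv x)
         (auto intro!: derivative_eq_intros)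
    moreover have "v x + (1 * v x + (- (n / x) * v x - g (u x)) * x) / k + B * (2 * x) / (2 * k)
        = x * (B - g (u x)) / k"
      using x k by (simp add: kn field_simps)
    ultimately show ?thesis by simp
  qed
  have cont: "continuous_on {0..r} (\<lambda>x. Y x + B * x\<^sup>2 / (2 * k))" for B r
    unfolding Y_def using k
    by (intro continuous_intros continuous_on_subset [OF g.u_cont] continuous_on_subset [OF g.v_cont]) auto
  have Y0: "Y 0 = c" by (simp add: Y_def u0)
  have Yr1: "Y r1 = apparent" by (simp add: Y_def apparent_def r1 kn)
  have "Y r0 + (A\<^sup>2 * m) * r0\<^sup>2 / (2 * k) \<le> Y 0 + (A\<^sup>2 * m) * 0\<^sup>2 / (2 * k)"
  proof (rule DERIV_nonpos_imp_decreasing_open [OF _ _ cont])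
    show "0 \<le> r0" using r0 by simp
    fix x assume x: "0 < x" "x < r0"
    have "x * (A\<^sup>2 * m - g (u x)) / k \<le> 0"
      using gu_bounds(3) [of x] x k by (intro divide_nonpos_pos mult_nonneg_nonpos) auto
    then show "\<exists>y. ((\<lambda>x. Y x + A\<^sup>2 * m * x\<^sup>2 / (2 * k)) has_real_derivative y) (at x) \<and> y \<le> 0"
      using der [OF x(1), of "A\<^sup>2 * m"] by blast
  qed
  moreover have "Y r1 + 0 * r1\<^sup>2 / (2 * k) \<le> Y r0 + 0 * r0\<^sup>2 / (2 * k)"
  proof (rule DERIV_nonpos_imp_nonincreasing [where f = "\<lambda>x. Y x + 0 * x\<^sup>2 / (2 * k)"])
    show "r0 \<le> r1" using r0_r1 by simp
    fix x assume x: "r0 \<le> x" "x \<le> r1"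
    have x0: "0 < x" using x r0 by simp
    have "x * (0 - g (u x)) / k \<le> 0"
      using gu_bounds(1) [of x] x x0 k by (intro divide_nonpos_pos mult_nonneg_nonpos) auto
    then show "\<exists>y. ((\<lambda>x. Y x + 0 * x\<^sup>2 / (2 * k)) has_real_derivative y) (at x) \<and> y \<le> 0"
      using der [OF x0, of 0] by blast
  qed
  ultimately have "apparent \<le> c - (A\<^sup>2 * m) * r0\<^sup>2 / (2 * k)" using Y0 Yr1 by simp
  also have "\<dots> = c - (A\<^sup>2 * M * r0\<^sup>2) * (m / M) / (2 * k)" using mM by simp
  also have "\<dots> \<le> c - (2 * (real n + 1) * (c - a2)) * (m / M) / (2 * k)"
    using r0_bounds(2) mM k by (intro diff_left_mono divide_right_mono mult_right_mono) auto
  also have "(2 * (real n + 1) * (c - a2)) * (m / M) / (2 * k) = (real n + 1) / (real n - 1) * (m / M) * (c - a2)"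
  proof -
    have "(2 * p * x) * y / (2 * k) = p / k * y * x" for p x y :: real using k by simp
    then show ?thesis by (simp only: k_def)
  qed
  finally show "apparent \<le> c - (real n + 1) / (real n - 1) * (m / M) * (c - a2)" .
  have "Y 0 + (A\<^sup>2 * M) * 0\<^sup>2 / (2 * k) \<le> Y r1 + (A\<^sup>2 * M) * r1\<^sup>2 / (2 * k)"
  proof (rule DERIV_nonneg_imp_increasing_open [OF _ _ cont])
    show "0 \<le> r1" using r1 by simp
    fix x assume x: "0 < x" "x < r1"
    have "0 \<le> x * (A\<^sup>2 * M - g (u x)) / k"
      using gu_bounds(2) [of x] x k by (intro divide_nonneg_pos mult_nonneg_nonneg) auto
    then show "\<exists>y. ((\<lambda>x. Y x + A\<^sup>2 * M * x\<^sup>2 / (2 * k)) has_real_derivative y) (at x) \<and> 0 \<le> y"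
      using der [OF x(1), of "A\<^sup>2 * M"] by blast
  qed
  then have "c - (A\<^sup>2 * r1\<^sup>2) * M / (2 * k) \<le> apparent" using Y0 Yr1 by (simp add: field_simps)
  moreover have "(A\<^sup>2 * r1\<^sup>2) * M / (2 * k) \<le> (8 * (real n + 1) * (c - a2) / m) * M / (2 * k)"
    using r1_sq mM k by (intro divide_right_mono mult_right_mono) auto
  moreover have "(8 * (real n + 1) * (c - a2) / m) * M / (2 * k) = 4 * (M / m) * ((real n + 1) / (real n - 1)) * (c - a2)"
    using k mM by (simp add: kn field_simps)
  ultimately show "c - 4 * (M / m) * ((real n + 1) / (real n - 1)) * (c - a2) \<le> apparent" by linarith
qed

end

text \<open>Clamping supplies the uniform continuity that \<open>shooting\<close> requires, without
  changing the function on \<open>[0,a]\<close>.\<close>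

lemma clamp_uniformly_continuous:
  fixes f :: "real \<Rightarrow> real"
  assumes f: "continuous_on {0..a} f" and a: "0 \<le> a"
  shows "uniformly_continuous_on UNIV (\<lambda>s. f (max 0 (min s a)))"
  unfolding uniformly_continuous_on_def
proof (intro allI impI)
  fix e :: real assume "0 < e"
  moreover have "uniformly_continuous_on {0..a} f" by (rule compact_uniformly_continuous [OF f]) simp
  ultimately obtain d where d: "0 < d"
    "\<And>x y. x \<in> {0..a} \<Longrightarrow> y \<in> {0..a} \<Longrightarrow> dist y x < d \<Longrightarrow> dist (f y) (f x) < e"
    unfolding uniformly_continuous_on_def by blast
  have "dist (f (max 0 (min y a))) (f (max 0 (min x a))) < e" if "dist y x < d" for x y
    by (rule d(2)) (use that a in \<open>auto simp: dist_real_def max_def min_def split: if_splits\<close>)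
  then show "\<exists>d>0. \<forall>x\<in>UNIV. \<forall>x'\<in>UNIV. dist x' x < d \<longrightarrow>
      dist (f (max 0 (min x' a))) (f (max 0 (min x a))) < e" using d(1) by blast
qed

lemma clamp_bounded:
  fixes f :: "real \<Rightarrow> real"
  assumes f: "continuous_on {0..a} f" and a: "0 \<le> a"
  obtains M where "\<And>s. \<bar>f (max 0 (min s a))\<bar> \<le> M"
proof -
  have "bounded (f ` {0..a})" by (intro compact_imp_bounded compact_continuous_image f) simp
  then obtain M where "\<forall>x\<in>{0..a}. \<bar>f x\<bar> \<le> M" by (auto simp: bounded_iff)
  then show ?thesis using a by (intro that [of M]) auto
qed

lemma (in well) f_min_eq: "0 \<le> a \<Longrightarrow> f (min s a) = f (max 0 (min s a))"
  using f_nonpos0 [of s] f_nonpos0 [of 0] by (cases "0 \<le> s") auto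

section \<open>The solution seen from outside its fast descent\<close>

context fast_descent
begin

text \<open>The true source once \<open>u\<close> stays below \<open>a1\<close>; inside the descent
  it replaces the large source by one bounded independently of \<open>A\<close>.\<close>

definition outer :: "real \<Rightarrow> real" where "outer t = f (min (u t) a1)"

lemma outer_cont: "continuous_on {0..} outer"
  unfolding outer_def
  by (intro continuous_on_compose2 [OF f_contU, of _ "\<lambda>t. min (u t) a1"] continuous_intros g.u_cont) auto

text \<open>The flux that this replacement omits; from outside it acts like a point source at the
  origin.\<close>

definition jump :: real where "jump = rint n (\<lambda>t. g (u t)) r1 - rint n outer r1"

lemma jump_nonneg: "0 \<le> jump"
proof -
  have "rint n outer r1 \<le> rint n (\<lambda>t. g (u t)) r1"
  proof (rule rint_mono [OF outer_cont g.fu_cont])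
    fix t assume t: "t \<in> {0..r1}"
    then have "a1 \<le> u t" "u t \<le> c" using u_ge(1) u_le_c by auto
    then show "outer t \<le> g (u t)" using low' [of "u t"] by (simp add: outer_def min_absorb2)
  qed
  then show ?thesis by (simp add: jump_def)
qed

context
  assumes untrapped: "\<not> trapped G u v"
begin

lemma below: "r1 \<le> t \<Longrightarrow> u t \<le> a1"
  by (rule g.stays_below [OF untrapped a(1)]) (use r1 in auto)

lemma rint_outer:
  assumes r: "r1 \<le> r"
  shows "rint n (\<lambda>t. g (u t)) r = jump + rint n outer r"
proof (cases "r = r1")
  case False
  then have lt: "r1 < r" using r by simp
  define \<Delta> where "\<Delta> r = rint n (\<lambda>t. g (u t)) r - rint n outer r" for r
  have der: "(\<Delta> has_real_derivative x ^ n * g (u x) - x ^ n * outer x) (at x)" if "0 < x" for x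
    unfolding \<Delta>_def [abs_def]
    by (intro DERIV_diff rint_has_derivative g.fu_cont outer_cont that)
  obtain z where z: "r1 < z" "z < r" "\<Delta> r - \<Delta> r1 = (r - r1) * (z ^ n * g (u z) - z ^ n * outer z)"
  proof (rule real_mvt [OF lt])
    show "continuous_on {r1..r} \<Delta>"
      by (intro continuous_at_imp_continuous_on ballI DERIV_isCont [OF der]) (use r1 in auto)
    show "(\<Delta> has_real_derivative x ^ n * g (u x) - x ^ n * outer x) (at x)" if "r1 < x" "x < r" for x
      by (rule der) (use that r1 in simp)
  qed
  have "g (u z) = outer z"
    using below [of z] z agree(1) [of "u z"] by (simp add: outer_def min_absorb1)
  then have "\<Delta> r = \<Delta> r1" using z(3) by simp
  then show ?thesis by (simp add: \<Delta>_def jump_def)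
qed (simp add: jump_def)

lemma v_outer: "r1 \<le> r \<Longrightarrow> v r = - (jump / r ^ n) - rmean n outer r"
  using g.v_eq [of r] r1(1) rint_outer [of r] by (simp add: rmean_def add_divide_distrib)

text \<open>Initial height of the regular part \<open>u - jump / ((n - 1) r^(n-1))\<close>,
  continued to the origin with source \<open>outer\<close>.\<close>

definition start :: real where
  "start = a1 - jump / ((real n - 1) * r1 ^ (n - 1)) + integral {0..r1} (rmean n outer)"

lemma start_outer:
  assumes r: "r1 \<le> r"
  shows "start - integral {0..r} (rmean n outer) = u r - jump / ((real n - 1) * r ^ (n - 1))"
proof (cases "r = r1")
  case False
  then have lt: "r1 < r" using r by simp
  obtain m where m: "n = Suc (Suc m)" using g.n by (metis add_2_eq_Suc le_Suc_ex)
  define \<Delta> where "\<Delta> r = u r - jump / (real n - 1) * inverse (r ^ (n - 1)) + integral {0..r} (rmean n outer)" for r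
  have der: "(\<Delta> has_real_derivative 0) (at x)" if x: "r1 \<le> x" for x
  proof -
    have x0: "0 < x" using x r1 by simp
    have "(\<Delta> has_real_derivative v x - jump / (real n - 1) *
        (- (inverse (x ^ (n - 1)) * (real (n - 1) * x ^ m) * inverse (x ^ (n - 1)))) + rmean n outer x) (at x)"
      unfolding \<Delta>_def [abs_def]
      by (intro DERIV_add DERIV_diff DERIV_cmult g.u_deriv DERIV_inverse' DERIV_pow_Suc
          has_real_derivative_integral continuous_on_rmean outer_cont x0) (use x0 m in auto)
    moreover have "v x - jump / (real n - 1) *
        (- (inverse (x ^ (n - 1)) * (real (n - 1) * x ^ m) * inverse (x ^ (n - 1)))) + rmean n outer x = 0"
    proof -
      have cancel: "j / K * (- (inverse (x * z) * (K * z) * inverse (x * z))) = - (j / (x * (x * z)))"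
        if "K \<noteq> 0" "0 < z" for j K z :: real using that x0 by (simp add: field_simps)
      have "x ^ (n - 1) = x * x ^ m" "x ^ n = x * (x * x ^ m)" "real (n - 1) = real n - 1"
        using m by auto
      then show ?thesis
        using cancel [of "real n - 1" "x ^ m" jump] x0 g.n by (simp add: v_outer [OF x])
    qed
    ultimately show ?thesis by simp
  qed
  obtain z where "\<Delta> r - \<Delta> r1 = (r - r1) * 0"
  proof (rule real_mvt [OF lt, where f' = "\<lambda>_. 0"])
    show "continuous_on {r1..r} \<Delta>"
      by (intro continuous_at_imp_continuous_on ballI DERIV_isCont [OF der]) auto
    show "(\<Delta> has_real_derivative 0) (at x)" if "r1 < x" "x < r" for x
      by (rule der) (use that in simp)
  qed
  then have "\<Delta> r = \<Delta> r1" by simp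
  then show ?thesis unfolding \<Delta>_def start_def using r1(2) by (simp add: divide_inverse mult.assoc)
qed (simp add: start_def r1)

text \<open>A source bounded by \<open>B\<close> changes heights by at most a multiple of
  \<open>B r1^2\<close>. Hence \<open>start\<close> approaches \<open>apparent\<close> as
  \<open>r1\<close> tends to 0, while the factor \<open>r1^(n-1)\<close> makes the point source
  disappear.\<close>

lemma start_bounds:
  assumes B: "\<And>s. \<bar>f (min s a1)\<bar> \<le> B"
  shows "\<bar>start - apparent\<bar> \<le> 2 * B * r1\<^sup>2"
    and "jump \<le> r1 ^ (n - 1) * ((real n - 1) * (a1 - apparent) + B * r1\<^sup>2)"
proof -
  obtain m where m: "n = Suc (Suc m)" using g.n by (metis add_2_eq_Suc le_Suc_ex)
  have B0: "0 \<le> B" using B [of 0] by simp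
  have r10: "0 < r1" by (rule r1)
  have outB: "\<bar>outer t\<bar> \<le> B" for t by (simp add: outer_def B)
  define J where "J = rmean n outer r1"
  have J: "\<bar>J\<bar> \<le> B * r1" unfolding J_def
    by (rule rmean_abs_bound [OF outer_cont]) (use r10 outB in auto)
  have int: "\<bar>integral {0..r1} (rmean n outer)\<bar> \<le> B * r1\<^sup>2"
  proof -
    have "\<bar>integral {0..r1} (rmean n outer)\<bar> \<le> B * r1\<^sup>2 / 2 - B * 0\<^sup>2 / 2"
      by (rule integral_rmean_bound [OF outer_cont, where G = "\<lambda>_. B"])
         (use outB r10 in \<open>auto intro!: derivative_eq_intros\<close>)
    then show ?thesis using B0 by simp
  qed
  have jump: "jump = r1 ^ n * (- v r1 - J)"
    using g.v_eq [of r1] r10 by (simp add: jump_def J_def rmean_def field_simps)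
  have app: "r1 * (- v r1) = (real n - 1) * (a1 - apparent)"
    using g.n by (simp add: apparent_def)
  have "jump = r1 ^ (n - 1) * ((real n - 1) * (a1 - apparent) - r1 * J)"
    unfolding jump app [symmetric] by (simp add: m algebra_simps)
  note jump' = this
  have r1J: "\<bar>r1 * J\<bar> \<le> B * r1\<^sup>2"
    using mult_left_mono [OF J, of r1] r10 by (simp add: abs_mult power2_eq_square mult_ac)
  have "(real n - 1) * (a1 - apparent) - r1 * J \<le> (real n - 1) * (a1 - apparent) + B * r1\<^sup>2"
    using r1J by linarith
  then show "jump \<le> r1 ^ (n - 1) * ((real n - 1) * (a1 - apparent) + B * r1\<^sup>2)"
    unfolding jump' using r10 by (intro mult_left_mono) auto
  have "jump / ((real n - 1) * r1 ^ (n - 1)) = (a1 - apparent) - r1 * J / (real n - 1)"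
    unfolding jump' using r10 g.n by (simp add: field_simps)
  then have eq: "start - apparent = r1 * J / (real n - 1) + integral {0..r1} (rmean n outer)"
    by (simp add: start_def)
  have "\<bar>r1 * J / (real n - 1)\<bar> = \<bar>r1 * J\<bar> / (real n - 1)" using g.n by (simp add: abs_mult)
  also have "\<dots> \<le> \<bar>r1 * J\<bar> / 1" using g.n by (intro divide_left_mono) auto
  finally have "\<bar>r1 * J / (real n - 1)\<bar> \<le> B * r1\<^sup>2" using r1J by simp
  then have "\<bar>r1 * J / (real n - 1)\<bar> + \<bar>integral {0..r1} (rmean n outer)\<bar> \<le> 2 * B * r1\<^sup>2"
    using int by simp
  then show "\<bar>start - apparent\<bar> \<le> 2 * B * r1\<^sup>2"
    unfolding eq by (rule order_trans [OF abs_triangle_ineq])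
qed

text \<open>Hiding the locale quantities behind existential quantifiers allows radii, point sources
  and heights to be chosen along a sequence of descents.\<close>

lemma outer_description:
  assumes B: "\<And>s. \<bar>f (min s a1)\<bar> \<le> B"
    and hi: "c - (real n + 1) / (real n - 1) * (m / M) * (c - a2) \<le> hi"
    and lo: "lo \<le> c - 4 * (M / m) * ((real n + 1) / (real n - 1)) * (c - a2)"
  shows "\<exists>\<rho> q d. 0 < \<rho> \<and> A\<^sup>2 * \<rho>\<^sup>2 \<le> 8 * (real n + 1) * (c - a2) / m \<and>
     0 \<le> q \<and> q \<le> \<rho> ^ (n - 1) * ((real n - 1) * (a1 - lo) + B * \<rho>\<^sup>2) \<and>
     lo - 2 * B * \<rho>\<^sup>2 \<le> d \<and> d \<le> hi + 2 * B * \<rho>\<^sup>2 \<and> (\<forall>t\<in>{0..\<rho>}. a1 \<le> u t) \<and>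
     (\<forall>t\<ge>\<rho>. u t \<le> a1 \<and> v t = - (q / t ^ n) - rmean n outer t \<and>
        d - integral {0..t} (rmean n outer) = u t - q / ((real n - 1) * t ^ (n - 1)))"
proof (rule exI [of _ r1], rule exI [of _ jump], rule exI [of _ start], intro conjI ballI allI impI)
  have app: "lo \<le> apparent" "apparent \<le> hi" using apparent_bounds hi lo by linarith+
  have "(real n - 1) * (a1 - apparent) \<le> (real n - 1) * (a1 - lo)"
    using app g.n by (intro mult_left_mono) auto
  then have "r1 ^ (n - 1) * ((real n - 1) * (a1 - apparent) + B * r1\<^sup>2)
      \<le> r1 ^ (n - 1) * ((real n - 1) * (a1 - lo) + B * r1\<^sup>2)"
    using r1(1) by (intro mult_left_mono [OF add_right_mono]) auto
  then show "jump \<le> r1 ^ (n - 1) * ((real n - 1) * (a1 - lo) + B * r1\<^sup>2)"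
    using start_bounds(2) [OF B] by linarith
  show "lo - 2 * B * r1\<^sup>2 \<le> start" "start \<le> hi + 2 * B * r1\<^sup>2"
    using start_bounds(1) [OF B] app by linarith+
qed (use r1 r1_sq jump_nonneg u_ge(1) below v_outer start_outer in auto)

end

end

text \<open>Subtracting the singular harmonic part \<open>q / ((n - 1) r\<^bsup>n-1\<^esup>)\<close> turns the solutions for growing
  amplitudes into a family to which the compactness lemma applies.\<close>
lemma (in well) fast_descents_trapped:
  fixes g G u v :: "nat \<Rightarrow> real \<Rightarrow> real" and A :: "nat \<Rightarrow> real"
  assumes fd: "\<And>k. fast_descent f F (g k) (G k) b \<beta> n (u k) (v k) (A k) m M a1 a2 c"
    and A: "(\<lambda>k. inverse (A k)) \<longlonglongrightarrow> 0"
    and hi: "c - (real n + 1) / (real n - 1) * (m / M) * (c - a2) < \<alpha>"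
    and lo: "0 < c - 4 * (M / m) * ((real n + 1) / (real n - 1)) * (c - a2)"
    and \<alpha>: "\<alpha> \<le> a1"
    and TR: "\<And>W X. rsol n f W X \<Longrightarrow> 0 < W 0 \<Longrightarrow> W 0 < \<alpha> \<Longrightarrow> trapped F W X"
  shows "\<exists>k. trapped (G k) (u k) (v k)"
proof (rule ccontr)
  assume "\<not> ?thesis"
  then have nt: "\<And>k. \<not> trapped (G k) (u k) (v k)" by blast
  interpret d0: fast_descent f F "g 0" "G 0" b \<beta> n "u 0" "v 0" "A 0" m M a1 a2 c by (rule fd)
  have n: "2 \<le> n" by (rule d0.g.n)
  have n1: "1 \<le> n" using n by simp
  have a1: "0 < a1" using d0.a b_pos b_less by simp
  define H where "H = c - (real n + 1) / (real n - 1) * (m / M) * (c - a2)"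
  define l where "l = c - 4 * (M / m) * ((real n + 1) / (real n - 1)) * (c - a2)"
  \<comment> \<open>The cut at \<open>a1\<close> gives one bounded nonlinearity for all amplitudes;
    the limit will stay below \<open>a1\<close>, where \<open>fb\<close> is
    \<open>f\<close>.\<close>
  define fb where "fb s = f (min s a1)" for s
  have fb_eq: "fb = (\<lambda>s. f (max 0 (min s a1)))" using f_min_eq a1 by (auto simp: fb_def fun_eq_iff)
  have f_cont01: "continuous_on {0..a1} f" by (rule continuous_on_subset [OF f_contU]) simp
  obtain B where B: "\<And>s. \<bar>fb s\<bar> \<le> B"
    unfolding fb_eq using clamp_bounded [OF f_cont01] a1 less_imp_le by blast
  have uc: "uniformly_continuous_on UNIV fb"
    unfolding fb_eq by (rule clamp_uniformly_continuous [OF f_cont01]) (use a1 in simp)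
  have fb_cont: "continuous_on UNIV fb" by (rule uniformly_continuous_imp_continuous [OF uc])
  define C where "C = 8 * (real n + 1) * (c - a2) / m"
  have C0: "0 \<le> C" using d0.mM d0.a by (simp add: C_def)
  define O' where "O' k t = fb (u k t)" for k t
  have "\<exists>\<rho> q d. 0 < \<rho> \<and> (A k)\<^sup>2 * \<rho>\<^sup>2 \<le> C \<and>
     0 \<le> q \<and> q \<le> \<rho> ^ (n - 1) * ((real n - 1) * (a1 - l) + B * \<rho>\<^sup>2) \<and>
     l - 2 * B * \<rho>\<^sup>2 \<le> d \<and> d \<le> H + 2 * B * \<rho>\<^sup>2 \<and> (\<forall>t\<in>{0..\<rho>}. a1 \<le> u k t) \<and>
     (\<forall>t\<ge>\<rho>. u k t \<le> a1 \<and> v k t = - (q / t ^ n) - rmean n (O' k) t \<and>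
        d - integral {0..t} (rmean n (O' k)) = u k t - q / ((real n - 1) * t ^ (n - 1)))" for k
  proof -
    interpret d: fast_descent f F "g k" "G k" b \<beta> n "u k" "v k" "A k" m M a1 a2 c by (rule fd)
    have "d.outer = O' k" by (simp add: fun_eq_iff d.outer_def O'_def fb_def)
    then show ?thesis
      using d.outer_description [OF nt, of B H l] B unfolding C_def H_def l_def fb_def by simp
  qed
  then obtain \<rho> q d where \<rho>: "\<And>k. 0 < \<rho> k" "\<And>k. (A k)\<^sup>2 * (\<rho> k)\<^sup>2 \<le> C"
    and q: "\<And>k. 0 \<le> q k" "\<And>k. q k \<le> \<rho> k ^ (n - 1) * ((real n - 1) * (a1 - l) + B * (\<rho> k)\<^sup>2)"
    and d: "\<And>k. l - 2 * B * (\<rho> k)\<^sup>2 \<le> d k" "\<And>k. d k \<le> H + 2 * B * (\<rho> k)\<^sup>2"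
    and inner: "\<And>k t. t \<in> {0..\<rho> k} \<Longrightarrow> a1 \<le> u k t"
    and u_le': "\<And>k t. \<rho> k \<le> t \<Longrightarrow> u k t \<le> a1"
    and v_eq': "\<And>k t. \<rho> k \<le> t \<Longrightarrow> v k t = - (q k / t ^ n) - rmean n (O' k) t"
    and w_eq': "\<And>k t. \<rho> k \<le> t \<Longrightarrow>
        d k - integral {0..t} (rmean n (O' k)) = u k t - q k / ((real n - 1) * t ^ (n - 1))"
    by metis
  have A1: "1 \<le> A k" for k by (rule fast_descent.A [OF fd])
  have \<rho>0: "\<rho> \<longlonglongrightarrow> 0"
  proof (rule Lim_null_comparison)
    have "\<rho> k \<le> sqrt C * inverse (A k)" for k
    proof -
      have "sqrt ((A k)\<^sup>2 * (\<rho> k)\<^sup>2) \<le> sqrt C" by (rule real_sqrt_le_mono [OF \<rho>(2)])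
      moreover have "sqrt ((A k)\<^sup>2 * (\<rho> k)\<^sup>2) = A k * \<rho> k"
        using A1 [of k] \<rho>(1) [of k] by (simp add: real_sqrt_mult)
      ultimately show ?thesis using A1 [of k] by (simp add: field_simps)
    qed
    then show "\<forall>\<^sub>F k in sequentially. norm (\<rho> k) \<le> sqrt C * inverse (A k)"
      using \<rho>(1) by (intro always_eventually) (simp add: less_imp_le)
    show "(\<lambda>k. sqrt C * inverse (A k)) \<longlonglongrightarrow> 0" using tendsto_mult_right_zero [OF A] by simp
  qed
  have q0: "q \<longlonglongrightarrow> 0"
  proof (rule Lim_null_comparison)
    show "\<forall>\<^sub>F k in sequentially. norm (q k) \<le> \<rho> k ^ (n - 1) * ((real n - 1) * (a1 - l) + B * (\<rho> k)\<^sup>2)"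
      using q by (intro always_eventually) simp
    have "(\<lambda>k. \<rho> k ^ (n - 1) * ((real n - 1) * (a1 - l) + B * (\<rho> k)\<^sup>2))
        \<longlonglongrightarrow> 0 ^ (n - 1) * ((real n - 1) * (a1 - l) + B * 0\<^sup>2)"
      by (intro tendsto_intros \<rho>0)
    then show "(\<lambda>k. \<rho> k ^ (n - 1) * ((real n - 1) * (a1 - l) + B * (\<rho> k)\<^sup>2)) \<longlonglongrightarrow> 0"
      using n by (simp add: power_0_left)
  qed
  define e where "e k t = q k / ((real n - 1) * t ^ (n - 1))" for k t
  have e0: "(\<lambda>k. e k t) \<longlonglongrightarrow> 0" if "0 < t" for t
    unfolding e_def using tendsto_divide [OF q0 tendsto_const, of "(real n - 1) * t ^ (n - 1)"] that n by simp
  have e_nonneg: "0 \<le> e k t" if "0 < t" for k t using q(1) [of k] that n by (simp add: e_def)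
  define w where "w k t = d k - integral {0..t} (rmean n (O' k))" for k t
  have w_eq: "w k t = u k t - e k t" if "\<rho> k \<le> t" for k t using w_eq' [OF that] by (simp add: w_def e_def)
  have ev_\<rho>: "\<forall>\<^sub>F k in sequentially. \<rho> k \<le> t" if "0 < t" for t
    using order_tendstoD(2) [OF \<rho>0 that] by eventually_elim simp
  have \<rho>C: "(\<rho> k)\<^sup>2 \<le> C" for k
  proof -
    have "1 * (\<rho> k)\<^sup>2 \<le> (A k)\<^sup>2 * (\<rho> k)\<^sup>2" using A1 [of k] by (intro mult_right_mono) auto
    then show ?thesis using \<rho>(2) [of k] by simp
  qed
  have B0: "0 \<le> B" using B [of 0] by simp
  \<comment> \<open>The source \<open>O' k\<close> is evaluated at \<open>u\<close> and not at the
    regular part \<open>w\<close>; for fixed \<open>r > 0\<close> these eventually differ by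
    \<open>e k r\<close>, which tends to 0.\<close>
  obtain h W where h: "strict_mono h" and W: "rsol n fb W (\<lambda>r. - rmean n (\<lambda>t. fb (W t)) r)"
    and wW: "\<And>r. 0 \<le> r \<Longrightarrow> (\<lambda>k. w (h k) r) \<longlonglongrightarrow> W r"
    and mW: "\<And>r. 0 \<le> r \<Longrightarrow> (\<lambda>k. rmean n (O' (h k)) r) \<longlonglongrightarrow> rmean n (\<lambda>t. fb (W t)) r"
    and pW: "\<And>R. (\<And>r. r \<in> {0..R} \<Longrightarrow> 0 < W r) \<Longrightarrow> \<forall>\<^sub>F k in sequentially. \<forall>r\<in>{0..R}. 0 < w (h k) r"
  proof (rule radial_compactness [OF n1 fb_cont, where w = w and g = O' and d = d and M = B
        and B = "\<bar>l\<bar> + \<bar>H\<bar> + 2 * B * C"])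
    show "continuous_on {0..} (O' k)" for k
      unfolding O'_def
      by (rule continuous_on_compose2 [OF fb_cont radial_solution.u_cont])
         (use fd in \<open>auto simp: fast_descent_def well_solution_def\<close>)
    show "\<bar>O' k r\<bar> \<le> B" for k r by (simp add: O'_def B)
    show "w k r = d k - integral {0..r} (rmean n (O' k))" for k r by (simp add: w_def)
    show "\<bar>d k\<bar> \<le> \<bar>l\<bar> + \<bar>H\<bar> + 2 * B * C" for k
    proof -
      have "2 * B * (\<rho> k)\<^sup>2 \<le> 2 * B * C" using \<rho>C B0 by (intro mult_left_mono) auto
      then show ?thesis using d [of k] by linarith
    qed
    fix r :: real assume r: "0 < r"
    show "(\<lambda>k. O' k r - fb (w k r)) \<longlonglongrightarrow> 0"
    proof (rule tendstoI)
      fix \<epsilon> :: real assume "0 < \<epsilon>"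
      then obtain \<delta> where \<delta>: "0 < \<delta>" "\<And>x y. dist y x < \<delta> \<Longrightarrow> dist (fb y) (fb x) < \<epsilon>"
        using uc unfolding uniformly_continuous_on_def by blast
      have "\<forall>\<^sub>F k in sequentially. e k r < \<delta>" by (rule order_tendstoD(2) [OF e0 [OF r] \<delta>(1)])
      with ev_\<rho> [OF r] show "\<forall>\<^sub>F k in sequentially. dist (O' k r - fb (w k r)) 0 < \<epsilon>"
      proof eventually_elim
        case (elim k)
        have "dist (u k r) (w k r) < \<delta>"
          using elim e_nonneg [OF r, of k] w_eq by (simp add: dist_real_def)
        then have "dist (fb (u k r)) (fb (w k r)) < \<epsilon>" by (rule \<delta>(2))
        then show ?case by (simp add: dist_real_def O'_def)
      qed
    qed
  qed blast
  have \<rho>2: "(\<lambda>k. (\<rho> (h k))\<^sup>2) \<longlonglongrightarrow> 0"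
    using tendsto_power [OF LIMSEQ_subseq_LIMSEQ [OF \<rho>0 h], of 2] by (simp add: o_def)
  have dW: "(\<lambda>k. d (h k)) \<longlonglongrightarrow> W 0" using wW [of 0] by (simp add: w_def)
  have W0: "l \<le> W 0" "W 0 \<le> H"
  proof -
    have "(\<lambda>k. l - 2 * B * (\<rho> (h k))\<^sup>2) \<longlonglongrightarrow> l - 2 * B * 0" by (intro tendsto_intros \<rho>2)
    then show "l \<le> W 0" using LIMSEQ_le [OF _ dW] d(1) by fastforce
    have "(\<lambda>k. H + 2 * B * (\<rho> (h k))\<^sup>2) \<longlonglongrightarrow> H + 2 * B * 0" by (intro tendsto_intros \<rho>2)
    then show "W 0 \<le> H" using LIMSEQ_le [OF dW] d(2) by fastforce
  qed
  have uW: "(\<lambda>k. u (h k) r) \<longlonglongrightarrow> W r" if r: "0 < r" for r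
  proof -
    have "(\<lambda>k. w (h k) r + e (h k) r) \<longlonglongrightarrow> W r + 0"
      using LIMSEQ_subseq_LIMSEQ [OF e0 [OF r] h] r by (intro tendsto_add wW) (auto simp: o_def)
    moreover have "\<forall>\<^sub>F k in sequentially. w (h k) r + e (h k) r = u (h k) r"
      using eventually_subseq [OF h ev_\<rho> [OF r]] by eventually_elim (simp add: w_eq)
    ultimately show ?thesis by (simp add: tendsto_cong)
  qed
  have W_le: "W r \<le> a1" if "0 \<le> r" for r
  proof (cases "r = 0")
    case False
    then have r: "0 < r" using that by simp
    show ?thesis
    proof (rule tendsto_upperbound [OF uW [OF r]])
      show "\<forall>\<^sub>F k in sequentially. u (h k) r \<le> a1"
        using eventually_subseq [OF h ev_\<rho> [OF r]] by eventually_elim (rule u_le')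
    qed simp
  qed (use W0 hi \<alpha> in \<open>simp add: H_def\<close>)
  define X where "X r = - rmean n (\<lambda>t. fb (W t)) r" for r
  have sX: "rsol n f W X"
    using W W_le unfolding rsol_def X_def by (auto simp: fb_def min_absorb1)
  interpret W: well_solution f F b \<beta> n W X by unfold_locales (use n f_contU sX in auto)
  \<comment> \<open>The limiting height lies strictly between 0 and \<open>\<alpha>\<close>, as
    arranged by \<open>lo\<close> and \<open>hi\<close>.\<close>
  have "trapped F W X" by (rule TR [OF sX]) (use W0 lo hi in \<open>auto simp: l_def H_def\<close>)
  then obtain R where R: "0 < R" "\<And>r. r \<in> {0..R} \<Longrightarrow> 0 < W r" "W.E R < 0"
    by (rule W.trapped_pos_radius) blast
  have "(\<lambda>k. - (q (h k) / R ^ n) - rmean n (O' (h k)) R) \<longlonglongrightarrow> - (0 / R ^ n) - rmean n (\<lambda>t. fb (W t)) R"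
    using LIMSEQ_subseq_LIMSEQ [OF q0 h] R(1)
    by (intro tendsto_intros mW) (auto simp: o_def)
  moreover have "\<forall>\<^sub>F k in sequentially. - (q (h k) / R ^ n) - rmean n (O' (h k)) R = v (h k) R"
    using eventually_subseq [OF h ev_\<rho> [OF R(1)]] by eventually_elim (simp add: v_eq')
  ultimately have vX: "(\<lambda>k. v (h k) R) \<longlonglongrightarrow> X R" by (simp add: X_def tendsto_cong)
  have "(\<lambda>k. F (u (h k) R)) \<longlonglongrightarrow> F (W R)"
    by (rule isCont_tendsto_compose [OF DERIV_isCont [OF F_derivU] uW [OF R(1)]])
  then have "(\<lambda>k. (v (h k) R)\<^sup>2 / 2 + F (u (h k) R)) \<longlonglongrightarrow> W.E R"
    unfolding W.E_def by (intro tendsto_intros vX) auto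
  then have "\<forall>\<^sub>F k in sequentially. (v (h k) R)\<^sup>2 / 2 + F (u (h k) R) < 0"
    by (rule order_tendstoD(2)) (rule R(3))
  with pW [OF R(2)] have "\<forall>\<^sub>F k in sequentially. (\<forall>r\<in>{0..R}. 0 < w (h k) r) \<and>
      (v (h k) R)\<^sup>2 / 2 + F (u (h k) R) < 0" by (rule eventually_conj)
  with eventually_subseq [OF h ev_\<rho> [OF R(1)]]
  have "\<forall>\<^sub>F k in sequentially. \<rho> (h k) \<le> R \<and> (\<forall>r\<in>{0..R}. 0 < w (h k) r) \<and>
      (v (h k) R)\<^sup>2 / 2 + F (u (h k) R) < 0" by (rule eventually_conj)
  then obtain k where k: "\<rho> (h k) \<le> R" "\<forall>r\<in>{0..R}. 0 < w (h k) r"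
      "(v (h k) R)\<^sup>2 / 2 + F (u (h k) R) < 0"
    using eventually_happens' [OF sequentially_bot] by blast
  have "trapped (G (h k)) (u (h k)) (v (h k))"
    unfolding trapped_def
  proof (intro exI [of _ R] conjI ballI)
    show "(v (h k) R)\<^sup>2 / 2 + G (h k) (u (h k) R) < 0"
      using k(3) fast_descent.agree(2) [OF fd u_le' [OF k(1)]] by simp
    fix r assume r: "r \<in> {0..R}"
    \<comment> \<open>Inside the descent \<open>u\<close> is at least \<open>a1\<close>; outside it
      is at least \<open>w\<close>, since the singular part is nonnegative.\<close>
    show "0 < u (h k) r"
    proof (cases "r \<le> \<rho> (h k)")
      case True
      then show ?thesis using inner [of r "h k"] r a1 by simp
    next
      case False
      then have "0 < r" using \<rho>(1) [of "h k"] by simp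
      moreover have "0 < w (h k) r" using k(2) r by blast
      ultimately show ?thesis using w_eq [of "h k" r] e_nonneg [of r "h k"] False by simp
    qed
  qed (use R in simp)
  with nt show False by blast
qed

section \<open>Small amplitudes\<close>

context well_solution
begin

text \<open>If \<open>f \<le> \<eta>\<close> is small near the top, the solution arrives at the level \<open>a'\<close> at a large radius, and the
  remaining friction loss is at most \<open>n V a' / r0\<close>.\<close>
lemma slow_crossing:
  fixes a a' \<eta> V :: real
  assumes a: "\<beta> < a" "a < a'" "a' < u 0"
    and \<eta>: "0 < \<eta>" "\<And>s. a' \<le> s \<Longrightarrow> s \<le> u 0 \<Longrightarrow> f s \<le> \<eta>"
    and V: "0 < V" "\<And>s. 0 \<le> s \<Longrightarrow> s \<le> u 0 \<Longrightarrow> 2 * (F (u 0) - F s) \<le> V\<^sup>2"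
    and small: "(2 * n * V * a' / F a)\<^sup>2 * \<eta> \<le> 2 * (real n + 1) * (u 0 - a')"
  shows "crossing u"
proof (rule ccontr)
  assume "\<not> crossing u"
  then have u_nonneg: "0 \<le> u r" if "0 \<le> r" for r using that by (auto simp: crossing_def not_less)
  have bu: "b \<le> u 0" using a b_less by simp
  have Fa: "0 < F a" by (rule F_pos [OF a(1)])
  have a'0: "0 < a'" using a b_pos b_less by simp
  obtain r0 where r0: "0 \<le> r0" "u r0 = a'" "\<And>t. 0 \<le> t \<Longrightarrow> t < r0 \<Longrightarrow> a' < u t"
    by (rule level_reached [of a']) (use a b_less in auto)
  have r0p: "0 < r0" using r0 a by (cases "r0 = 0") auto
  have ge_a': "a' \<le> u t" if "0 \<le> t" "t \<le> r0" for t
    using r0(2) r0(3) [of t] that by (cases "t = r0") auto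
  define K where "K = real n + 1"
  have K: "0 < K" by (simp add: K_def)
  \<comment> \<open>With \<open>f \<le> \<eta>\<close> the solution stays above a flat parabola, so
    \<open>r0\<close> is at least of order \<open>1 / sqrt \<eta>\<close>.\<close>
  have "u 0 + \<eta> * 0\<^sup>2 / (2 * K) \<le> u r0 + \<eta> * r0\<^sup>2 / (2 * K)"
  proof (rule DERIV_nonneg_imp_increasing_open [OF r0(1)])
    show "continuous_on {0..r0} (\<lambda>x. u x + \<eta> * x\<^sup>2 / (2 * K))"
      using K by (intro continuous_intros continuous_on_subset [OF u_cont]) auto
    fix x assume x: "0 < x" "x < r0"
    have "rmean n (\<lambda>t. f (u t)) x \<le> \<eta> * x / Suc n"
      by (rule rmean_bounds(1) [OF fu_cont]) (use x ge_a' u_le [OF bu] \<eta>(2) in auto)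
    then have "0 \<le> v x + \<eta> * x / K" using v_eq [of x] x by (simp add: K_def add.commute)
    moreover have "((\<lambda>x. u x + \<eta> * x\<^sup>2 / (2 * K)) has_real_derivative v x + \<eta> * x / K) (at x)"
      using K by (auto intro!: derivative_eq_intros u_deriv x)
    ultimately show "\<exists>y. ((\<lambda>x. u x + \<eta> * x\<^sup>2 / (2 * K)) has_real_derivative y) (at x) \<and> 0 \<le> y" by blast
  qed
  then have "2 * K * (u 0 - a') \<le> r0\<^sup>2 * \<eta>" using K r0(2) by (simp add: field_simps)
  then have "(2 * n * V * a' / F a)\<^sup>2 * \<eta> \<le> r0\<^sup>2 * \<eta>" using small by (simp add: K_def)
  then have "(2 * n * V * a' / F a)\<^sup>2 \<le> r0\<^sup>2" using \<eta>(1) by simp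
  then have "2 * n * V * a' / F a \<le> r0" by (rule power2_le_imp_le) (rule r0(1))
  then have loss: "n * V / r0 * a' \<le> F a / 2" using Fa r0p by (simp add: field_simps)
  have vV: "\<bar>v r\<bar> \<le> V" if r: "0 \<le> r" for r
  proof -
    have "(v r)\<^sup>2 = 2 * (E r - F (u r))" by (simp add: E_def)
    also have "\<dots> \<le> 2 * (F (u 0) - F (u r))" using E_antimono [of 0 r] r by (simp add: E0)
    also have "\<dots> \<le> V\<^sup>2" by (rule V(2)) (use u_nonneg u_le [OF bu] r in auto)
    finally have "\<bar>v r\<bar>\<^sup>2 \<le> V\<^sup>2" by simp
    then show ?thesis by (rule power2_le_imp_le) (use V in simp)
  qed
  \<comment> \<open>While \<open>u\<close> decreases, the energy loss \<open>(n / r) v^2\<close> is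
    at most \<open>(n V / r0) |v|\<close>, whose integral is at most \<open>n V a' / r0\<close>;
    half of \<open>F a\<close> remains.\<close>
  have E_ge: "F a / 2 \<le> E r" if r: "r0 \<le> r" and v: "\<And>x. r0 < x \<Longrightarrow> x < r \<Longrightarrow> v x \<le> 0" for r
  proof -
    have "E r0 - n * V / r0 * u r0 \<le> E r - n * V / r0 * u r"
    proof (rule DERIV_nonneg_imp_increasing_open [OF r])
      show "continuous_on {r0..r} (\<lambda>x. E x - n * V / r0 * u x)"
        by (intro continuous_intros continuous_on_subset [OF u_cont] continuous_on_subset [OF E_cont])
           (use r0 in auto)
      fix x assume x: "r0 < x" "x < r"
      have x0: "0 < x" using x r0p by simp
      have "((\<lambda>x. E x - n * V / r0 * u x) has_real_derivative - (n / x) * (v x)\<^sup>2 - n * V / r0 * v x) (at x)"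
        by (intro DERIV_diff DERIV_cmult E_deriv u_deriv x0)
      moreover have "- (n / x) * (v x)\<^sup>2 - n * V / r0 * v x = n * (- v x) * (V / r0 - (- v x) / x)"
        by (simp add: algebra_simps power2_eq_square)
      moreover have "(- v x) / x \<le> V / r0"
        using vV [of x] x x0 r0p V(1) v [OF x] by (intro frac_le) auto
      then have "0 \<le> n * (- v x) * (V / r0 - (- v x) / x)"
        using v [OF x] by (intro mult_nonneg_nonneg) auto
      ultimately show "\<exists>y. ((\<lambda>x. E x - n * V / r0 * u x) has_real_derivative y) (at x) \<and> 0 \<le> y" by auto
    qed
    moreover have "F a \<le> E r0" using F_le_E [of r0] F_strict_mono [of a a'] a b_less r0(2) by simp
    moreover have "0 \<le> n * V / r0 * u r" using V r0p r u_nonneg [of r] by simp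
    ultimately show ?thesis using loss r0(2) by simp
  qed
  have vneg0: "v R < 0" if R: "0 < R" "R \<le> r0" for R
  proof (rule v_neg_if [OF R(1)])
    fix r assume "r \<in> {0..R}"
    then show "b < u r" using ge_a' [of r] R a b_less by simp
  qed
  \<comment> \<open>At a first critical point \<open>z\<close> the remaining energy gives
    \<open>F (u z) > 0\<close>, so \<open>u z\<close> lies above \<open>b\<close>, where
    \<open>v_neg_if\<close> excludes it.\<close>
  have vneg: "v R < 0" if R: "0 < R" for R
  proof (rule ccontr)
    assume vR: "\<not> v R < 0"
    then have "r0 < R" using vneg0 [OF R] by fastforce
    moreover have "continuous_on {r0..R} v" by (rule continuous_on_subset [OF v_cont]) (use r0 in auto)
    ultimately obtain z where z: "r0 < z" "z \<le> R" "v z = 0" "\<And>x. r0 \<le> x \<Longrightarrow> x < z \<Longrightarrow> v x < 0"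
      using first_zero [of r0 R v] vneg0 [OF r0p] vR by (metis less_imp_le linorder_not_less order_refl)
    have "F a / 2 \<le> E z" by (rule E_ge) (use z in \<open>auto intro: less_imp_le\<close>)
    then have "0 < F (u z)" using z(3) Fa by (simp add: E_def)
    then have uz: "b < u z" using F_le_0 [of "u z"] b_less by (cases "u z \<le> \<beta>") auto
    have "v z < 0"
    proof (rule v_neg_if)
      show "0 < z" using z r0p by simp
      fix r assume r: "r \<in> {0..z}" "v r = 0"
      show "b < u r"
      proof (cases "r \<le> r0")
        case True
        then show ?thesis using ge_a' [of r] r a b_less by simp
      next
        case False
        then have "r = z" using z(4) [of r] r by (cases "r < z") auto
        then show ?thesis using uz by simp
      qed
    qed
    then show False using z by simp
  qed
  have pos: "0 < u r" if r: "0 \<le> r" for r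
  proof (rule ccontr)
    assume "\<not> 0 < u r"
    then have ur: "u r = 0" using u_nonneg [OF r] by simp
    then have "0 < r" using r a a'0 by (cases "r = 0") auto
    then obtain d where "0 < d" "\<And>h. 0 < h \<Longrightarrow> h < d \<Longrightarrow> u (r + h) < u r"
      using DERIV_neg_dec_right [OF u_deriv vneg] by blast
    then have "u (r + d / 2) < 0" using ur by simp
    then show False using u_nonneg [of "r + d / 2"] r \<open>0 < d\<close> by simp
  qed
  have Elow: "F a / 2 \<le> E r" if "r0 \<le> r" for r
    by (rule E_ge [OF that]) (use vneg r0p in \<open>auto intro: less_imp_le\<close>)
  have "0 \<le> E r" if "0 \<le> r" for r
    using Elow [of "max r r0"] E_antimono [of r "max r r0"] that Fa by auto
  then have lim: "(u \<longlongrightarrow> 0) at_top" by (intro u_tendsto_0 pos)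
  have "((\<lambda>r. F (u r)) \<longlongrightarrow> F 0) at_top"
    by (rule isCont_tendsto_compose [OF DERIV_isCont [OF F_derivU] lim])
  then have "\<forall>\<^sub>F r in at_top. F (u r) < F a / 4"
    by (rule order_tendstoD) (use Fa in \<open>simp add: F_nonpos0\<close>)
  then obtain R where R: "\<And>r. R \<le> r \<Longrightarrow> F (u r) < F a / 4"
    unfolding eventually_at_top_linorder by blast
  \<comment> \<open>Energy at least \<open>F a / 2\<close> and \<open>F(u) < F a / 4\<close> leave
    \<open>v^2 > F a / 2\<close>.\<close>
  define k where "k = sqrt (F a / 2)"
  have k: "0 < k" "k\<^sup>2 = F a / 2"
    unfolding k_def by (rule real_sqrt_gt_zero real_sqrt_pow2, use Fa in linarith)+
  have "\<exists>r\<ge>max R r0. u r < 0"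
  proof (rule escape [OF k(1)])
    fix r assume "max R r0 < r"
    then have r: "R \<le> r" "r0 \<le> r" "0 < r" using r0p by auto
    have "(- v r)\<^sup>2 = 2 * E r - 2 * F (u r)" by (simp add: E_def)
    then have "k\<^sup>2 < (- v r)\<^sup>2" using Elow [OF r(2)] R [OF r(1)] k(2) by linarith
    then have "k < - v r" by (rule power_less_imp_less_base) (use vneg [OF r(3)] in linarith)
    then show "v r \<le> - k" by linarith
  qed (use r0 in simp)
  then obtain r where "max R r0 \<le> r" "u r < 0" by blast
  with u_nonneg [of r] r0 show False by simp
qed

end

section \<open>The glued nonlinearity\<close>

lemma affine_seg_left: "affine_seg x0 y0 x1 y1 x0 = y0"
  by (simp add: affine_seg_def)

lemma affine_seg_right: "x0 < x1 \<Longrightarrow> affine_seg x0 y0 x1 y1 x1 = y1"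
  by (simp add: affine_seg_def)

lemma affine_seg_between:
  assumes "x0 < x1" "x0 \<le> s" "s \<le> x1"
  shows "min y0 y1 \<le> affine_seg x0 y0 x1 y1 s" "affine_seg x0 y0 x1 y1 s \<le> max y0 y1"
proof -
  define t where "t = (s - x0) / (x1 - x0)"
  have t: "0 \<le> t" "t \<le> 1" using assms by (auto simp: t_def)
  have eq: "affine_seg x0 y0 x1 y1 s = (1 - t) * y0 + t * y1"
    unfolding affine_seg_def t_def by (simp add: algebra_simps diff_divide_distrib)
  have "(1 - t) * min y0 y1 + t * min y0 y1 \<le> (1 - t) * y0 + t * y1"
    using t by (intro add_mono mult_left_mono) auto
  then show "min y0 y1 \<le> affine_seg x0 y0 x1 y1 s" by (simp add: eq algebra_simps)
  have "(1 - t) * y0 + t * y1 \<le> (1 - t) * max y0 y1 + t * max y0 y1"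
    using t by (intro add_mono mult_left_mono) auto
  then show "affine_seg x0 y0 x1 y1 s \<le> max y0 y1" by (simp add: eq algebra_simps)
qed

lemma glued_pos_continuous:
  assumes f1: "continuous_on UNIV f1" and f2: "continuous_on {\<alpha>..} f2" and f3: "continuous_on {\<alpha>..} f3"
    and o: "\<alpha> \<le> \<alpha>1" "0 < \<epsilon>1" "\<alpha>1 + \<epsilon>1 \<le> \<alpha>2" "0 < \<epsilon>2"
  shows "continuous_on UNIV (glued_pos f1 f2 f3 \<alpha>1 \<epsilon>1 A2 \<alpha>2 \<epsilon>2 A3)"
proof -
  have aff: "continuous_on S (affine_seg x0 y0 x1 y1)" for S x0 y0 x1 y1
    unfolding affine_seg_def by (intro continuous_intros)
  have c2: "continuous_on S (\<lambda>s. A2\<^sup>2 * f2 s)" "continuous_on S (\<lambda>s. A3\<^sup>2 * f3 s)" if "S \<subseteq> {\<alpha>..}" for S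
    by (intro continuous_intros continuous_on_subset [OF f2 that] continuous_on_subset [OF f3 that])+
  show ?thesis
    unfolding glued_pos_def
    by (intro continuous_on_cases_le aff c2 continuous_on_id continuous_on_subset [OF f1])
       (use o affine_seg_left affine_seg_right in \<open>auto simp: affine_seg_def\<close>)
qed

text \<open>Positive values glued on above a level \<open>a > \<beta>\<close> leave the well intact,
  and primitives normalised at 0 agree up to \<open>a\<close>.\<close>

lemma (in well) extend:
  assumes g: "continuous_on UNIV g" and a: "\<beta> < a"
    and agree: "\<And>s. s \<le> a \<Longrightarrow> g s = f s" and pos: "\<And>s. a < s \<Longrightarrow> 0 < g s"
  obtains G where "well g G b \<beta>" "\<And>s. s \<le> a \<Longrightarrow> G s = F s"
proof -
  obtain G :: "real \<Rightarrow> real" where G: "\<And>s. (G has_real_derivative g s) (at s)" "G 0 = 0"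
    by (rule antiderivative_exists [OF g]) blast
  have der: "((\<lambda>x. G x - F x) has_real_derivative g s - f s) (at s)" for s
    by (intro DERIV_diff G F_derivU)
  have a0: "0 < a" using a b_pos b_less by simp
  have eq: "G y - F y = G x - F x" if xy: "x < y" "y \<le> a" for x y
  proof -
    obtain z where "x < z" "z < y" "(G y - F y) - (G x - F x) = (y - x) * (g z - f z)"
      by (rule real_mvt [OF xy(1), where f = "\<lambda>x. G x - F x"])
         (auto intro!: der continuous_at_imp_continuous_on DERIV_isCont [OF der])
    then show ?thesis using agree [of z] xy by simp
  qed
  have GF: "G s = F s" if "s \<le> a" for s
  proof (cases s "0 :: real" rule: linorder_cases)
    case less then show ?thesis using eq [of s 0] a0 G(2) F_nonpos0 [of 0] by simp
  next
    case greater then show ?thesis using eq [of 0 s] that G(2) F_nonpos0 [of 0] by simp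
  qed (use G(2) F_nonpos0 in simp)
  have ba: "b < a" using a b_less by simp
  have "well g G b \<beta>"
  proof
    show "0 < g s" if "b < s" for s using pos [of s] agree [of s] f_pos [OF that] by (cases "s \<le> a") auto
  qed (use g G GF agree a0 ba a b_pos b_less f_nonpos0 F_nonpos0 f_le F_neg F_beta in auto)
  with GF show ?thesis using that by blast
qed

lemma rsol_cong: "rsol n f u v \<Longrightarrow> (\<And>r. 0 \<le> r \<Longrightarrow> g (u r) = f (u r)) \<Longrightarrow> rsol n g u v"
  unfolding rsol_def by auto

lemma radial_ground_state_cong:
  "radial_ground_state N f u \<Longrightarrow> (\<And>r. 0 \<le> r \<Longrightarrow> g (u r) = f (u r)) \<Longrightarrow> radial_ground_state N g u"
  unfolding radial_ground_state_def by (metis less_imp_le)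

lemma radial_ground_state_nonneg: "radial_ground_state N f u \<Longrightarrow> 0 \<le> r \<Longrightarrow> 0 \<le> u r"
  unfolding radial_ground_state_def by (elim exE conjE) simp

lemma radial_ground_state_rsol:
  assumes "radial_ground_state (Suc n) f u"
  obtains v where "rsol n f u v" "\<And>r. 0 \<le> r \<Longrightarrow> 0 \<le> u r" "(u \<longlongrightarrow> 0) at_top" "\<exists>r\<ge>0. u r \<noteq> 0"
  using assms unfolding radial_ground_state_def rsol_def by auto

section \<open>Choice of levels and amplitudes\<close>

context well
begin

text \<open>An untrapped solution below \<open>U\<close> would make \<open>U\<close>
  crossing.\<close>

lemma trapped_below:
  assumes n: "2 \<le> n"
    and H2: "\<And>s. \<beta> < s \<Longrightarrow> \<exists>d. ((\<lambda>t. F t / f t) has_real_derivative d) (at s) \<and>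
               (real n - 1) / (2 * (real n + 1)) < d"
    and U: "rsol n f U V" "\<not> crossing U"
    and W: "rsol n f W X" "0 < W 0" "W 0 < U 0"
  shows "trapped F W X"
proof (rule ccontr)
  assume nt: "\<not> trapped F W X"
  interpret two_solutions f F b \<beta> n W X U V
    by unfold_locales (use n f_contU U W nt H2 in auto)
  show False using crossing_above U by simp
qed

lemma crossing_beyond:
  assumes n: "2 \<le> n"
    and H2: "\<And>s. \<beta> < s \<Longrightarrow> \<exists>d. ((\<lambda>t. F t / f t) has_real_derivative d) (at s) \<and>
               (real n - 1) / (2 * (real n + 1)) < d"
    and U: "rsol n f U V" "\<not> trapped F U V" "0 < U 0"
    and W: "rsol n f W X" "U 0 < W 0"
  shows "crossing W"
proof -
  interpret two_solutions f F b \<beta> n U V W X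
    by unfold_locales (use n f_contU U W H2 in auto)
  show ?thesis by (rule crossing_above)
qed

text \<open>Choice of the first two levels and of the first amplitude. With \<open>\<alpha>1 = \<alpha> + \<delta>\<close>, \<open>\<epsilon>1 = \<delta>\<close>,
  \<open>c = \<alpha> + (2\<^sup>n + 2 n + 2) \<delta>\<close> and \<open>f2\<close> nearly constant on \<open>[\<alpha>, c]\<close>, the apparent initial height
  falls just below \<open>\<alpha>\<close> for large \<open>A\<close>.\<close>
lemma large_amplitude_exists:
  fixes f2 :: "real \<Rightarrow> real" and \<alpha> :: real
  assumes n: "2 \<le> n" and \<alpha>: "\<beta> \<le> \<alpha>"
    and TR: "\<And>W X. rsol n f W X \<Longrightarrow> 0 < W 0 \<Longrightarrow> W 0 < \<alpha> \<Longrightarrow> trapped F W X"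
    and f2: "continuous_on {\<alpha>..} f2" "\<And>s. \<alpha> \<le> s \<Longrightarrow> 0 < f2 s"
    and f3: "continuous_on {\<alpha>..} f3" "\<And>s. \<alpha> \<le> s \<Longrightarrow> 0 < f3 s"
  obtains a1 \<epsilon> c A G where "\<alpha> < a1" "0 < \<epsilon>" "a1 + \<epsilon> < c" "0 < A"
    "well (\<lambda>s. glued_pos f f2 f3 a1 \<epsilon> A c 1 1 (min s c)) G b \<beta>"
    "\<And>s. s \<le> a1 \<Longrightarrow> G s = F s"
    "\<And>u v. rsol n (\<lambda>s. glued_pos f f2 f3 a1 \<epsilon> A c 1 1 (min s c)) u v \<Longrightarrow> u 0 = c \<Longrightarrow> trapped G u v"
proof -
  define k where "k = f2 \<alpha>"
  have k: "0 < k" using f2(2) by (simp add: k_def)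
  \<comment> \<open>Bounds around \<open>k\<close> with \<open>m / M = n / (n + 1)\<close>: the
    factor of \<open>c - a2\<close> in the upper bound of the apparent height becomes
    \<open>n / (n - 1)\<close>, still larger than 1.\<close>
  define m where "m = k * (2 * real n / (2 * real n + 1))"
  define M where "M = k * ((2 * real n + 2) / (2 * real n + 1))"
  have mM: "0 < m" "m \<le> M" using k n by (auto simp: m_def M_def intro!: mult_left_mono divide_right_mono)
  have ratio: "m / M = n / (real n + 1)" "M / m = (real n + 1) / n"
  proof -
    have quot: "(k * (x / y)) / (k * (z / y)) = x / z" if "0 < y" for x y z :: real
      using k that by simp
    have "m / M = 2 * real n / (2 * real n + 2)" "M / m = (2 * real n + 2) / (2 * real n)"
      unfolding m_def M_def by (rule quot, simp)+
    moreover have "2 * real n / (2 * real n + 2) = n / (real n + 1)"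
      "(2 * real n + 2) / (2 * real n) = (real n + 1) / n"
      using n by (simp_all add: field_simps)
    ultimately show "m / M = n / (real n + 1)" "M / m = (real n + 1) / n" by (simp_all only:)
  qed
  have mk: "m < k" "k < M"
    using mult_strict_left_mono [of "2 * real n / (2 * real n + 1)" 1 k] k
      mult_strict_left_mono [of 1 "(2 * real n + 2) / (2 * real n + 1)" k]
    by (auto simp: m_def M_def)
  have "(f2 \<longlongrightarrow> k) (at \<alpha> within {\<alpha>..})" using f2(1) by (simp add: continuous_on_def k_def)
  then have "\<forall>\<^sub>F s in at \<alpha> within {\<alpha>..}. m < f2 s" "\<forall>\<^sub>F s in at \<alpha> within {\<alpha>..}. f2 s < M"
    using mk by (auto intro: order_tendstoD)
  then have "\<forall>\<^sub>F s in at \<alpha> within {\<alpha>..}. m < f2 s \<and> f2 s < M" by (rule eventually_conj)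
  then obtain d0 where d0: "0 < d0" "\<And>s. \<alpha> < s \<Longrightarrow> s - \<alpha> < d0 \<Longrightarrow> m < f2 s \<and> f2 s < M"
    unfolding eventually_at by (auto simp: dist_real_def)
  \<comment> \<open>In units of \<open>\<delta>\<close>, \<open>c - \<alpha>\<close> is
    \<open>P\<close> and \<open>c - a2\<close> is \<open>P - 2\<close>. The summand
    \<open>2^n\<close> serves \<open>ramp\<close>; the apparent height is below
    \<open>\<alpha>\<close> when \<open>n (P - 2) > (n - 1) P\<close>, that is
    \<open>P > 2 n\<close>.\<close>
  define P where "P = 2 ^ n + 2 * real n + 2"
  have P: "0 < P" by (simp add: P_def add_pos_nonneg)
  have \<alpha>0: "0 < \<alpha>" using \<alpha> b_pos b_less by simp
  \<comment> \<open>The first bound keeps \<open>f2\<close> between \<open>m\<close> and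
    \<open>M\<close> up to \<open>c\<close>; the second gives
    \<open>c - \<alpha> \<le> \<alpha> / 25\<close>, so that a loss of \<open>18 (c - a2)\<close>
    still leaves a positive apparent height.\<close>
  define \<delta> where "\<delta> = min (d0 / (2 * P)) (\<alpha> / (25 * P))"
  have \<delta>: "0 < \<delta>" using d0 P \<alpha>0 by (simp add: \<delta>_def)
  have "\<delta> \<le> d0 / (2 * P)" "\<delta> \<le> \<alpha> / (25 * P)" by (simp_all add: \<delta>_def)
  then have "P * \<delta> \<le> d0 / 2" "P * \<delta> \<le> \<alpha> / 25" using P by (simp_all add: field_simps)
  then have P\<delta>: "P * \<delta> < d0" "P * \<delta> \<le> \<alpha> / 25" using d0 by auto
  define a1 where "a1 = \<alpha> + \<delta>"
  define a2 where "a2 = a1 + \<delta>"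
  define c where "c = \<alpha> + P * \<delta>"
  have P2: "2 < P" using n by (simp add: P_def add_pos_pos)
  then have "2 * \<delta> < P * \<delta>" using \<delta> by (rule mult_strict_right_mono)
  then have lev: "\<alpha> < a1" "a1 < a2" "a2 < c" using \<delta> by (auto simp: a1_def a2_def c_def)
  have a1\<beta>: "\<beta> < a1" using lev \<alpha> by simp
  have a10: "0 < a1" "b < a1" using a1\<beta> b_pos b_less by auto
  have f2b: "m \<le> f2 s" "f2 s \<le> M" if "a1 \<le> s" "s \<le> c" for s
    using d0(2) [of s] that lev P\<delta> by (auto simp: c_def)
  have fa1: "0 < f a1" using f_pos [OF a10(2)] .
  \<comment> \<open>The summands 1 and \<open>f a1 / m\<close> ensure
    \<open>A^2 m \<ge> f a1\<close>, so that the affine piece rises; the last one sends the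
    amplitude to infinity.\<close>
  define Am where "Am k = 1 + f a1 / m + real k" for k :: nat
  have Am1: "1 \<le> Am k" for k using fa1 mM by (simp add: Am_def)
  have Am_sq: "f a1 \<le> (Am k)\<^sup>2 * m" for k
  proof -
    have "f a1 / m \<le> Am k" by (simp add: Am_def)
    also have "\<dots> \<le> (Am k)\<^sup>2" using Am1 [of k] by (rule self_le_power) simp
    finally show ?thesis using mM by (simp add: field_simps)
  qed
  \<comment> \<open>The final \<open>1 1\<close> are placeholders: \<open>min s c\<close> never
    reaches the last two pieces.\<close>
  define g where "g k s = glued_pos f f2 f3 a1 \<delta> (Am k) c 1 1 (min s c)" for k s
  have g1: "g k s = f s" if "s \<le> a1" for k s using that lev by (simp add: g_def glued_pos_def)
  have g2: "g k s = (Am k)\<^sup>2 * f2 s" if "a2 < s" "s \<le> c" for k s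
    using that lev by (simp add: g_def glued_pos_def a2_def)
  have gaff: "g k s = affine_seg a1 (f a1) a2 ((Am k)\<^sup>2 * f2 a2) s" if "a1 < s" "s \<le> a2" for k s
    using that lev by (simp add: g_def glued_pos_def a2_def)
  have A_f2: "(Am k)\<^sup>2 * m \<le> (Am k)\<^sup>2 * f2 s" "(Am k)\<^sup>2 * f2 s \<le> (Am k)\<^sup>2 * M" if "a1 \<le> s" "s \<le> c" for k s
    using f2b [OF that] by (auto intro!: mult_left_mono)
  have g_low: "(Am k)\<^sup>2 * m \<le> g k s" if "a2 \<le> s" "s \<le> c" for k s
  proof (cases "s = a2")
    case True
    then show ?thesis using gaff [of a2 k] A_f2(1) [of a2 k] lev by (simp add: affine_seg_right)
  next
    case False
    then show ?thesis using g2 [of s k] A_f2(1) [of s k] that lev by simp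
  qed
  have g_bounds: "f a1 \<le> g k s" "g k s \<le> (Am k)\<^sup>2 * M" if s: "a1 \<le> s" "s \<le> c" for k s
  proof -
    have M1: "f a1 \<le> (Am k)\<^sup>2 * M"
      using Am_sq [of k] mult_left_mono [OF mM(2), of "(Am k)\<^sup>2"] by simp
    have "f a1 \<le> g k s \<and> g k s \<le> (Am k)\<^sup>2 * M"
    proof (cases "s = a1 \<or> a2 < s")
      case True
      then show ?thesis
      proof
        assume "s = a1"
        then show ?thesis using g1 [of a1 k] M1 by simp
      next
        assume "a2 < s"
        then show ?thesis using g2 [of s k] A_f2 [OF s, of k] Am_sq [of k] s by simp
      qed
    next
      case False
      then have s': "a1 < s" "s \<le> a2" using s by auto
      have "f a1 \<le> (Am k)\<^sup>2 * f2 a2" "(Am k)\<^sup>2 * f2 a2 \<le> (Am k)\<^sup>2 * M"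
        using A_f2 [of a2 k] Am_sq [of k] lev by auto
      then show ?thesis
        using affine_seg_between [of a1 a2 s "f a1" "(Am k)\<^sup>2 * f2 a2"] s' lev gaff [OF s'] M1
        by (auto simp: min_absorb1 max_absorb2)
    qed
    then show "f a1 \<le> g k s" "g k s \<le> (Am k)\<^sup>2 * M" by auto
  qed
  have g_cont: "continuous_on UNIV (g k)" for k
    unfolding g_def
    by (rule continuous_on_compose2 [OF glued_pos_continuous [OF f_contU f2(1) f3(1)]])
       (use lev \<delta> in \<open>auto intro!: continuous_intros simp: a2_def\<close>)
  have g_pos: "0 < g k s" if "a1 < s" for k s
  proof -
    have "g k s = g k (min s c)" by (simp add: g_def)
    moreover have "f a1 \<le> g k (min s c)" by (rule g_bounds) (use that lev in auto)
    ultimately show ?thesis using fa1 by simp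
  qed
  have "\<exists>G. well (g k) G b \<beta> \<and> (\<forall>s\<le>a1. G s = F s)" for k
    by (rule extend [OF g_cont [of k] a1\<beta>]) (use g1 g_pos in auto)
  then obtain G where G: "\<And>k. well (g k) (G k) b \<beta>" "\<And>k s. s \<le> a1 \<Longrightarrow> G k s = F s" by metis
  have cond: "a2 - a1 \<le> 2 * (m / M) * (c - a2) / 2 ^ n"
    "c - (real n + 1) / (real n - 1) * (m / M) * (c - a2) < \<alpha>"
    "0 < c - 4 * (M / m) * ((real n + 1) / (real n - 1)) * (c - a2)"
  proof -
    have ca2: "c - a2 = (2 ^ n + 2 * n) * \<delta>" by (simp add: c_def a2_def a1_def P_def algebra_simps)
    have half: "1 / 2 \<le> m / M" using n by (simp add: ratio field_simps)
    have "a2 - a1 = \<delta>" by (simp add: a2_def)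
    also have "\<delta> \<le> (c - a2) / 2 ^ n" using \<delta> by (simp add: ca2 field_simps)
    also have "\<dots> = 2 * (1 / 2) * (c - a2) / 2 ^ n" by simp
    also have "\<dots> \<le> 2 * (m / M) * (c - a2) / 2 ^ n"
      using half lev by (intro divide_right_mono mult_right_mono mult_left_mono) auto
    finally show "a2 - a1 \<le> 2 * (m / M) * (c - a2) / 2 ^ n" .
    have n1: "0 < real n - 1" using n by simp
    have "(real n + 1) / (real n - 1) * (m / M) = n / (real n - 1)"
      using n1 by (simp add: ratio)
    moreover have "c - \<alpha> < n / (real n - 1) * (c - a2)"
    proof -
      have "(real n - 1) * (c - \<alpha>) < n * (c - a2)"
      proof -
        have c\<alpha>: "c - \<alpha> = P * \<delta>" by (simp add: c_def)
        have "n * (c - a2) - (real n - 1) * (c - \<alpha>) = (P - 2 * real n) * \<delta>"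
          unfolding ca2 c\<alpha> P_def by (simp add: algebra_simps)
        moreover have "0 < (P - 2 * real n) * \<delta>" using \<delta> by (intro mult_pos_pos) (simp_all add: P_def add_pos_pos)
        ultimately show ?thesis by linarith
      qed
      then show ?thesis using n1 by (simp add: field_simps)
    qed
    ultimately show "c - (real n + 1) / (real n - 1) * (m / M) * (c - a2) < \<alpha>" by simp
    \<comment> \<open>Both bounds are attained at \<open>n = 2\<close>; together with the factor 4
      they give 18.\<close>
    have "(real n + 1) / (real n - 1) \<le> 3" "M / m \<le> 3 / 2"
      using n n1 by (simp_all add: ratio field_simps)
    then have "4 * (M / m) * ((real n + 1) / (real n - 1)) \<le> 4 * (3 / 2) * 3"
      using n1 mM by (intro mult_mono) auto
    then have "4 * (M / m) * ((real n + 1) / (real n - 1)) * (c - a2) \<le> 4 * (3 / 2) * 3 * (c - a2)"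
      using lev by (intro mult_right_mono) auto
    also have "\<dots> = 18 * (c - a2)" by simp
    also have "\<dots> < c" using P\<delta>(2) \<alpha>0 \<delta> by (simp add: c_def a2_def a1_def)
    finally show "0 < c - 4 * (M / m) * ((real n + 1) / (real n - 1)) * (c - a2)" by simp
  qed
  \<comment> \<open>One amplitude has to serve all solutions from \<open>c\<close>; otherwise a
    choice of untrapped solutions, one for each amplitude, contradicts
    \<open>fast_descents_trapped\<close>.\<close>
  have "\<exists>k. \<forall>u v. rsol n (g k) u v \<longrightarrow> u 0 = c \<longrightarrow> trapped (G k) u v"
  proof (rule ccontr)
    assume "\<not> ?thesis"
    then obtain u v where uv: "\<And>k. rsol n (g k) (u k) (v k)" "\<And>k. u k 0 = c"
      "\<And>k. \<not> trapped (G k) (u k) (v k)" by metis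
    have "\<exists>k. trapped (G k) (u k) (v k)"
    proof (rule fast_descents_trapped [where A = Am and m = m and M = M and ?a1.0 = a1 and ?a2.0 = a2
          and c = c and \<alpha> = \<alpha> and g = g and n = n])
      show "fast_descent f F (g k) (G k) b \<beta> n (u k) (v k) (Am k) m M a1 a2 c" for k
      proof -
        interpret w: well "g k" "G k" b \<beta> by (rule G)
        show ?thesis
          by unfold_locales
             (use n g_cont uv g1 G(2) g_low g_bounds Am1 mM lev a1\<beta> cond(1) in auto)
      qed
      show "(\<lambda>k. inverse (Am k)) \<longlonglongrightarrow> 0"
      proof (rule Lim_null_comparison)
        show "\<forall>\<^sub>F k in sequentially. norm (inverse (Am k)) \<le> inverse (real (Suc k))"
        proof (rule always_eventually, rule allI)
          fix k
          have "real (Suc k) \<le> Am k" using fa1 mM by (simp add: Am_def)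
          then have "inverse (Am k) \<le> inverse (real (Suc k))" by (intro le_imp_inverse_le) auto
          then show "norm (inverse (Am k)) \<le> inverse (real (Suc k))" using Am1 [of k] by simp
        qed
      qed (rule LIMSEQ_inverse_real_of_nat)
      show "\<alpha> \<le> a1" using lev by simp
    qed (rule cond TR; assumption?)+
    with uv(3) show False by blast
  qed
  then obtain j where j: "\<And>u v. rsol n (g j) u v \<Longrightarrow> u 0 = c \<Longrightarrow> trapped (G j) u v" by blast
  show ?thesis
  proof (rule that [of a1 \<delta> c "Am j" "G j"])
    show "0 < Am j" using Am1 [of j] by simp
    show "well (\<lambda>s. glued_pos f f2 f3 a1 \<delta> (Am j) c 1 1 (min s c)) (G j) b \<beta>"
      using G(1) [of j] by (simp add: g_def [abs_def])
    show "trapped (G j) u v" if "rsol n (\<lambda>s. glued_pos f f2 f3 a1 \<delta> (Am j) c 1 1 (min s c)) u v" "u 0 = c" for u v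
      using j that by (simp add: g_def [abs_def])
  qed (use lev \<delta> G(2) in \<open>auto simp: a2_def\<close>)
qed

end

context well
begin

theorem three_glued_ground_states:
  assumes n: "2 \<le> n"
    and H2: "\<And>s. \<beta> < s \<Longrightarrow> \<exists>d. ((\<lambda>t. F t / f t) has_real_derivative d) (at s) \<and>
               (real n - 1) / (2 * (real n + 1)) < d"
    and U: "radial_ground_state (Suc n) f U"
    and f2: "continuous_on {U 0..} f2" "\<And>s. U 0 \<le> s \<Longrightarrow> 0 < f2 s"
    and f3: "continuous_on {U 0..} f3" "\<And>s. U 0 \<le> s \<Longrightarrow> 0 < f3 s"
  obtains \<alpha>1 \<epsilon>1 A2 \<alpha>2 \<epsilon>2 A3 u2 u3 where
    "U 0 < \<alpha>1" "0 < \<epsilon>1" "0 < A2" "\<alpha>1 + \<epsilon>1 < \<alpha>2" "0 < \<epsilon>2" "0 < A3"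
    "radial_ground_state (Suc n) (glued_pos f f2 f3 \<alpha>1 \<epsilon>1 A2 \<alpha>2 \<epsilon>2 A3) U"
    "radial_ground_state (Suc n) (glued_pos f f2 f3 \<alpha>1 \<epsilon>1 A2 \<alpha>2 \<epsilon>2 A3) u2"
    "radial_ground_state (Suc n) (glued_pos f f2 f3 \<alpha>1 \<epsilon>1 A2 \<alpha>2 \<epsilon>2 A3) u3"
    "U 0 < u2 0" "u2 0 < u3 0"
proof -
  obtain V0 where V0: "rsol n f U V0" and U_nonneg: "\<And>r. 0 \<le> r \<Longrightarrow> 0 \<le> U r"
    and U_lim: "(U \<longlongrightarrow> 0) at_top" and U_nz: "\<exists>r\<ge>0. U r \<noteq> 0"
    by (rule radial_ground_state_rsol [OF U]) blast
  interpret u: well_solution f F b \<beta> n U V0 by unfold_locales (use n f_contU V0 in auto)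
  have U_nc: "\<not> crossing U" using U_nonneg by (force simp: crossing_def)
  have U_nt: "\<not> trapped F U V0" by (rule u.ground_state_untrapped(2) [OF U_nonneg U_lim])
  have U0: "0 < U 0" using U_nz u.ground_state_pos [OF U_nonneg U_lim] by blast
  have "0 \<le> F (U 0)" using u.ground_state_untrapped(1) [OF U_nonneg U_lim, of 0] by (simp add: u.E0)
  then have U\<beta>: "\<beta> \<le> U 0" by (rule F_nonneg_imp [OF U0])
  have below: "\<And>W X. rsol n f W X \<Longrightarrow> 0 < W 0 \<Longrightarrow> W 0 < U 0 \<Longrightarrow> trapped F W X"
    by (rule trapped_below [OF n H2 V0 U_nc])
  have beyond: "\<And>W X. rsol n f W X \<Longrightarrow> U 0 < W 0 \<Longrightarrow> crossing W"
    by (rule crossing_beyond [OF n H2 V0 U_nt U0])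
  obtain a1 \<epsilon> c A G2 where lev: "U 0 < a1" "0 < \<epsilon>" "a1 + \<epsilon> < c" "0 < A"
    and w2: "well (\<lambda>s. glued_pos f f2 f3 a1 \<epsilon> A c 1 1 (min s c)) G2 b \<beta>"
    and G2F: "\<And>s. s \<le> a1 \<Longrightarrow> G2 s = F s"
    and tr2: "\<And>u v. rsol n (\<lambda>s. glued_pos f f2 f3 a1 \<epsilon> A c 1 1 (min s c)) u v \<Longrightarrow> u 0 = c \<Longrightarrow> trapped G2 u v"
    by (rule large_amplitude_exists [OF n U\<beta> below f2 f3];
        (assumption | (rule that; (assumption | simp))))
  define g2 where "g2 s = glued_pos f f2 f3 a1 \<epsilon> A c 1 1 (min s c)" for s
  have c: "U 0 < c" "a1 < c" "\<beta> < c" using lev U\<beta> by auto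
  have c0: "0 < c" using c b_pos b_less by simp
  interpret w2: well g2 G2 b \<beta> using w2 by (simp add: g2_def [abs_def])
  define a' where "a' = c + 1"
  define T where "T = c + 2"
  have "continuous_on {a'..T} f3" by (rule continuous_on_subset [OF f3(1)]) (use c in \<open>auto simp: a'_def\<close>)
  then obtain x3 where x3: "x3 \<in> {a'..T}" "\<And>s. s \<in> {a'..T} \<Longrightarrow> f3 s \<le> f3 x3"
    using continuous_attains_sup [of "{a'..T}" f3] by (auto simp: a'_def T_def)
  define M3 where "M3 = f3 x3"
  have M3: "0 < M3" using f3(2) [of x3] x3(1) c by (simp add: M3_def a'_def)
  obtain Bd where Bd: "\<And>s. 0 \<le> s \<Longrightarrow> s \<le> c \<Longrightarrow> \<bar>G2 s\<bar> \<le> Bd"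
  proof -
    have "bounded (G2 ` {0..c})" by (intro compact_imp_bounded compact_continuous_image w2.F_contU) simp
    then obtain B where "\<forall>s\<in>{0..c}. \<bar>G2 s\<bar> \<le> B" by (auto simp: bounded_iff)
    then show ?thesis by (intro that [of B]) simp
  qed
  have G2c: "0 < G2 c" by (rule w2.F_pos) (rule c)
  \<comment> \<open>Bounds the second affine piece without reference to \<open>A3\<close>, as its
    right end value will be at most \<open>\<eta> \<le> 1\<close>. This avoids a circle, since
    \<open>A3\<close> is chosen after the speed bound \<open>V\<close>.\<close>
  define K where "K = A\<^sup>2 * f2 c + 1"
  have f2c: "0 < A\<^sup>2 * f2 c" using f2(2) [of c] c lev by simp
  define V where "V = sqrt (2 * (G2 c + K + 1 + Bd))"
  have "0 \<le> Bd" using Bd [of 0] c0 by simp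
  then have Vp: "0 < G2 c + K + 1 + Bd" using G2c f2c by (simp add: K_def)
  then have V: "0 < V" "V\<^sup>2 = 2 * (G2 c + K + 1 + Bd)" by (simp_all add: V_def)
  define x where "x = (2 * n * V * a' / G2 c)\<^sup>2"
  have x0: "0 \<le> x" by (simp add: x_def)
  \<comment> \<open>As \<open>T - a' = 1\<close>, the hypothesis \<open>small\<close> of
    \<open>slow_crossing\<close> becomes \<open>x \<eta> \<le> 2 (n + 1)\<close>; the cap 1 is what
    \<open>K\<close> relies on.\<close>
  define \<eta> where "\<eta> = min 1 (2 * (real n + 1) / (x + 1))"
  have \<eta>: "0 < \<eta>" "\<eta> \<le> 1" using x0 by (auto simp: \<eta>_def)
  have x\<eta>: "x * \<eta> \<le> 2 * (real n + 1) * (T - a')"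
  proof -
    have "x * \<eta> \<le> (x + 1) * (2 * (real n + 1) / (x + 1))"
      using x0 \<eta> by (intro mult_mono) (auto simp: \<eta>_def)
    then show ?thesis using x0 by (simp add: T_def a'_def)
  qed
  define A3 where "A3 = sqrt (\<eta> / M3)"
  have A3: "0 < A3" "A3\<^sup>2 = \<eta> / M3" using \<eta> M3 by (simp_all add: A3_def)
  have A3f3: "0 < A3\<^sup>2 * f3 s" "A3\<^sup>2 * f3 s \<le> \<eta>" if "s \<in> {a'..T}" for s
  proof -
    show "0 < A3\<^sup>2 * f3 s" using f3(2) [of s] that c A3(1) by (simp add: a'_def)
    have "A3\<^sup>2 * f3 s \<le> A3\<^sup>2 * M3" unfolding M3_def by (intro mult_left_mono x3 that) simp
    then show "A3\<^sup>2 * f3 s \<le> \<eta>" using A3 M3 by simp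
  qed
  define \<phi> where "\<phi> = glued_pos f f2 f3 a1 \<epsilon> A c 1 A3"
  \<comment> \<open>Truncation above \<open>T\<close> makes the function bounded; solutions with
    initial height between \<open>b\<close> and \<open>T\<close> never exceed
    \<open>T\<close>.\<close>
  define g where "g s = \<phi> (min s T)" for s
  have \<phi>_cont: "continuous_on UNIV \<phi>"
    unfolding \<phi>_def by (rule glued_pos_continuous [OF f_contU f2(1) f3(1)]) (use lev in auto)
  have \<phi>_f: "\<phi> s = f s" if "s \<le> a1" for s using that by (simp add: \<phi>_def glued_pos_def)
  have g_clamp: "g = (\<lambda>s. \<phi> (max 0 (min s T)))"
  proof
    fix s
    show "g s = \<phi> (max 0 (min s T))"
    proof (cases "0 \<le> s")
      case False
      have "0 \<le> a1" using lev U0 by simp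
      then show ?thesis using False f_nonpos0 [of s] f_nonpos0 [of 0] \<phi>_f [of s] \<phi>_f [of 0] c0
        by (simp add: g_def T_def min_absorb1)
    qed (use c0 in \<open>simp add: g_def T_def\<close>)
  qed
  have g_cont: "continuous_on UNIV g"
    unfolding g_def by (rule continuous_on_compose2 [OF \<phi>_cont]) (auto intro!: continuous_intros)
  have gg2: "g s = g2 s" if "s \<le> c" for s using that lev by (simp add: g_def g2_def \<phi>_def glued_pos_def T_def)
  have g_ramp: "0 < g s" "g s \<le> K" if s: "c \<le> s" "s \<le> a'" for s
  proof -
    have "g s = affine_seg c (A\<^sup>2 * f2 c) (c + 1) (A3\<^sup>2 * f3 (c + 1)) s"
      using s lev by (cases "s = c") (auto simp: g_def \<phi>_def glued_pos_def a'_def T_def affine_seg_left)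
    moreover have "A3\<^sup>2 * f3 (c + 1) \<le> 1" "0 < A3\<^sup>2 * f3 (c + 1)"
      using A3f3 [of "c + 1"] \<eta> by (auto simp: a'_def T_def)
    ultimately show "0 < g s" "g s \<le> K"
      using affine_seg_between [of c "c + 1" s "A\<^sup>2 * f2 c" "A3\<^sup>2 * f3 (c + 1)"] s f2c
      by (auto simp: a'_def K_def)
  qed
  have g_top: "0 < g s \<and> g s \<le> \<eta>" if s: "a' \<le> s" for s
  proof -
    have st: "min s T \<in> {a'..T}" using s by (auto simp: a'_def T_def)
    have "g s = A3\<^sup>2 * f3 (min s T)"
    proof (cases "s = a'")
      case True
      then show ?thesis using lev by (simp add: g_def \<phi>_def glued_pos_def a'_def T_def affine_seg_right)
    next
      case False
      have "\<phi> t = A3\<^sup>2 * f3 t" if "c + 1 < t" for t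
        using that lev by (simp add: \<phi>_def glued_pos_def)
      moreover have "c + 1 < min s T" using False s by (auto simp: a'_def T_def)
      ultimately show ?thesis by (simp add: g_def)
    qed
    then show ?thesis using A3f3 [OF st] by simp
  qed
  have g_pos: "0 < g s" if "c < s" for s
    using g_ramp(1) [of s] g_top [of s] that by (cases "s \<le> a'") auto
  obtain GG where w3: "well g GG b \<beta>" and GG: "\<And>s. s \<le> c \<Longrightarrow> GG s = G2 s"
    by (rule w2.extend [OF g_cont c(3) gg2 g_pos]; (assumption | (rule that; (assumption | simp))))
  interpret w3: well g GG b \<beta> by (rule w3)
  have cross_T: "crossing u" if s: "rsol n g u v" "u 0 = T" for u v
  proof -
    interpret z: well_solution g GG b \<beta> n u v by unfold_locales (use n g_cont s in auto)
    show ?thesis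
    proof (rule z.slow_crossing [of c a' \<eta> V])
      show "g s \<le> \<eta>" if "a' \<le> s" for s using g_top [OF that] by simp
      show "2 * (GG (u 0) - GG s) \<le> V\<^sup>2" if s0: "0 \<le> s" "s \<le> u 0" for s
      proof -
        have ca: "c < a'" "a' < T" by (simp_all add: a'_def T_def)
        obtain y1 where y1: "c < y1" "y1 < a'" "GG a' - GG c = (a' - c) * g y1"
          by (rule real_mvt [OF ca(1) w3.F_contU w3.F_derivU])
        obtain y2 where y2: "a' < y2" "y2 < T" "GG T - GG a' = (T - a') * g y2"
          by (rule real_mvt [OF ca(2) w3.F_contU w3.F_derivU])
        have "GG T \<le> G2 c + K + 1"
          using y1 y2 g_ramp(2) [of y1] g_top [of y2] \<eta> GG [of c] by (simp add: a'_def T_def)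
        moreover have "- GG s \<le> Bd"
        proof (cases "s \<le> c")
          case True
          then show ?thesis using Bd [of s] GG [of s] s0 by simp
        next
          case False
          then have "0 < GG s" by (intro w3.F_pos) (use c in simp)
          then show ?thesis using \<open>0 \<le> Bd\<close> by simp
        qed
        ultimately show ?thesis using V(2) s(2) by simp
      qed
      show "(2 * n * V * a' / GG c)\<^sup>2 * \<eta> \<le> 2 * (real n + 1) * (u 0 - a')"
        using x\<eta> GG [of c] s(2) by (simp add: x_def)
    qed (use c \<eta> V s in \<open>auto simp: a'_def T_def\<close>)
  qed
  \<comment> \<open>Such a solution never meets the glued part, so it is an
    \<open>f\<close>-solution starting above the ground state \<open>U\<close>.\<close>
  have cross_a1: "crossing u" if s: "rsol n g u v" "u 0 = a1" for u v
  proof -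
    interpret z: well_solution g GG b \<beta> n u v by unfold_locales (use n g_cont s in auto)
    have "rsol n f u v"
    proof (rule rsol_cong [OF s(1)])
      fix r :: real assume "0 \<le> r"
      then have "u r \<le> a1" using z.u_le [of r] s(2) lev U\<beta> b_less by simp
      moreover from this have "min (u r) T = u r" using c by (simp add: T_def)
      ultimately show "f (u r) = g (u r)" by (simp add: g_def \<phi>_f)
    qed
    then show ?thesis by (rule beyond) (use s lev in simp)
  qed
  have trap_c: "trapped GG u v" if s: "rsol n g u v" "u 0 = c" for u v
  proof -
    interpret z: well_solution g GG b \<beta> n u v by unfold_locales (use n g_cont s in auto)
    have le: "u r \<le> c" if "0 \<le> r" for r using z.u_le [OF _ that] s(2) c b_less by simp
    then have "rsol n g2 u v" by (intro rsol_cong [OF s(1)]) (simp add: gg2)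
    then have "trapped G2 u v" using tr2 s(2) by (simp add: g2_def [abs_def])
    then show ?thesis unfolding trapped_def using GG le by auto
  qed
  have \<phi>01: "continuous_on {0..T} \<phi>" by (rule continuous_on_subset [OF \<phi>_cont]) simp
  have uc: "uniformly_continuous_on UNIV g"
    unfolding g_clamp by (rule clamp_uniformly_continuous [OF \<phi>01]) (use c0 in \<open>simp add: T_def\<close>)
  obtain M where M: "\<And>s. \<bar>g s\<bar> \<le> M"
    unfolding g_clamp by (rule clamp_bounded [OF \<phi>01]) (use c0 in \<open>auto simp: T_def\<close>)
  have GG0: "GG 0 = 0" by (simp add: w3.F_nonpos0)
  have to_glued: "radial_ground_state (Suc n) \<phi> w"
    if w: "radial_ground_state (Suc n) g w" "b \<le> w 0" "w 0 \<le> T" for w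
  proof -
    obtain x where "rsol n g w x" by (rule radial_ground_state_rsol [OF w(1)])
    then interpret z: well_solution g GG b \<beta> n w x by unfold_locales (use n g_cont in auto)
    have "w r \<le> T" if "0 \<le> r" for r using z.u_le [OF w(2) that] w(3) by simp
    then show ?thesis by (intro radial_ground_state_cong [OF w(1)]) (simp add: g_def min_absorb1)
  qed
  \<comment> \<open>To be used with the crossing heights \<open>a1\<close> and \<open>T\<close> on
    the two sides of the trapped height \<open>c\<close>, which then separates the two new ground
    states.\<close>
  have shoot: "\<exists>w. radial_ground_state (Suc n) \<phi> w \<and> min a c < w 0 \<and> w 0 < max a c"
    if a: "\<And>u v. rsol n g u v \<Longrightarrow> u 0 = a \<Longrightarrow> crossing u" "a1 \<le> a" "a \<le> T" for a
  proof -
    obtain u v where uv: "rsol n g u v" "\<not> crossing u" "\<not> trapped GG u v" "min a c < u 0" "u 0 < max a c"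
      by (rule shooting [OF n w3.F_derivU GG0 uc M a(1) trap_c]) blast+
    interpret z: well_solution g GG b \<beta> n u v by unfold_locales (use n g_cont uv in auto)
    have lower: "a1 < u 0" using uv(4) a(2) c by (simp add: min_def split: if_splits)
    have upper: "u 0 \<le> T" using uv(5) a(3) by (simp add: max_def T_def split: if_splits)
    have "0 < u 0" using lower lev U0 by simp
    then obtain w where "radial_ground_state (Suc n) g w" "w 0 = u 0"
      using z.ground_state_if [OF _ uv(2,3)] by blast
    then have "radial_ground_state (Suc n) \<phi> w"
      by (intro to_glued) (use lower upper lev U\<beta> b_less in auto)
    then show ?thesis using uv \<open>w 0 = u 0\<close> by auto
  qed
  have "\<exists>w. radial_ground_state (Suc n) \<phi> w \<and> min a1 c < w 0 \<and> w 0 < max a1 c"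
    by (rule shoot [OF cross_a1]; (assumption | use c in \<open>simp add: T_def\<close>))
  then obtain u2 where u2: "radial_ground_state (Suc n) \<phi> u2" "a1 < u2 0" "u2 0 < c"
    using c by auto
  have "\<exists>w. radial_ground_state (Suc n) \<phi> w \<and> min T c < w 0 \<and> w 0 < max T c"
    by (rule shoot [OF cross_T]; (assumption | use c in \<open>simp add: T_def\<close>))
  then obtain u3 where u3: "radial_ground_state (Suc n) \<phi> u3" "c < u3 0"
    by (auto simp: T_def)
  have "radial_ground_state (Suc n) \<phi> U"
  proof (rule radial_ground_state_cong [OF U])
    fix r :: real assume "0 \<le> r"
    then have "U r \<le> a1" using u.u_le [of r] U\<beta> b_less lev by simp
    then show "\<phi> (U r) = f (U r)" by (rule \<phi>_f)
  qed
  then show ?thesis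
    by (intro that [of a1 \<epsilon> A c 1 A3 u2 u3]) (use lev A3 u2 u3 in \<open>auto simp: \<phi>_def\<close>)
qed

end

section \<open>From the hypotheses to an energy well, and back to the oddly extended
  function\<close>

theorem theorem4p3:
  fixes N :: nat and f1 f2 f3 :: "real \<Rightarrow> real" and \<alpha>s :: real
  assumes N: "N > 2"
    and H1_cont: "continuous_on {0..} f1"
    and H1_C1: "\<exists>f1'. (\<forall>s>0. (f1 has_real_derivative f1' s) (at s)) \<and> continuous_on {0<..} f1'"
    and H1_zero: "f1 0 = 0"
    and H1_H2_H3: "\<exists>b \<beta>. b \<ge> 0
        \<and> (\<forall>s>b. f1 s > 0) \<and> (\<forall>s\<in>{0..b}. f1 s \<le> 0)
        \<and> (\<exists>\<epsilon>0>0. \<forall>s\<in>{0<..<\<epsilon>0}. f1 s < 0)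
        \<and> \<beta> \<ge> b \<and> integral {0..\<beta>} f1 = 0
        \<and> (\<forall>\<gamma>. \<gamma> \<ge> b \<and> integral {0..\<gamma>} f1 = 0 \<longrightarrow> \<gamma> = \<beta>)
        \<and> (\<forall>s>\<beta>. deriv (\<lambda>t. integral {0..t} f1 / f1 t) s > (real N - 2) / (2 * real N))
        \<and> mono_on {b<..} (\<lambda>s. f1 s / (s - b))"
    and H4: "\<exists>u. radial_ground_state N f1 u \<and> u 0 = \<alpha>s"
    and f2: "continuous_on {\<alpha>s..} f2" "\<forall>s\<ge>\<alpha>s. f2 s > 0"
    and f3: "continuous_on {\<alpha>s..} f3" "\<forall>s\<ge>\<alpha>s. f3 s > 0"
  shows "\<exists>\<alpha>1 \<epsilon>1 A2 \<alpha>2 \<epsilon>2 A3.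
      \<alpha>1 > \<alpha>s \<and> \<epsilon>1 > 0 \<and> A2 > 0 \<and> \<alpha>2 > \<alpha>1 + \<epsilon>1 \<and> \<epsilon>2 > 0 \<and> A3 > 0 \<and>
      (\<exists>u1 u2 u3.
         radial_ground_state N (glued f1 f2 f3 \<alpha>1 \<epsilon>1 A2 \<alpha>2 \<epsilon>2 A3) u1 \<and>
         radial_ground_state N (glued f1 f2 f3 \<alpha>1 \<epsilon>1 A2 \<alpha>2 \<epsilon>2 A3) u2 \<and>
         radial_ground_state N (glued f1 f2 f3 \<alpha>1 \<epsilon>1 A2 \<alpha>2 \<epsilon>2 A3) u3 \<and>
         (\<exists>r\<ge>0. u1 r \<noteq> u2 r) \<and> (\<exists>r\<ge>0. u1 r \<noteq> u3 r) \<and> (\<exists>r\<ge>0. u2 r \<noteq> u3 r))"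
proof -
  obtain n where Nn: "N = Suc n" "2 \<le> n" using N by (cases N) auto
  obtain b \<beta> \<epsilon>0 where b: "b \<ge> 0" and pos': "\<forall>s>b. f1 s > 0" and nonpos': "\<forall>s\<in>{0..b}. f1 s \<le> 0"
    and \<epsilon>0': "\<epsilon>0 > 0" "\<forall>s\<in>{0<..<\<epsilon>0}. f1 s < 0"
    and \<beta>: "\<beta> \<ge> b" "integral {0..\<beta>} f1 = 0"
    and H2': "\<forall>s>\<beta>. deriv (\<lambda>t. integral {0..t} f1 / f1 t) s > (real N - 2) / (2 * real N)"
    using H1_H2_H3 by (elim exE conjE) (rule that; assumption)
  have pos: "0 < f1 s" if "b < s" for s using pos' that by simp
  have nonpos: "f1 s \<le> 0" if "s \<in> {0..b}" for s using nonpos' that by simp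
  have H2: "(real N - 2) / (2 * real N) < deriv (\<lambda>t. integral {0..t} f1 / f1 t) s" if "\<beta> < s" for s
    using H2' that by simp
  have \<epsilon>0: "0 < \<epsilon>0" "\<And>s. 0 < s \<Longrightarrow> s < \<epsilon>0 \<Longrightarrow> f1 s < 0" using \<epsilon>0' by simp_all
  \<comment> \<open>With \<open>b = 0\<close> the function \<open>f1\<close> would be both positive
    and negative just above 0.\<close>
  have b0: "0 < b"
  proof (rule ccontr)
    assume "\<not> 0 < b"
    then show False using pos [of "\<epsilon>0 / 2"] \<epsilon>0(2) [of "\<epsilon>0 / 2"] \<epsilon>0(1) b by simp
  qed
  define f where "f s = f1 (max 0 s)" for s
  have ff1: "f s = f1 s" if "0 \<le> s" for s using that by (simp add: f_def)
  have f_cont: "continuous_on UNIV f"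
    unfolding f_def by (rule continuous_on_compose2 [OF H1_cont]) (auto intro!: continuous_intros)
  obtain F :: "real \<Rightarrow> real" where F: "\<And>s. (F has_real_derivative f s) (at s)" "F 0 = 0"
    by (rule antiderivative_exists [OF f_cont]) blast
  have F_cont: "continuous_on S F" for S
    by (intro continuous_at_imp_continuous_on ballI) (rule DERIV_isCont [OF F(1)])
  have F_int: "integral {0..s} f1 = F s" if s: "0 \<le> s" for s
  proof -
    have "(f1 has_integral F s - F 0) {0..s}"
    proof (rule fundamental_theorem_of_calculus [OF s])
      fix x assume "x \<in> {0..s}"
      then show "(F has_vector_derivative f1 x) (at x within {0..s})"
        using has_field_derivative_at_within [OF F(1) [of x]] ff1 [of x]
        by (simp add: has_real_derivative_iff_has_vector_derivative)
    qed
    then show ?thesis using F(2) by (simp add: integral_unique)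
  qed
  have F_anti: "F y \<le> F x" if "0 \<le> x" "x \<le> y" "y \<le> b" for x y
  proof (rule DERIV_nonpos_imp_nonincreasing [OF that(2)])
    fix z assume "x \<le> z" "z \<le> y"
    then show "\<exists>d. (F has_real_derivative d) (at z) \<and> d \<le> 0"
      using F(1) [of z] nonpos [of z] ff1 [of z] that by (intro exI [of _ "f z"]) auto
  qed
  \<comment> \<open>\<open>F\<close> becomes negative on \<open>(0, \<epsilon>0)\<close> and does
    not increase up to \<open>b\<close>.\<close>
  have F_neg_b: "F s < 0" if s: "0 < s" "s \<le> b" for s
  proof -
    define t where "t = min s (\<epsilon>0 / 2)"
    have t: "0 < t" "t \<le> s" "t < \<epsilon>0" using s \<epsilon>0(1) by (auto simp: t_def)
    obtain z where "0 < z" "z < t" "F t - F 0 = (t - 0) * f z"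
      by (rule real_mvt [OF t(1) F_cont F(1)])
    then have "F t < 0" using \<epsilon>0(2) [of z] ff1 [of z] t F(2) by (simp add: mult_pos_neg)
    then show ?thesis using F_anti [of t s] t s by simp
  qed
  have F\<beta>: "F \<beta> = 0" using F_int [of \<beta>] \<beta> b by simp
  have b\<beta>: "b < \<beta>" using F_neg_b [of b] b0 F\<beta> \<beta>(1) by (cases "b = \<beta>") auto
  have "well f F b \<beta>"
  proof
    show "f s = 0" if "s \<le> 0" for s using that H1_zero by (simp add: f_def)
    show "F s = 0" if s: "s \<le> 0" for s
    proof (cases "s = 0")
      case False
      then have s0: "s < 0" using s by simp
      obtain z where "s < z" "z < 0" "F 0 - F s = (0 - s) * f z"
        by (rule real_mvt [OF s0 F_cont F(1)])
      then show ?thesis using F(2) H1_zero by (simp add: f_def)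
    qed (use F in simp)
    show "f s \<le> 0" if "s \<le> b" for s
      using that nonpos [of "max 0 s"] b0 by (simp add: f_def)
    show "0 < f s" if "b < s" for s using pos [OF that] ff1 [of s] that b0 by simp
    show "F s < 0" if s: "0 < s" "s < \<beta>" for s
    proof (cases "s \<le> b")
      case False
      obtain z where "s < z" "z < \<beta>" "F \<beta> - F s = (\<beta> - s) * f z"
        by (rule real_mvt [OF s(2) F_cont F(1)])
      moreover have "0 < f z" using pos [of z] ff1 [of z] calculation False b0 by simp
      ultimately show ?thesis using F\<beta> s(2) by (smt (verit) mult_pos_pos)
    qed (use F_neg_b s in simp)
  qed (use f_cont F b0 b\<beta> F\<beta> in auto)
  then interpret well f F b \<beta> .
  obtain U where U: "radial_ground_state N f1 U" "U 0 = \<alpha>s" using H4 by blast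
  have U': "radial_ground_state (Suc n) f U"
    by (rule radial_ground_state_cong [OF U(1) [unfolded Nn(1)]])
       (rule ff1, rule radial_ground_state_nonneg [OF U(1)])
  have H2'': "\<exists>d. ((\<lambda>t. F t / f t) has_real_derivative d) (at s) \<and> (real n - 1) / (2 * (real n + 1)) < d"
    if s: "\<beta> < s" for s
  proof -
    have s0: "0 < s" "b < s" using s b0 b\<beta> by auto
    \<comment> \<open>\<open>deriv\<close> in (H2) is a genuine derivative, since \<open>f1\<close>
      is differentiable and positive at \<open>s\<close>.\<close>
    obtain f1' where "\<And>s. 0 < s \<Longrightarrow> (f1 has_real_derivative f1' s) (at s)" using H1_C1 by blast
    then have "(f1 has_real_derivative f1' s) (at s)" using s0 by blast
    then have "((\<lambda>t. F t / f1 t) has_real_derivative (f s * f1 s - F s * f1' s) / (f1 s * f1 s)) (at s)"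
      using pos [OF s0(2)] by (intro DERIV_divide F(1)) auto
    then obtain d where d: "((\<lambda>t. F t / f1 t) has_real_derivative d) (at s)" by blast
    have "((\<lambda>t. integral {0..t} f1 / f1 t) has_real_derivative d) (at s)"
      by (rule has_field_derivative_transform_within_open [OF d, of "{0<..}"]) (use s0 F_int in auto)
    then have "deriv (\<lambda>t. integral {0..t} f1 / f1 t) s = d" by (rule DERIV_imp_deriv)
    then have "(real n - 1) / (2 * (real n + 1)) < d" using H2 [OF s] by (simp add: Nn(1) add.commute)
    moreover have "((\<lambda>t. F t / f t) has_real_derivative d) (at s)"
      by (rule has_field_derivative_transform_within_open [OF d, of "{0<..}"]) (use s0 ff1 in auto)
    ultimately show ?thesis by blast
  qed
  have f2': "continuous_on {U 0..} f2" "\<And>s. U 0 \<le> s \<Longrightarrow> 0 < f2 s"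
    and f3': "continuous_on {U 0..} f3" "\<And>s. U 0 \<le> s \<Longrightarrow> 0 < f3 s"
    using f2 f3 unfolding U(2) by blast+
  obtain \<alpha>1 \<epsilon>1 A2 \<alpha>2 \<epsilon>2 A3 u2 u3 where
    par: "U 0 < \<alpha>1" "0 < \<epsilon>1" "0 < A2" "\<alpha>1 + \<epsilon>1 < \<alpha>2" "0 < \<epsilon>2" "0 < A3"
    and gs: "radial_ground_state (Suc n) (glued_pos f f2 f3 \<alpha>1 \<epsilon>1 A2 \<alpha>2 \<epsilon>2 A3) U"
      "radial_ground_state (Suc n) (glued_pos f f2 f3 \<alpha>1 \<epsilon>1 A2 \<alpha>2 \<epsilon>2 A3) u2"
      "radial_ground_state (Suc n) (glued_pos f f2 f3 \<alpha>1 \<epsilon>1 A2 \<alpha>2 \<epsilon>2 A3) u3"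
    and less: "U 0 < u2 0" "u2 0 < u3 0"
    by (rule three_glued_ground_states [OF Nn(2) H2'' U' f2' f3']; (assumption | (rule that; assumption)))
  note levels = par [unfolded U(2)]
  have "0 \<le> U 0" by (rule radial_ground_state_nonneg [OF U']) simp
  then have \<alpha>1: "0 \<le> \<alpha>1" using par(1) by simp
  \<comment> \<open>Ground states are nonnegative and meet only the nonnegative half of the odd
    extension.\<close>
  have glued: "radial_ground_state N (glued f1 f2 f3 \<alpha>1 \<epsilon>1 A2 \<alpha>2 \<epsilon>2 A3) u"
    if u: "radial_ground_state (Suc n) (glued_pos f f2 f3 \<alpha>1 \<epsilon>1 A2 \<alpha>2 \<epsilon>2 A3) u" for u
    unfolding Nn(1)
  proof (rule radial_ground_state_cong [OF u])
    fix r :: real assume "0 \<le> r"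
    then have "0 \<le> u r" by (rule radial_ground_state_nonneg [OF u])
    then show "glued f1 f2 f3 \<alpha>1 \<epsilon>1 A2 \<alpha>2 \<epsilon>2 A3 (u r) = glued_pos f f2 f3 \<alpha>1 \<epsilon>1 A2 \<alpha>2 \<epsilon>2 A3 (u r)"
      using \<alpha>1 by (simp add: glued_def glued_pos_def ff1)
  qed
  have distinct: "\<exists>r\<ge>0. U r \<noteq> u2 r" "\<exists>r\<ge>0. U r \<noteq> u3 r" "\<exists>r\<ge>0. u2 r \<noteq> u3 r"
    by (rule exI [of _ 0], use less in simp)+
  show ?thesis
    by (rule exI [of _ \<alpha>1], rule exI [of _ \<epsilon>1], rule exI [of _ A2], rule exI [of _ \<alpha>2],
        rule exI [of _ \<epsilon>2], rule exI [of _ A3], intro conjI, (rule levels)+,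
        rule exI [of _ U], rule exI [of _ u2], rule exI [of _ u3], intro conjI, (rule glued gs distinct)+)
qed

end
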